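(* Let $\mathcal{C}$ be a triangulated category of finite type whose numerical Grothendieck group has finite rank, let $\mathcal{D}$ be the perfect derived category of a smooth proper dg algebra, and let $S : \mathcal{C} \to \mathcal{D}$ be a spherical functor with right adjoint functor $R:\mathcal{D}\to\mathcal{C}$, twist functor $T_S$ and cotwist functor $C_S$. Assume that the essential image of $R$ contains a split-generator of $\mathcal{C}$. Assume moreover that $$h_0(C_S) \leq \log\rho([C_S])$$ and that there exists an element $v \in \mathcal{N}(\mathcal{C}) \otimes_\mathbb{Z} \mathbb{C}$ such that $[S]v \neq 0$ and $[C_S]v = \lambda v$ for some $\lambda\in\mathbb{C}$ with $|\lambda| = \rho([C_S])$. Then $$h_0(T_S) = \log\rho([T_S]).$$
   Context: Standing assumptions: all triangulated categories are linear over a field $\mathbb{K}$, admit a dg enhancement (i.e. are equivalent, as triangulated categories, to $H^0(\mathcal{A})$ for a pretriangulated dg category $\mathcal{A}$), and all exact functors between them admit dg lifts; cones of natural transformations are formed functorially via these. A triangulated category is assumed to have a split-generator whenever the categorical entropy of one of its endofunctors is considered. A dg algebra $A$ is smooth if $A$ is perfect as a dg bimodule over itself, and proper if it has finite dimensional total cohomology. Split-generator: an object $G$ of a triangulated category $\mathcal{D}$ such that the smallest full triangulated subcategory containing $G$ and closed under taking direct summands is $\mathcal{D}$. Categorical complexity: for objects $E,F$ of $\mathcal{D}$ and $t \in \mathbb{R}$, $\delta_t(E,F)=0$ if $F\cong 0$; otherwise $\delta_t(E,F) \in [0,\infty]$ is the infimum of $\sum_{i=1}^k e^{n_i t}$ over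 all sequences of integers $(n_1,\dots,n_k)$ for which there exist an object $F'$ and objects $0=A_0,A_1,\dots,A_k = F\oplus F'$ with exact triangles $A_{i-1}\to A_i \to E[n_i] \to A_{i-1}[1]$ for $i=1,\dots,k$. Categorical entropy of an exact endofunctor $\Phi$ of $\mathcal{D}$: $h_t(\Phi) = \lim_{n\to\infty}\frac1n\log\delta_t(G,\Phi^nG) \in [-\infty,\infty)$ for a split-generator $G$ (the limit exists and is independent of $G$). Spherical functor: an exact functor $S:\mathcal{C}\to\mathcal{D}$ with right and left adjoints $R,L$ such that (1) the twist functor $T_S=\mathrm{Cone}(SR\xrightarrow{\varepsilon}\mathrm{Id}_\mathcal{D})$ ($\varepsilon$ the counit of $S\dashv R$) is an exact autoequivalence of $\mathcal{D}$; (2) the cotwist functor $C_S=\mathrm{Cone}(\mathrm{Id}_\mathcal{C}\xrightarrow{\eta}RS)[-1]$ ($\eta$ the unit of $S\dashv R$) is an exact autoequivalence of $\mathcal{C}$; (3) $R\cong LT_S[-1]$; (4) $R\cong C_SL[1]$. Finite type: $\sum_{i\in\mathbb{Z}}\dim\mathrm{Hom}_\mathcal{D}(E,F[i])<\infty$ for all objects $E,F$. The Grothendieck group $K(\mathcal{D})$ is the free abelian group on objects modulo $E-F+G$ for each exact triangle $E\to F\to G\to E[1]$; for $\mathcal{D}$ of finite type, the Euler form is $\chi([E],[F])=\sum_i(-1)^i\dim\mathrm{Hom}_\mathcal{D}(E,F[i])$, and the numerical Grothendieck group is $\mathcal{N}(\mathcal{D})=K(\mathcal{D})/\langle[E] :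 \chi([E],-)=0\rangle$. Only triangulated categories whose numerical Grothendieck groups are of finite rank are considered. An exact functor $\Phi:\mathcal{C}\to\mathcal{D}$ admitting a right adjoint induces a linear map $[\Phi]:\mathcal{N}(\mathcal{C})\otimes_\mathbb{Z}\mathbb{C}\to\mathcal{N}(\mathcal{D})\otimes_\mathbb{Z}\mathbb{C}$. $\rho$ denotes the spectral radius (largest absolute value of the eigenvalues). *)

theory Defs
  imports
    "HOL-Analysis.Analysis"
    "HOL-Algebra.Free_Abelian_Groups"
    "HOL-Algebra.Generated_Groups"
    "HOL-Library.Function_Algebras"
begin

definition linear_on_subspace ::
  "('k \<Rightarrow> 'm \<Rightarrow> 'm) \<Rightarrow> ('k \<Rightarrow> 'n \<Rightarrow> 'n) \<Rightarrow> 'm::ab_group_add set \<Rightarrow> ('m \<Rightarrow> 'n::ab_group_add) \<Rightarrow> bool"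
where
  "linear_on_subspace s s' V f \<longleftrightarrow>
     (\<forall>x\<in>V. \<forall>y\<in>V. f (x + y) = f x + f y) \<and> (\<forall>c. \<forall>x\<in>V. f (s c x) = s' c (f x))"

definition fin_dim :: "('k::field \<Rightarrow> 'm \<Rightarrow> 'm) \<Rightarrow> 'm::ab_group_add set \<Rightarrow> bool" where
  "fin_dim s V \<longleftrightarrow> (\<exists>B. finite B \<and> V \<subseteq> module.span s B)"

definition ksign :: "int \<Rightarrow> 'm \<Rightarrow> 'm::ab_group_add" where
  "ksign n x = (if even n then x else - x)"


section \<open>Linear categories\<close>

text \<open>The morphisms of a category all live in one ambient vector space \<^typ>\<open>'m\<close>, and
  the morphism spaces are subspaces of it. This is no restriction: the morphism spaces of a small
  linear category embed into their direct sum, on which composition is a single bilinear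
  operation (zero on non-composable pairs).\<close>

record ('k, 'o, 'm) precategory =
  Ob :: "'o set"
  cmp :: "'m \<Rightarrow> 'm \<Rightarrow> 'm"  (infixr "\<odot>\<index>" 70)
  idn :: "'o \<Rightarrow> 'm"
  smul :: "'k \<Rightarrow> 'm \<Rightarrow> 'm"

record ('k, 'o, 'm) lincat = "('k, 'o, 'm) precategory" +
  Hom :: "'o \<Rightarrow> 'o \<Rightarrow> 'm set"

locale linear_category =
  fixes C :: "('k::field, 'o, 'm::ab_group_add, 'z) lincat_scheme" (structure)
  assumes vs: "vector_space (smul C)"
    and hom_subspace: "\<lbrakk>X \<in> Ob C; Y \<in> Ob C\<rbrakk> \<Longrightarrow> module.subspace (smul C) (Hom C X Y)"
    and idn_hom: "X \<in> Ob C \<Longrightarrow> idn C X \<in> Hom C X X"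
    and cmp_hom: "\<lbrakk>X \<in> Ob C; Y \<in> Ob C; Z \<in> Ob C; f \<in> Hom C X Y; g \<in> Hom C Y Z\<rbrakk>
        \<Longrightarrow> g \<odot> f \<in> Hom C X Z"
    and cmp_lin_right: "\<lbrakk>X \<in> Ob C; Y \<in> Ob C; Z \<in> Ob C; g \<in> Hom C Y Z\<rbrakk>
        \<Longrightarrow> linear_on_subspace (smul C) (smul C) (Hom C X Y) (\<lambda>f. g \<odot> f)"
    and cmp_lin_left: "\<lbrakk>X \<in> Ob C; Y \<in> Ob C; Z \<in> Ob C; f \<in> Hom C X Y\<rbrakk>
        \<Longrightarrow> linear_on_subspace (smul C) (smul C) (Hom C Y Z) (\<lambda>g. g \<odot> f)"
    and cmp_assoc: "\<lbrakk>W \<in> Ob C; X \<in> Ob C; Y \<in> Ob C; Z \<in> Ob C;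
        f \<in> Hom C W X; g \<in> Hom C X Y; h \<in> Hom C Y Z\<rbrakk> \<Longrightarrow> (h \<odot> g) \<odot> f = h \<odot> (g \<odot> f)"
    and cmp_idn_left: "\<lbrakk>X \<in> Ob C; Y \<in> Ob C; f \<in> Hom C X Y\<rbrakk> \<Longrightarrow> idn C Y \<odot> f = f"
    and cmp_idn_right: "\<lbrakk>X \<in> Ob C; Y \<in> Ob C; f \<in> Hom C X Y\<rbrakk> \<Longrightarrow> f \<odot> idn C X = f"

definition iso_mor :: "('k, 'o, 'm, 'z) lincat_scheme \<Rightarrow> 'o \<Rightarrow> 'o \<Rightarrow> 'm \<Rightarrow> bool" where
  "iso_mor C X Y f \<longleftrightarrow> f \<in> Hom C X Y \<and>
     (\<exists>g \<in> Hom C Y X. g \<odot>\<^bsub>C\<^esub> f = idn C X \<and> f \<odot>\<^bsub>C\<^esub> g = idn C Y)"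

definition iso_ob :: "('k, 'o, 'm, 'z) lincat_scheme \<Rightarrow> 'o \<Rightarrow> 'o \<Rightarrow> bool" where
  "iso_ob C X Y \<longleftrightarrow> (\<exists>f. iso_mor C X Y f)"

definition zero_ob :: "('k, 'o, 'm::ab_group_add, 'z) lincat_scheme \<Rightarrow> 'o \<Rightarrow> bool" where
  "zero_ob C X \<longleftrightarrow> X \<in> Ob C \<and> idn C X = 0"

definition direct_sum ::
  "('k, 'o, 'm::ab_group_add, 'z) lincat_scheme \<Rightarrow> 'o \<Rightarrow> 'o \<Rightarrow> 'o \<Rightarrow> bool"
where
  "direct_sum C X Y S \<longleftrightarrow> S \<in> Ob C \<and>
     (\<exists>i \<in> Hom C X S. \<exists>j \<in> Hom C Y S. \<exists>p \<in> Hom C S X. \<exists>q \<in> Hom C S Y.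
        p \<odot>\<^bsub>C\<^esub> i = idn C X \<and> q \<odot>\<^bsub>C\<^esub> j = idn C Y \<and> p \<odot>\<^bsub>C\<^esub> j = 0 \<and> q \<odot>\<^bsub>C\<^esub> i = 0 \<and>
        i \<odot>\<^bsub>C\<^esub> p + j \<odot>\<^bsub>C\<^esub> q = idn C S)"


subsection \<open>Functors and natural transformations\<close>

record ('o1, 'm1, 'o2, 'm2) fnct =
  fob :: "'o1 \<Rightarrow> 'o2"
  fmap :: "'o1 \<Rightarrow> 'o1 \<Rightarrow> 'm1 \<Rightarrow> 'm2"

definition fcomp :: "('o2, 'm2, 'o3, 'm3) fnct \<Rightarrow> ('o1, 'm1, 'o2, 'm2) fnct
    \<Rightarrow> ('o1, 'm1, 'o3, 'm3) fnct"  (infixr "\<circ>\<^sub>F" 75) where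
  "G \<circ>\<^sub>F F = \<lparr>fob = fob G \<circ> fob F,
             fmap = (\<lambda>X Y f. fmap G (fob F X) (fob F Y) (fmap F X Y f))\<rparr>"

definition id_fnct :: "('o, 'm, 'o, 'm) fnct" where
  "id_fnct = \<lparr>fob = (\<lambda>X. X), fmap = (\<lambda>X Y f. f)\<rparr>"

definition lin_functor ::
  "('k, 'o1, 'm1::ab_group_add, 'z1) lincat_scheme \<Rightarrow>
   ('k, 'o2, 'm2::ab_group_add, 'z2) lincat_scheme \<Rightarrow> ('o1, 'm1, 'o2, 'm2) fnct \<Rightarrow> bool"
where
  "lin_functor C D F \<longleftrightarrow>
     fob F ` Ob C \<subseteq> Ob D \<and>
     (\<forall>X\<in>Ob C. \<forall>Y\<in>Ob C. fmap F X Y ` Hom C X Y \<subseteq> Hom D (fob F X) (fob F Y) \<and>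
        linear_on_subspace (smul C) (smul D) (Hom C X Y) (fmap F X Y)) \<and>
     (\<forall>X\<in>Ob C. fmap F X X (idn C X) = idn D (fob F X)) \<and>
     (\<forall>X\<in>Ob C. \<forall>Y\<in>Ob C. \<forall>Z\<in>Ob C. \<forall>f\<in>Hom C X Y. \<forall>g\<in>Hom C Y Z.
        fmap F X Z (g \<odot>\<^bsub>C\<^esub> f) = fmap F Y Z g \<odot>\<^bsub>D\<^esub> fmap F X Y f)"

definition equivalence ::
  "('k, 'o1, 'm1::ab_group_add, 'z1) lincat_scheme \<Rightarrow>
   ('k, 'o2, 'm2::ab_group_add, 'z2) lincat_scheme \<Rightarrow> ('o1, 'm1, 'o2, 'm2) fnct \<Rightarrow> bool"
where
  "equivalence C D F \<longleftrightarrow> lin_functor C D F \<and>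
     (\<forall>X\<in>Ob C. \<forall>Y\<in>Ob C.
        bij_betw (fmap F X Y) (Hom C X Y) (Hom D (fob F X) (fob F Y))) \<and>
     (\<forall>Y\<in>Ob D. \<exists>X\<in>Ob C. iso_ob D (fob F X) Y)"

definition nat_trans ::
  "('k, 'o1, 'm1, 'z1) lincat_scheme \<Rightarrow> ('k, 'o2, 'm2, 'z2) lincat_scheme \<Rightarrow>
   ('o1, 'm1, 'o2, 'm2) fnct \<Rightarrow> ('o1, 'm1, 'o2, 'm2) fnct \<Rightarrow> ('o1 \<Rightarrow> 'm2) \<Rightarrow> bool"
where
  "nat_trans C D F G \<alpha> \<longleftrightarrow>
     (\<forall>X\<in>Ob C. \<alpha> X \<in> Hom D (fob F X) (fob G X)) \<and>
     (\<forall>X\<in>Ob C. \<forall>Y\<in>Ob C. \<forall>f\<in>Hom C X Y.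
        \<alpha> Y \<odot>\<^bsub>D\<^esub> fmap F X Y f = fmap G X Y f \<odot>\<^bsub>D\<^esub> \<alpha> X)"

definition nat_iso ::
  "('k, 'o1, 'm1, 'z1) lincat_scheme \<Rightarrow> ('k, 'o2, 'm2, 'z2) lincat_scheme \<Rightarrow>
   ('o1, 'm1, 'o2, 'm2) fnct \<Rightarrow> ('o1, 'm1, 'o2, 'm2) fnct \<Rightarrow> ('o1 \<Rightarrow> 'm2) \<Rightarrow> bool"
where
  "nat_iso C D F G \<alpha> \<longleftrightarrow> nat_trans C D F G \<alpha> \<and>
     (\<forall>X\<in>Ob C. iso_mor D (fob F X) (fob G X) (\<alpha> X))"

definition isomorphic_functors ::
  "('k, 'o1, 'm1, 'z1) lincat_scheme \<Rightarrow> ('k, 'o2, 'm2, 'z2) lincat_scheme \<Rightarrow>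
   ('o1, 'm1, 'o2, 'm2) fnct \<Rightarrow> ('o1, 'm1, 'o2, 'm2) fnct \<Rightarrow> bool"
where
  "isomorphic_functors C D F G \<longleftrightarrow> (\<exists>\<alpha>. nat_iso C D F G \<alpha>)"

definition adjunction ::
  "('k, 'o1, 'm1::ab_group_add, 'z1) lincat_scheme \<Rightarrow>
   ('k, 'o2, 'm2::ab_group_add, 'z2) lincat_scheme \<Rightarrow>
   ('o1, 'm1, 'o2, 'm2) fnct \<Rightarrow> ('o2, 'm2, 'o1, 'm1) fnct \<Rightarrow>
   ('o1 \<Rightarrow> 'm1) \<Rightarrow> ('o2 \<Rightarrow> 'm2) \<Rightarrow> bool"
  \<comment> \<open>\<open>F\<close> is left adjoint to \<open>G\<close> with unit \<open>\<eta>\<close> and counit \<open>\<epsilon>\<close>\<close>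
where
  "adjunction C D F G \<eta> \<epsilon> \<longleftrightarrow>
     nat_trans C C id_fnct (G \<circ>\<^sub>F F) \<eta> \<and> nat_trans D D (F \<circ>\<^sub>F G) id_fnct \<epsilon> \<and>
     (\<forall>X\<in>Ob C. \<epsilon> (fob F X) \<odot>\<^bsub>D\<^esub> fmap F X (fob G (fob F X)) (\<eta> X) = idn D (fob F X)) \<and>
     (\<forall>Y\<in>Ob D. fmap G (fob F (fob G Y)) Y (\<epsilon> Y) \<odot>\<^bsub>C\<^esub> \<eta> (fob G Y) = idn C (fob G Y))"


section \<open>Triangulated categories\<close>

text \<open>The translation functor is, as in Verdier's definition, an automorphism; \<open>shift C n\<close> is its
  \<open>n\<close>-th power, so that \<open>E[n]\<close> is \<open>fob (shift C n) E\<close>. The predicate \<open>tri C X Y Z f g h\<close> says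
  that \<open>X \<rightarrow> Y \<rightarrow> Z \<rightarrow> X[1]\<close> (with maps \<open>f\<close>, \<open>g\<close>, \<open>h\<close>) is an exact triangle.\<close>

record ('k, 'o, 'm) tricat = "('k, 'o, 'm) lincat" +
  shift :: "int \<Rightarrow> ('o, 'm, 'o, 'm) fnct"
  tri :: "'o \<Rightarrow> 'o \<Rightarrow> 'o \<Rightarrow> 'm \<Rightarrow> 'm \<Rightarrow> 'm \<Rightarrow> bool"

abbreviation sh_ob :: "('k, 'o, 'm) tricat \<Rightarrow> int \<Rightarrow> 'o \<Rightarrow> 'o" where
  "sh_ob C n X \<equiv> fob (shift C n) X"

abbreviation sh_map :: "('k, 'o, 'm) tricat \<Rightarrow> int \<Rightarrow> 'o \<Rightarrow> 'o \<Rightarrow> 'm \<Rightarrow> 'm" where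
  "sh_map C n X Y f \<equiv> fmap (shift C n) X Y f"

locale triangulated_category = linear_category C
  for C :: "('k::field, 'o, 'm::ab_group_add) tricat" (structure) +
  assumes ex_zero: "\<exists>X. zero_ob C X"
    and ex_direct_sum: "\<lbrakk>X \<in> Ob C; Y \<in> Ob C\<rbrakk> \<Longrightarrow> \<exists>S. direct_sum C X Y S"
    and shift_functor: "lin_functor C C (shift C n)"
    and shift_zero: "X \<in> Ob C \<Longrightarrow> sh_ob C 0 X = X"
      "\<lbrakk>X \<in> Ob C; Y \<in> Ob C; f \<in> Hom C X Y\<rbrakk> \<Longrightarrow> sh_map C 0 X Y f = f"
    and shift_add: "X \<in> Ob C \<Longrightarrow> sh_ob C (m + n) X = sh_ob C m (sh_ob C n X)"
      "\<lbrakk>X \<in> Ob C; Y \<in> Ob C; f \<in> Hom C X Y\<rbrakk> \<Longrightarrow>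
         sh_map C (m + n) X Y f = sh_map C m (sh_ob C n X) (sh_ob C n Y) (sh_map C n X Y f)"
    and tri_type: "tri C X Y Z f g h \<Longrightarrow> X \<in> Ob C \<and> Y \<in> Ob C \<and> Z \<in> Ob C \<and>
         f \<in> Hom C X Y \<and> g \<in> Hom C Y Z \<and> h \<in> Hom C Z (sh_ob C 1 X)"
    and tri_iso: "\<lbrakk>tri C X Y Z f g h; X' \<in> Ob C; Y' \<in> Ob C; Z' \<in> Ob C;
         f' \<in> Hom C X' Y'; g' \<in> Hom C Y' Z'; h' \<in> Hom C Z' (sh_ob C 1 X');
         iso_mor C X X' a; iso_mor C Y Y' b; iso_mor C Z Z' c;
         b \<odot> f = f' \<odot> a; c \<odot> g = g' \<odot> b; sh_map C 1 X X' a \<odot> h = h' \<odot> c\<rbrakk>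
         \<Longrightarrow> tri C X' Y' Z' f' g' h'"
    and tri_idn: "\<lbrakk>X \<in> Ob C; zero_ob C Z\<rbrakk> \<Longrightarrow> tri C X X Z (idn C X) 0 0"
    and tri_ex: "\<lbrakk>X \<in> Ob C; Y \<in> Ob C; f \<in> Hom C X Y\<rbrakk> \<Longrightarrow> \<exists>Z g h. tri C X Y Z f g h"
    and tri_rotate: "\<lbrakk>X \<in> Ob C; Y \<in> Ob C; Z \<in> Ob C;
         f \<in> Hom C X Y; g \<in> Hom C Y Z; h \<in> Hom C Z (sh_ob C 1 X)\<rbrakk> \<Longrightarrow>
         tri C X Y Z f g h \<longleftrightarrow> tri C Y Z (sh_ob C 1 X) g h (- sh_map C 1 X Y f)"
    and tri_complete: "\<lbrakk>tri C X Y Z f g h; tri C X' Y' Z' f' g' h';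
         a \<in> Hom C X X'; b \<in> Hom C Y Y'; b \<odot> f = f' \<odot> a\<rbrakk> \<Longrightarrow>
         \<exists>c \<in> Hom C Z Z'. c \<odot> g = g' \<odot> b \<and> sh_map C 1 X X' a \<odot> h = h' \<odot> c"
    and octahedral: "\<lbrakk>tri C X Y Z' f i p; tri C Y Z X' g j q; tri C X Z Y' (g \<odot> f) k r\<rbrakk> \<Longrightarrow>
         \<exists>u v. tri C Z' Y' X' u v (sh_map C 1 Y Z' i \<odot> q) \<and>
           u \<odot> i = k \<odot> g \<and> v \<odot> k = j \<and> r \<odot> u = p \<and> q \<odot> v = sh_map C 1 X Y f \<odot> r"

definition exact_functor ::
  "('k, 'o1, 'm1::ab_group_add) tricat \<Rightarrow> ('k, 'o2, 'm2::ab_group_add) tricat \<Rightarrow>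
   ('o1, 'm1, 'o2, 'm2) fnct \<Rightarrow> bool"
where
  "exact_functor C D F \<longleftrightarrow> lin_functor C D F \<and>
     (\<exists>\<sigma>. nat_iso C D (F \<circ>\<^sub>F shift C 1) (shift D 1 \<circ>\<^sub>F F) \<sigma> \<and>
        (\<forall>X Y Z f g h. tri C X Y Z f g h \<longrightarrow>
           tri D (fob F X) (fob F Y) (fob F Z) (fmap F X Y f) (fmap F Y Z g)
             (\<sigma> X \<odot>\<^bsub>D\<^esub> fmap F Z (sh_ob C 1 X) h)))"

definition exact_autoequivalence ::
  "('k, 'o, 'm::ab_group_add) tricat \<Rightarrow> ('o, 'm, 'o, 'm) fnct \<Rightarrow> bool"
where
  "exact_autoequivalence C F \<longleftrightarrow> exact_functor C C F \<and> equivalence C C F"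

inductive_set thick_closure :: "('k, 'o, 'm::ab_group_add) tricat \<Rightarrow> 'o \<Rightarrow> 'o set"
  for C :: "('k, 'o, 'm::ab_group_add) tricat" and G :: 'o
where
  gen: "G \<in> Ob C \<Longrightarrow> G \<in> thick_closure C G"
| shift: "X \<in> thick_closure C G \<Longrightarrow> sh_ob C n X \<in> thick_closure C G"
| cone: "\<lbrakk>X \<in> thick_closure C G; Y \<in> thick_closure C G; tri C X Y Z f g h\<rbrakk>
    \<Longrightarrow> Z \<in> thick_closure C G"
| iso: "\<lbrakk>X \<in> thick_closure C G; Y \<in> Ob C; iso_ob C X Y\<rbrakk> \<Longrightarrow> Y \<in> thick_closure C G"
| summand: "\<lbrakk>S \<in> thick_closure C G; X \<in> Ob C; Y \<in> Ob C; direct_sum C X Y S\<rbrakk>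
    \<Longrightarrow> X \<in> thick_closure C G"

definition split_generator :: "('k, 'o, 'm::ab_group_add) tricat \<Rightarrow> 'o \<Rightarrow> bool" where
  "split_generator C G \<longleftrightarrow> G \<in> Ob C \<and> thick_closure C G = Ob C"


subsection \<open>Categorical entropy\<close>

definition complexity ::
  "('k, 'o, 'm::ab_group_add) tricat \<Rightarrow> real \<Rightarrow> 'o \<Rightarrow> 'o \<Rightarrow> ereal"
where
  "complexity C t E F = (if zero_ob C F then 0 else
     Inf {ereal (\<Sum>i=1..k. exp (real_of_int (n i) * t)) | (k::nat) (n :: nat \<Rightarrow> int).
            \<exists>F' A. F' \<in> Ob C \<and> zero_ob C (A 0) \<and> direct_sum C F F' (A k) \<and>
              (\<forall>i\<in>{1..k}. \<exists>f g h. tri C (A (i - 1)) (A i) (sh_ob C (n i) E) f g h)})"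

definition elog :: "ereal \<Rightarrow> ereal" where
  "elog x = (if x \<le> 0 then - \<infinity> else if x = \<infinity> then \<infinity> else ereal (ln (real_of_ereal x)))"

definition entropy ::
  "('k, 'o, 'm::ab_group_add) tricat \<Rightarrow> real \<Rightarrow> ('o, 'm, 'o, 'm) fnct \<Rightarrow> ereal"
where
  "entropy C t \<Phi> = (THE h. \<forall>G. split_generator C G \<longrightarrow>
     (\<lambda>n. elog (complexity C t G ((fob \<Phi> ^^ n) G)) / ereal (real n)) \<longlonglongrightarrow> h)"


subsection \<open>Numerical Grothendieck group\<close>

definition finite_type :: "('k::field, 'o, 'm::ab_group_add) tricat \<Rightarrow> bool" where
  "finite_type C \<longleftrightarrow> (\<forall>E\<in>Ob C. \<forall>F\<in>Ob C.
     finite {i. Hom C E (sh_ob C i F) \<noteq> {0}} \<and> (\<forall>i. fin_dim (smul C) (Hom C E (sh_ob C i F))))"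

definition euler_form :: "('k::field, 'o, 'm::ab_group_add) tricat \<Rightarrow> 'o \<Rightarrow> 'o \<Rightarrow> int" where
  "euler_form C E F = (\<Sum>i | Hom C E (sh_ob C i F) \<noteq> {0}.
     ksign i (int (vector_space.dim (smul C) (Hom C E (sh_ob C i F)))))"

definition grothendieck_relations :: "('k, 'o, 'm) tricat \<Rightarrow> ('o \<Rightarrow>\<^sub>0 int) set" where
  "grothendieck_relations C =
     {frag_of X - frag_of Y + frag_of Z | X Y Z. \<exists>f g h. tri C X Y Z f g h}"

definition K_subgroup :: "('k, 'o, 'm) tricat \<Rightarrow> ('o \<Rightarrow>\<^sub>0 int) set" where
  "K_subgroup C = generate (free_Abelian_group (Ob C)) (grothendieck_relations C)"

definition K_group :: "('k, 'o, 'm) tricat \<Rightarrow> ('o \<Rightarrow>\<^sub>0 int) set monoid" where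
  "K_group C = free_Abelian_group (Ob C) Mod K_subgroup C"

definition K_class :: "('k, 'o, 'm) tricat \<Rightarrow> 'o \<Rightarrow> ('o \<Rightarrow>\<^sub>0 int) set" where
  "K_class C E = K_subgroup C #>\<^bsub>free_Abelian_group (Ob C)\<^esub> frag_of E"

definition num_radical :: "('k::field, 'o, 'm::ab_group_add) tricat \<Rightarrow> ('o \<Rightarrow>\<^sub>0 int) set set" where
  "num_radical C =
     generate (K_group C) {K_class C E | E. E \<in> Ob C \<and> (\<forall>F\<in>Ob C. euler_form C E F = 0)}"

definition N_group ::
  "('k::field, 'o, 'm::ab_group_add) tricat \<Rightarrow> ('o \<Rightarrow>\<^sub>0 int) set set monoid"
where
  "N_group C = K_group C Mod num_radical C"

definition N_class ::
  "('k::field, 'o, 'm::ab_group_add) tricat \<Rightarrow> 'o \<Rightarrow> ('o \<Rightarrow>\<^sub>0 int) set set"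
where
  "N_class C E = num_radical C #>\<^bsub>K_group C\<^esub> K_class C E"

definition finite_rank :: "('g, 'z) monoid_scheme \<Rightarrow> bool" where
  "finite_rank G \<longleftrightarrow> (\<exists>F. finite F \<and> F \<subseteq> carrier G \<and>
     (\<forall>x\<in>carrier G. \<exists>m::nat. m > 0 \<and> x [^]\<^bsub>G\<^esub> m \<in> generate G F))"

text \<open>Over a field, \<open>V \<otimes> W\<close> embeds into the dual of the space of bilinear forms on
  \<open>V \<times> W\<close>, as the span of the functionals \<open>\<beta> \<mapsto> \<beta>(v, w)\<close>. Tensor products are realised in this way.
  For \<open>G \<otimes>\<^sub>\<int> \<complex>\<close> the relevant forms \<open>G \<times> \<complex> \<rightarrow> \<complex>\<close> (additive in the first, complex linear in
  the second variable) are the additive maps \<open>G \<rightarrow> \<complex>\<close>, and \<open>G \<otimes>\<^sub>\<int> \<complex>\<close> is spanned by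
  the images \<open>g \<otimes> 1\<close> of the elements of \<open>G\<close>.\<close>

definition pointwise :: "('k \<Rightarrow> 'm \<Rightarrow> 'm) \<Rightarrow> 'k \<Rightarrow> ('i \<Rightarrow> 'm) \<Rightarrow> ('i \<Rightarrow> 'm)" where
  "pointwise s c f = (\<lambda>i. s c (f i))"

definition additive_on :: "('g, 'z) monoid_scheme \<Rightarrow> ('g \<Rightarrow> complex) \<Rightarrow> bool" where
  "additive_on G \<phi> \<longleftrightarrow> (\<forall>x\<in>carrier G. \<forall>y\<in>carrier G. \<phi> (x \<otimes>\<^bsub>G\<^esub> y) = \<phi> x + \<phi> y)"

definition tensor_one :: "('g, 'z) monoid_scheme \<Rightarrow> 'g \<Rightarrow> ('g \<Rightarrow> complex) \<Rightarrow> complex" where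
  "tensor_one G x = (\<lambda>\<phi>. if additive_on G \<phi> then \<phi> x else 0)"

definition tensor_complex :: "('g, 'z) monoid_scheme \<Rightarrow> (('g \<Rightarrow> complex) \<Rightarrow> complex) set" where
  "tensor_complex G = module.span (pointwise (*)) (tensor_one G ` carrier G)"

type_synonym 'o num_vec = "((('o \<Rightarrow>\<^sub>0 int) set set) \<Rightarrow> complex) \<Rightarrow> complex"

abbreviation cscale :: "complex \<Rightarrow> ('i \<Rightarrow> complex) \<Rightarrow> 'i \<Rightarrow> complex" where
  "cscale \<equiv> pointwise (*)"

definition N_complex :: "('k::field, 'o, 'm::ab_group_add) tricat \<Rightarrow> 'o num_vec set" where
  "N_complex C = tensor_complex (N_group C)"

text \<open>The map \<open>[\<Phi>]\<close> is the linear map sending \<open>[E] \<otimes> 1\<close> to \<open>[\<Phi> E] \<otimes> 1\<close> for all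
  objects \<open>E\<close>, unique because these vectors span.\<close>

definition N_map ::
  "('k::field, 'o1, 'm1::ab_group_add) tricat \<Rightarrow> ('k, 'o2, 'm2::ab_group_add) tricat \<Rightarrow>
   ('o1, 'm1, 'o2, 'm2) fnct \<Rightarrow> 'o1 num_vec \<Rightarrow> 'o2 num_vec"
where
  "N_map C D \<Phi> = (THE f. f \<in> extensional (N_complex C) \<and>
     f ` N_complex C \<subseteq> N_complex D \<and>
     linear_on_subspace cscale cscale (N_complex C) f \<and>
     (\<forall>E\<in>Ob C. f (tensor_one (N_group C) (N_class C E))
                 = tensor_one (N_group D) (N_class D (fob \<Phi> E))))"

definition spectral_radius :: "('i \<Rightarrow> complex) set \<Rightarrow> (('i \<Rightarrow> complex) \<Rightarrow> ('i \<Rightarrow> complex)) \<Rightarrow> real" where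
  "spectral_radius V f = Max {cmod \<mu> | \<mu>. \<exists>v\<in>V. v \<noteq> 0 \<and> f v = cscale \<mu> v}"

definition num_spectral_radius ::
  "('k::field, 'o, 'm::ab_group_add) tricat \<Rightarrow> ('o, 'm, 'o, 'm) fnct \<Rightarrow> real"
where
  "num_spectral_radius C \<Phi> = spectral_radius (N_complex C) (N_map C C \<Phi>)"


section \<open>Dg categories and dg enhancements\<close>

record ('k, 'o, 'm) dgcat = "('k, 'o, 'm) precategory" +
  dHom :: "'o \<Rightarrow> 'o \<Rightarrow> int \<Rightarrow> 'm set"
  dif :: "'o \<Rightarrow> 'o \<Rightarrow> 'm \<Rightarrow> 'm"

locale dg_category =
  fixes A :: "('k::field, 'o, 'm::ab_group_add) dgcat" (structure)
  assumes vs: "vector_space (smul A)"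
    and dhom_subspace: "\<lbrakk>X \<in> Ob A; Y \<in> Ob A\<rbrakk> \<Longrightarrow> module.subspace (smul A) (dHom A X Y n)"
    and idn_hom: "X \<in> Ob A \<Longrightarrow> idn A X \<in> dHom A X X 0"
    and cmp_hom: "\<lbrakk>X \<in> Ob A; Y \<in> Ob A; Z \<in> Ob A; f \<in> dHom A X Y m; g \<in> dHom A Y Z n\<rbrakk>
        \<Longrightarrow> g \<odot> f \<in> dHom A X Z (n + m)"
    and cmp_lin_right: "\<lbrakk>X \<in> Ob A; Y \<in> Ob A; Z \<in> Ob A; g \<in> dHom A Y Z n\<rbrakk>
        \<Longrightarrow> linear_on_subspace (smul A) (smul A) (dHom A X Y m) (\<lambda>f. g \<odot> f)"
    and cmp_lin_left: "\<lbrakk>X \<in> Ob A; Y \<in> Ob A; Z \<in> Ob A; f \<in> dHom A X Y m\<rbrakk>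
        \<Longrightarrow> linear_on_subspace (smul A) (smul A) (dHom A Y Z n) (\<lambda>g. g \<odot> f)"
    and cmp_assoc: "\<lbrakk>W \<in> Ob A; X \<in> Ob A; Y \<in> Ob A; Z \<in> Ob A;
        f \<in> dHom A W X l; g \<in> dHom A X Y m; h \<in> dHom A Y Z n\<rbrakk>
        \<Longrightarrow> (h \<odot> g) \<odot> f = h \<odot> (g \<odot> f)"
    and cmp_idn_left: "\<lbrakk>X \<in> Ob A; Y \<in> Ob A; f \<in> dHom A X Y n\<rbrakk> \<Longrightarrow> idn A Y \<odot> f = f"
    and cmp_idn_right: "\<lbrakk>X \<in> Ob A; Y \<in> Ob A; f \<in> dHom A X Y n\<rbrakk> \<Longrightarrow> f \<odot> idn A X = f"
    and dif_hom: "\<lbrakk>X \<in> Ob A; Y \<in> Ob A; f \<in> dHom A X Y n\<rbrakk> \<Longrightarrow> dif A X Y f \<in> dHom A X Y (n + 1)"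
    and dif_lin: "\<lbrakk>X \<in> Ob A; Y \<in> Ob A\<rbrakk>
        \<Longrightarrow> linear_on_subspace (smul A) (smul A) (dHom A X Y n) (dif A X Y)"
    and dif_dif: "\<lbrakk>X \<in> Ob A; Y \<in> Ob A; f \<in> dHom A X Y n\<rbrakk> \<Longrightarrow> dif A X Y (dif A X Y f) = 0"
    and leibniz: "\<lbrakk>X \<in> Ob A; Y \<in> Ob A; Z \<in> Ob A; f \<in> dHom A X Y m; g \<in> dHom A Y Z n\<rbrakk>
        \<Longrightarrow> dif A X Z (g \<odot> f) = dif A Y Z g \<odot> f + ksign n (g \<odot> dif A X Y f)"

definition cocycles ::
  "('k, 'o, 'm::ab_group_add) dgcat \<Rightarrow> 'o \<Rightarrow> 'o \<Rightarrow> int \<Rightarrow> 'm set"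
where
  "cocycles A X Y n = {f \<in> dHom A X Y n. dif A X Y f = 0}"

definition coboundaries ::
  "('k, 'o, 'm::ab_group_add) dgcat \<Rightarrow> 'o \<Rightarrow> 'o \<Rightarrow> int \<Rightarrow> 'm set"
where
  "coboundaries A X Y n = dif A X Y ` dHom A X Y (n - 1)"

text \<open>\<open>u\<close> exhibits \<open>X'\<close> as the shift \<open>X[n]\<close>, up to homotopy equivalence.\<close>

definition dg_shift ::
  "('k, 'o, 'm::ab_group_add) dgcat \<Rightarrow> int \<Rightarrow> 'o \<Rightarrow> 'o \<Rightarrow> 'm \<Rightarrow> 'm \<Rightarrow> bool"
where
  "dg_shift A n X X' u v \<longleftrightarrow> X \<in> Ob A \<and> X' \<in> Ob A \<and>
     u \<in> cocycles A X X' (- n) \<and> v \<in> cocycles A X' X n \<and>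
     v \<odot>\<^bsub>A\<^esub> u - idn A X \<in> coboundaries A X X 0 \<and> u \<odot>\<^bsub>A\<^esub> v - idn A X' \<in> coboundaries A X' X' 0"

text \<open>\<open>Z\<close>, with \<open>i : Y \<rightarrow> Z\<close> closed of degree 0 and \<open>j : X \<rightarrow> Z\<close> of degree \<open>-1\<close> with \<open>dj = i f\<close>,
  represents the cone of the closed degree 0 morphism \<open>f : X \<rightarrow> Y\<close> up to homotopy equivalence: for
  every object \<open>W\<close> the map \<open>(x, y) \<mapsto> j x + i y\<close> from the mapping cone of
  \<open>f : Hom(W, X) \<rightarrow> Hom(W, Y)\<close>, whose differential is \<open>(x, y) \<mapsto> (- dx, dy + f x)\<close>, to
  \<open>Hom(W, Z)\<close> is surjective and injective on cohomology.\<close>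

definition dg_cone ::
  "('k, 'o, 'm::ab_group_add) dgcat \<Rightarrow> 'o \<Rightarrow> 'o \<Rightarrow> 'm \<Rightarrow> 'o \<Rightarrow> 'm \<Rightarrow> 'm \<Rightarrow> bool"
where
  "dg_cone A X Y f Z i j \<longleftrightarrow> X \<in> Ob A \<and> Y \<in> Ob A \<and> Z \<in> Ob A \<and>
     f \<in> cocycles A X Y 0 \<and> i \<in> cocycles A Y Z 0 \<and>
     j \<in> dHom A X Z (- 1) \<and> dif A X Z j = i \<odot>\<^bsub>A\<^esub> f \<and>
     (\<forall>W\<in>Ob A. \<forall>n.
        (\<forall>z\<in>cocycles A W Z n. \<exists>x\<in>cocycles A W X (n + 1). \<exists>y\<in>dHom A W Y n.
            dif A W Y y = - (f \<odot>\<^bsub>A\<^esub> x) \<and> j \<odot>\<^bsub>A\<^esub> x + i \<odot>\<^bsub>A\<^esub> y - z \<in> coboundaries A W Z n) \<and>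
        (\<forall>x\<in>cocycles A W X (n + 1). \<forall>y\<in>dHom A W Y n.
            dif A W Y y = - (f \<odot>\<^bsub>A\<^esub> x) \<and> j \<odot>\<^bsub>A\<^esub> x + i \<odot>\<^bsub>A\<^esub> y \<in> coboundaries A W Z n \<longrightarrow>
            (\<exists>x'\<in>dHom A W X n. \<exists>y'\<in>dHom A W Y (n - 1).
               x = - dif A W X x' \<and> y = dif A W Y y' + f \<odot>\<^bsub>A\<^esub> x')))"

text \<open>The projection \<open>p : Z \<rightarrow> X\<close>, closed of degree 1, of such a cone (it is the first component
  of a cocycle \<open>(p, s)\<close> corresponding to the identity of \<open>Z\<close>, so its cohomology class is unique).\<close>

definition dg_cone_proj ::
  "('k, 'o, 'm::ab_group_add) dgcat \<Rightarrow> 'o \<Rightarrow> 'o \<Rightarrow> 'm \<Rightarrow> 'o \<Rightarrow> 'm \<Rightarrow> 'm \<Rightarrow> 'm \<Rightarrow> bool"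
where
  "dg_cone_proj A X Y f Z i j p \<longleftrightarrow> p \<in> cocycles A Z X 1 \<and>
     (\<exists>s\<in>dHom A Z Y 0. dif A Z Y s = - (f \<odot>\<^bsub>A\<^esub> p) \<and>
        j \<odot>\<^bsub>A\<^esub> p + i \<odot>\<^bsub>A\<^esub> s - idn A Z \<in> coboundaries A Z Z 0)"

definition pretriangulated :: "('k::field, 'o, 'm::ab_group_add) dgcat \<Rightarrow> bool" where
  "pretriangulated A \<longleftrightarrow> dg_category A \<and>
     (\<forall>X\<in>Ob A. \<forall>n. \<exists>X' u v. dg_shift A n X X' u v) \<and>
     (\<forall>X\<in>Ob A. \<forall>Y\<in>Ob A. \<forall>f\<in>cocycles A X Y 0. \<exists>Z i j. dg_cone A X Y f Z i j)"

text \<open>A functor \<open>E\<close> from \<open>H\<^sup>0(A)\<close> to \<open>D\<close> is given by its values on objects and on closed degree 0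
  morphisms, annihilating the coboundaries; faithfulness means that only coboundaries are annihilated.
  Exactness is required with respect to the usual triangulated structure of \<open>H\<^sup>0(A)\<close>: \<open>\<theta>\<close> compares the
  shift functors and the exact triangles of \<open>H\<^sup>0(A)\<close> are those coming from cones. (A different sign
  convention for the latter is absorbed by \<open>\<theta>\<close>.)\<close>

definition dg_enhancement ::
  "('k::field, 'o1, 'm1::ab_group_add) dgcat \<Rightarrow> ('o1, 'm1, 'o2, 'm2) fnct \<Rightarrow>
   ('k, 'o2, 'm2::ab_group_add) tricat \<Rightarrow> bool"
where
  "dg_enhancement A E D \<longleftrightarrow> pretriangulated A \<and>
     fob E ` Ob A \<subseteq> Ob D \<and>
     (\<forall>X\<in>Ob A. \<forall>Y\<in>Ob A.
        fmap E X Y ` cocycles A X Y 0 = Hom D (fob E X) (fob E Y) \<and>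
        linear_on_subspace (smul A) (smul D) (cocycles A X Y 0) (fmap E X Y) \<and>
        (\<forall>f\<in>cocycles A X Y 0. fmap E X Y f = 0 \<longleftrightarrow> f \<in> coboundaries A X Y 0)) \<and>
     (\<forall>X\<in>Ob A. fmap E X X (idn A X) = idn D (fob E X)) \<and>
     (\<forall>X\<in>Ob A. \<forall>Y\<in>Ob A. \<forall>Z\<in>Ob A. \<forall>f\<in>cocycles A X Y 0. \<forall>g\<in>cocycles A Y Z 0.
        fmap E X Z (g \<odot>\<^bsub>A\<^esub> f) = fmap E Y Z g \<odot>\<^bsub>D\<^esub> fmap E X Y f) \<and>
     (\<forall>Y\<in>Ob D. \<exists>X\<in>Ob A. iso_ob D (fob E X) Y) \<and>
     (\<exists>\<theta>.
        (\<forall>X X' u v. dg_shift A 1 X X' u v \<longrightarrow>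
           iso_mor D (fob E X') (sh_ob D 1 (fob E X)) (\<theta> X X' u)) \<and>
        (\<forall>X X' u v Y Y' u' v' f.
           dg_shift A 1 X X' u v \<and> dg_shift A 1 Y Y' u' v' \<and> f \<in> cocycles A X Y 0 \<longrightarrow>
           sh_map D 1 (fob E X) (fob E Y) (fmap E X Y f) \<odot>\<^bsub>D\<^esub> \<theta> X X' u
             = \<theta> Y Y' u' \<odot>\<^bsub>D\<^esub> fmap E X' Y' (u' \<odot>\<^bsub>A\<^esub> f \<odot>\<^bsub>A\<^esub> v)) \<and>
        (\<forall>X Y f Z i j p X' u v.
           dg_cone A X Y f Z i j \<and> dg_cone_proj A X Y f Z i j p \<and> dg_shift A 1 X X' u v \<longrightarrow>
           tri D (fob E X) (fob E Y) (fob E Z) (fmap E X Y f) (fmap E Y Z i)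
             (\<theta> X X' u \<odot>\<^bsub>D\<^esub> fmap E Z X' (u \<odot>\<^bsub>A\<^esub> p))))"


subsection \<open>Dg functors, dg lifts and functorial cones\<close>

definition dg_functor ::
  "('k, 'o1, 'm1::ab_group_add) dgcat \<Rightarrow> ('k, 'o2, 'm2::ab_group_add) dgcat \<Rightarrow>
   ('o1, 'm1, 'o2, 'm2) fnct \<Rightarrow> bool"
where
  "dg_functor A B F \<longleftrightarrow>
     fob F ` Ob A \<subseteq> Ob B \<and>
     (\<forall>X\<in>Ob A. \<forall>Y\<in>Ob A. \<forall>n.
        fmap F X Y ` dHom A X Y n \<subseteq> dHom B (fob F X) (fob F Y) n \<and>
        linear_on_subspace (smul A) (smul B) (dHom A X Y n) (fmap F X Y) \<and>
        (\<forall>f\<in>dHom A X Y n. fmap F X Y (dif A X Y f) = dif B (fob F X) (fob F Y) (fmap F X Y f))) \<and>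
     (\<forall>X\<in>Ob A. fmap F X X (idn A X) = idn B (fob F X)) \<and>
     (\<forall>X\<in>Ob A. \<forall>Y\<in>Ob A. \<forall>Z\<in>Ob A. \<forall>m n. \<forall>f\<in>dHom A X Y m. \<forall>g\<in>dHom A Y Z n.
        fmap F X Z (g \<odot>\<^bsub>A\<^esub> f) = fmap F Y Z g \<odot>\<^bsub>B\<^esub> fmap F X Y f)"

definition dg_nat_trans ::
  "('k, 'o1, 'm1) dgcat \<Rightarrow> ('k, 'o2, 'm2::ab_group_add) dgcat \<Rightarrow>
   ('o1, 'm1, 'o2, 'm2) fnct \<Rightarrow> ('o1, 'm1, 'o2, 'm2) fnct \<Rightarrow> int \<Rightarrow> ('o1 \<Rightarrow> 'm2) \<Rightarrow> bool"
where
  "dg_nat_trans A B F G n \<alpha> \<longleftrightarrow>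
     (\<forall>X\<in>Ob A. \<alpha> X \<in> dHom B (fob F X) (fob G X) n) \<and>
     (\<forall>X\<in>Ob A. \<forall>Y\<in>Ob A. \<forall>m. \<forall>f\<in>dHom A X Y m.
        \<alpha> Y \<odot>\<^bsub>B\<^esub> fmap F X Y f = ksign (n * m) (fmap G X Y f \<odot>\<^bsub>B\<^esub> \<alpha> X))"

text \<open>\<open>P\<close> is a dg lift of \<open>F\<close>: the functors \<open>F \<circ> E\<close> and \<open>E' \<circ> H\<^sup>0(P)\<close> are isomorphic, via \<open>\<phi>\<close>.\<close>

definition dg_lift ::
  "('k, 'o1, 'm1::ab_group_add) tricat \<Rightarrow> ('k, 'p1, 'l1::ab_group_add) dgcat \<Rightarrow>
   ('p1, 'l1, 'o1, 'm1) fnct \<Rightarrow>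
   ('k, 'o2, 'm2::ab_group_add) tricat \<Rightarrow> ('k, 'p2, 'l2::ab_group_add) dgcat \<Rightarrow>
   ('p2, 'l2, 'o2, 'm2) fnct \<Rightarrow>
   ('o1, 'm1, 'o2, 'm2) fnct \<Rightarrow> ('p1, 'l1, 'p2, 'l2) fnct \<Rightarrow> ('p1 \<Rightarrow> 'm2) \<Rightarrow> bool"
where
  "dg_lift C A E D B E' F P \<phi> \<longleftrightarrow> dg_functor A B P \<and>
     (\<forall>X\<in>Ob A. iso_mor D (fob F (fob E X)) (fob E' (fob P X)) (\<phi> X)) \<and>
     (\<forall>X\<in>Ob A. \<forall>Y\<in>Ob A. \<forall>f\<in>cocycles A X Y 0.
        fmap E' (fob P X) (fob P Y) (fmap P X Y f) \<odot>\<^bsub>D\<^esub> \<phi> X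
          = \<phi> Y \<odot>\<^bsub>D\<^esub> fmap F (fob E X) (fob E Y) (fmap E X Y f))"

definition dg_exact_functor ::
  "('k, 'o1, 'm1::ab_group_add) tricat \<Rightarrow> ('k, 'p1, 'l1::ab_group_add) dgcat \<Rightarrow>
   ('p1, 'l1, 'o1, 'm1) fnct \<Rightarrow>
   ('k, 'o2, 'm2::ab_group_add) tricat \<Rightarrow> ('k, 'p2, 'l2::ab_group_add) dgcat \<Rightarrow>
   ('p2, 'l2, 'o2, 'm2) fnct \<Rightarrow> ('o1, 'm1, 'o2, 'm2) fnct \<Rightarrow> bool"
where
  "dg_exact_functor C A E D B E' F \<longleftrightarrow> exact_functor C D F \<and> (\<exists>P \<phi>. dg_lift C A E D B E' F P \<phi>)"

text \<open>\<open>T\<close> is a functorial cone of the natural transformation \<open>\<alpha> : F \<rightarrow> G\<close> of endofunctors of \<open>D\<close>: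
  \<open>\<alpha>\<close> lifts to a closed degree 0 transformation \<open>a : P \<rightarrow> Q\<close> of dg functors, and \<open>T\<close> has as dg lift
  a dg functor \<open>K\<close> that is a cone of \<open>a\<close>.\<close>

definition functorial_cone ::
  "('k::field, 'o, 'm::ab_group_add) tricat \<Rightarrow> ('k, 'p, 'l::ab_group_add) dgcat \<Rightarrow>
   ('p, 'l, 'o, 'm) fnct \<Rightarrow> ('o, 'm, 'o, 'm) fnct \<Rightarrow> ('o, 'm, 'o, 'm) fnct \<Rightarrow> ('o \<Rightarrow> 'm) \<Rightarrow>
   ('o, 'm, 'o, 'm) fnct \<Rightarrow> bool"
where
  "functorial_cone D B E F G \<alpha> T \<longleftrightarrow> lin_functor D D T \<and>
     (\<exists>P \<phi> Q \<psi> a K \<kappa> i j.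
        dg_lift D B E D B E F P \<phi> \<and> dg_lift D B E D B E G Q \<psi> \<and>
        dg_nat_trans B B P Q 0 a \<and>
        (\<forall>X\<in>Ob B. dif B (fob P X) (fob Q X) (a X) = 0 \<and>
           fmap E (fob P X) (fob Q X) (a X) \<odot>\<^bsub>D\<^esub> \<phi> X = \<psi> X \<odot>\<^bsub>D\<^esub> \<alpha> (fob E X)) \<and>
        dg_lift D B E D B E T K \<kappa> \<and>
        dg_nat_trans B B Q K 0 i \<and> dg_nat_trans B B P K (- 1) j \<and>
        (\<forall>X\<in>Ob B. dg_cone B (fob P X) (fob Q X) (a X) (fob K X) (i X) (j X)))"


section \<open>Dg algebras and their perfect derived categories\<close>

record ('k, 'a) dga =
  ascale :: "'k \<Rightarrow> 'a \<Rightarrow> 'a"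
  agr :: "int \<Rightarrow> 'a set"
  adif :: "'a \<Rightarrow> 'a"

text \<open>The sort \<open>{ring, monoid_mult}\<close> is that of unital rings, with \<open>1 = 0\<close> allowed.\<close>

locale dg_algebra =
  fixes A :: "('k::field, 'a::{ring, monoid_mult}) dga"
  assumes vs: "vector_space (ascale A)"
    and scale_mult: "ascale A c (x * y) = ascale A c x * y" "ascale A c (x * y) = x * ascale A c y"
    and gr_subspace: "module.subspace (ascale A) (agr A n)"
    and gr_decomp: "\<exists>!c. finite {n. c n \<noteq> 0} \<and> (\<forall>n. c n \<in> agr A n) \<and> x = (\<Sum>n | c n \<noteq> 0. c n)"
    and gr_one: "1 \<in> agr A 0"
    and gr_mult: "\<lbrakk>x \<in> agr A m; y \<in> agr A n\<rbrakk> \<Longrightarrow> x * y \<in> agr A (m + n)"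
    and d_lin: "linear_on_subspace (ascale A) (ascale A) UNIV (adif A)"
    and d_gr: "x \<in> agr A n \<Longrightarrow> adif A x \<in> agr A (n + 1)"
    and d_d: "adif A (adif A x) = 0"
    and d_mult: "x \<in> agr A n \<Longrightarrow> adif A (x * y) = adif A x * y + ksign n (x * adif A y)"

definition hom_part :: "('k, 'a::ab_group_add) dga \<Rightarrow> 'a \<Rightarrow> int \<Rightarrow> 'a" where
  "hom_part A x = (THE c. finite {n. c n \<noteq> 0} \<and> (\<forall>n. c n \<in> agr A n) \<and> x = (\<Sum>n | c n \<noteq> 0. c n))"

text \<open>The linear extension of \<open>x \<mapsto> (-1)^deg(x) x\<close>.\<close>

definition grading_sign :: "('k, 'a::ab_group_add) dga \<Rightarrow> 'a \<Rightarrow> 'a" where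
  "grading_sign A x = (\<Sum>n | hom_part A x n \<noteq> 0. ksign n (hom_part A x n))"

definition ground_dga :: "('k::field, 'k) dga" where
  "ground_dga = \<lparr>ascale = (*), agr = (\<lambda>n. if n = 0 then UNIV else {0}), adif = (\<lambda>_. 0)\<rparr>"

definition proper_dga :: "('k::field, 'a::{ring, monoid_mult}) dga \<Rightarrow> bool" where
  "proper_dga A \<longleftrightarrow> (\<exists>F. finite F \<and> (\<forall>n. \<forall>z\<in>agr A n. adif A z = 0 \<longrightarrow>
     (\<exists>w\<in>module.span (ascale A) F. z - w \<in> adif A ` agr A (n - 1))))"


subsection \<open>Dg bimodules\<close>

record ('a, 'b, 'x) bimod =
  bgr :: "int \<Rightarrow> 'x set"
  lact :: "'a \<Rightarrow> 'x \<Rightarrow> 'x"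
  ract :: "'x \<Rightarrow> 'b \<Rightarrow> 'x"
  bdif :: "'x \<Rightarrow> 'x"

locale dg_bimodule =
  fixes s :: "'k::field \<Rightarrow> 'x \<Rightarrow> 'x::ab_group_add"
    and A :: "('k, 'a::{ring, monoid_mult}) dga"
    and B :: "('k, 'b::{ring, monoid_mult}) dga"
    and M :: "('a, 'b, 'x) bimod"
  assumes vs: "vector_space s"
    and gr_subspace: "module.subspace s (bgr M n)"
    and lact_gr: "\<lbrakk>a \<in> agr A m; x \<in> bgr M n\<rbrakk> \<Longrightarrow> lact M a x \<in> bgr M (m + n)"
    and ract_gr: "\<lbrakk>x \<in> bgr M m; b \<in> agr B n\<rbrakk> \<Longrightarrow> ract M x b \<in> bgr M (m + n)"
    and lact_lin: "linear_on_subspace s s (bgr M n) (lact M a)"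
      "x \<in> bgr M n \<Longrightarrow> linear_on_subspace (ascale A) s UNIV (\<lambda>a. lact M a x)"
    and ract_lin: "linear_on_subspace s s (bgr M n) (\<lambda>x. ract M x b)"
      "x \<in> bgr M n \<Longrightarrow> linear_on_subspace (ascale B) s UNIV (ract M x)"
    and lact_one: "x \<in> bgr M n \<Longrightarrow> lact M 1 x = x"
    and ract_one: "x \<in> bgr M n \<Longrightarrow> ract M x 1 = x"
    and lact_mult: "\<lbrakk>x \<in> bgr M n; a \<in> agr A l; a' \<in> agr A m\<rbrakk>
        \<Longrightarrow> lact M (a * a') x = lact M a (lact M a' x)"
    and ract_mult: "\<lbrakk>x \<in> bgr M n; b \<in> agr B l; b' \<in> agr B m\<rbrakk>
        \<Longrightarrow> ract M x (b * b') = ract M (ract M x b) b'"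
    and acts_commute: "\<lbrakk>x \<in> bgr M n; a \<in> agr A l; b \<in> agr B m\<rbrakk>
        \<Longrightarrow> ract M (lact M a x) b = lact M a (ract M x b)"
    and d_lin: "linear_on_subspace s s (bgr M n) (bdif M)"
    and d_gr: "x \<in> bgr M n \<Longrightarrow> bdif M x \<in> bgr M (n + 1)"
    and d_d: "x \<in> bgr M n \<Longrightarrow> bdif M (bdif M x) = 0"
    and d_lact: "\<lbrakk>a \<in> agr A m; x \<in> bgr M n\<rbrakk>
        \<Longrightarrow> bdif M (lact M a x) = lact M (adif A a) x + ksign m (lact M a (bdif M x))"
    and d_ract: "\<lbrakk>x \<in> bgr M n; b \<in> agr B m\<rbrakk>
        \<Longrightarrow> bdif M (ract M x b) = ract M (bdif M x) b + ksign n (ract M x (adif B b))"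

text \<open>A bimodule map \<open>f\<close> of degree \<open>n\<close> is stored as the family of its components
  \<open>f i j : M\<^sup>i \<rightarrow> N\<^sup>j\<close>, which vanish unless \<open>j = i + n\<close>; they are extended by zero outside \<open>M\<^sup>i\<close>.\<close>

definition bimod_hom ::
  "('k \<Rightarrow> 'x \<Rightarrow> 'x::ab_group_add) \<Rightarrow> ('k \<Rightarrow> 'y \<Rightarrow> 'y::ab_group_add) \<Rightarrow>
   ('k, 'a) dga \<Rightarrow> ('k, 'b) dga \<Rightarrow> ('a, 'b, 'x) bimod \<Rightarrow> ('a, 'b, 'y) bimod \<Rightarrow> int \<Rightarrow>
   (int \<Rightarrow> int \<Rightarrow> 'x \<Rightarrow> 'y) set"
where
  "bimod_hom s s' A B M N n = {f.
     (\<forall>i j x. j \<noteq> i + n \<or> x \<notin> bgr M i \<longrightarrow> f i j x = 0) \<and>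
     (\<forall>i. f i (i + n) ` bgr M i \<subseteq> bgr N (i + n) \<and>
        linear_on_subspace s s' (bgr M i) (f i (i + n))) \<and>
     (\<forall>i m. \<forall>a\<in>agr A m. \<forall>x\<in>bgr M i.
        f (m + i) (m + i + n) (lact M a x) = ksign (n * m) (lact N a (f i (i + n) x))) \<and>
     (\<forall>i m. \<forall>b\<in>agr B m. \<forall>x\<in>bgr M i.
        f (i + m) (i + m + n) (ract M x b) = ract N (f i (i + n) x) b)}"

definition bimod_cmp ::
  "(int \<Rightarrow> int \<Rightarrow> 'y \<Rightarrow> 'z::comm_monoid_add) \<Rightarrow> (int \<Rightarrow> int \<Rightarrow> 'x \<Rightarrow> 'y::zero) \<Rightarrow>
   (int \<Rightarrow> int \<Rightarrow> 'x \<Rightarrow> 'z)"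
where
  "bimod_cmp g f = (\<lambda>i k x. \<Sum>j | f i j x \<noteq> 0. g j k (f i j x))"

text \<open>The dg category of dg \<open>A\<close>-\<open>B\<close>-bimodules with underlying space inside \<^typ>\<open>'x\<close>. On a map of
  degree \<open>n\<close> its differential is \<open>f \<mapsto> d f - (-1)\<^sup>n f d\<close>.\<close>

definition bimod_dgcat ::
  "('k::field \<Rightarrow> 'x \<Rightarrow> 'x::ab_group_add) \<Rightarrow>
   ('k, 'a::{ring, monoid_mult}) dga \<Rightarrow> ('k, 'b::{ring, monoid_mult}) dga \<Rightarrow>
   ('k, ('a, 'b, 'x) bimod, int \<Rightarrow> int \<Rightarrow> 'x \<Rightarrow> 'x) dgcat"
where
  "bimod_dgcat s A B =
     \<lparr>Ob = {M. dg_bimodule s A B M},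
      cmp = bimod_cmp,
      idn = (\<lambda>M i j x. if j = i \<and> x \<in> bgr M i then x else 0),
      smul = (\<lambda>c f i j x. s c (f i j x)),
      dHom = (\<lambda>M N n. bimod_hom s s A B M N n),
      dif = (\<lambda>M N f i k x. if x \<in> bgr M i
               then bdif N (f i (k - 1) x) - ksign (k - 1 - i) (f (i + 1) k (bdif M x)) else 0)\<rparr>"

definition diagonal_bimod :: "('k, 'a::{ring, monoid_mult}) dga \<Rightarrow> ('a, 'a, 'a) bimod" where
  "diagonal_bimod A = \<lparr>bgr = agr A, lact = (*), ract = (*), bdif = adif A\<rparr>"

text \<open>The dg bimodule \<open>A \<otimes> B\<close>, i.e. the free module of rank one over \<open>A\<^sup>o\<^sup>p \<otimes> B\<close>, inside the dual
  of the space of bilinear forms.\<close>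

definition bilinear_form :: "('k::field, 'a::ab_group_add) dga \<Rightarrow> ('k, 'b::ab_group_add) dga \<Rightarrow>
  ('a \<Rightarrow> 'b \<Rightarrow> 'k) \<Rightarrow> bool" where
  "bilinear_form A B \<beta> \<longleftrightarrow>
     (\<forall>x. linear_on_subspace (ascale B) (*) UNIV (\<beta> x)) \<and>
     (\<forall>y. linear_on_subspace (ascale A) (*) UNIV (\<lambda>x. \<beta> x y))"

definition pure_tensor :: "('k::field, 'a::ab_group_add) dga \<Rightarrow> ('k, 'b::ab_group_add) dga \<Rightarrow>
  'a \<Rightarrow> 'b \<Rightarrow> ('a \<Rightarrow> 'b \<Rightarrow> 'k) \<Rightarrow> 'k" where
  "pure_tensor A B x y = (\<lambda>\<beta>. if bilinear_form A B \<beta> then \<beta> x y else 0)"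

definition free_bimod ::
  "('k::field, 'a::{ring, monoid_mult}) dga \<Rightarrow> ('k, 'b::{ring, monoid_mult}) dga \<Rightarrow>
   ('a, 'b, ('a \<Rightarrow> 'b \<Rightarrow> 'k) \<Rightarrow> 'k) bimod"
where
  "free_bimod A B =
     \<lparr>bgr = (\<lambda>n. module.span (pointwise (*))
               {pure_tensor A B x y | x y m. x \<in> agr A m \<and> y \<in> agr B (n - m)}),
      lact = (\<lambda>a t \<beta>. if bilinear_form A B \<beta> then t (\<lambda>x y. \<beta> (a * x) y) else 0),
      ract = (\<lambda>t b \<beta>. if bilinear_form A B \<beta> then t (\<lambda>x y. \<beta> x (y * b)) else 0),
      bdif = (\<lambda>t \<beta>. if bilinear_form A B \<beta>
                then t (\<lambda>x y. \<beta> (adif A x) y) + t (\<lambda>x y. \<beta> (grading_sign A x) (adif B y)) else 0)\<rparr>"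

text \<open>Copies a bimodule into the 0-th coordinate of the space \<^typ>\<open>nat \<Rightarrow> 'x\<close>. This larger universe
  contains countable direct sums of shifts of the given bimodule.\<close>

definition embed_bimod :: "('a, 'b, 'x::zero) bimod \<Rightarrow> ('a, 'b, nat \<Rightarrow> 'x) bimod" where
  "embed_bimod M =
     \<lparr>bgr = (\<lambda>n. {x. x 0 \<in> bgr M n \<and> (\<forall>i>0. x i = 0)}),
      lact = (\<lambda>a x i. lact M a (x i)),
      ract = (\<lambda>x b i. ract M (x i) b),
      bdif = (\<lambda>x i. bdif M (x i))\<rparr>"


subsection \<open>Perfect modules\<close>

text \<open>The objects of the smallest thick subcategory of \<open>H\<^sup>0(A)\<close> that contains \<open>G\<close>.\<close>

inductive_set dg_thick :: "('k, 'o, 'm::ab_group_add) dgcat \<Rightarrow> 'o \<Rightarrow> 'o set"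
  for A :: "('k, 'o, 'm::ab_group_add) dgcat" and G :: 'o
where
  gen: "G \<in> Ob A \<Longrightarrow> G \<in> dg_thick A G"
| shift: "\<lbrakk>X \<in> dg_thick A G; dg_shift A n X X' u v\<rbrakk> \<Longrightarrow> X' \<in> dg_thick A G"
| cone: "\<lbrakk>X \<in> dg_thick A G; Y \<in> dg_thick A G; dg_cone A X Y f Z i j\<rbrakk> \<Longrightarrow> Z \<in> dg_thick A G"
| retract: "\<lbrakk>X \<in> dg_thick A G; Y \<in> Ob A; i \<in> cocycles A Y X 0; p \<in> cocycles A X Y 0;
     p \<odot>\<^bsub>A\<^esub> i - idn A Y \<in> coboundaries A Y Y 0\<rbrakk> \<Longrightarrow> Y \<in> dg_thick A G"

text \<open>The perfect derived category of \<open>A\<close> is the thick closure of \<open>A\<close> in the derived category of right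
  dg modules. Since \<open>A\<close> is h-projective, this closure may be formed in the homotopy category. Up to
  homotopy equivalence its objects are direct summands of iterated extensions of finitely many shifts
  of \<open>A\<close>, so that there are enough modules inside \<^typ>\<open>nat \<Rightarrow> 'a\<close>. Right \<open>A\<close>-modules
  are bimodules over the ground field and \<open>A\<close>.\<close>

definition regular_module :: "('k::field, 'a::{ring, monoid_mult}) dga \<Rightarrow> ('k, 'a, 'a) bimod" where
  "regular_module A = \<lparr>bgr = agr A, lact = ascale A, ract = (*), bdif = adif A\<rparr>"

definition perf_dgcat ::
  "('k::field, 'a::{ring, monoid_mult}) dga \<Rightarrow>
   ('k, ('k, 'a, nat \<Rightarrow> 'a) bimod, int \<Rightarrow> int \<Rightarrow> (nat \<Rightarrow> 'a) \<Rightarrow> (nat \<Rightarrow> 'a)) dgcat"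
where
  "perf_dgcat A = (let M = bimod_dgcat (pointwise (ascale A)) ground_dga A
     in M\<lparr>Ob := dg_thick M (embed_bimod (regular_module A))\<rparr>)"

definition is_perfect_derived_category ::
  "('k::field, 'a::{ring, monoid_mult}) dga \<Rightarrow> ('k, 'o, 'm::ab_group_add) tricat \<Rightarrow> bool"
where
  "is_perfect_derived_category A D \<longleftrightarrow> (\<exists>E. dg_enhancement (perf_dgcat A) E D)"

definition bimod_quasi_iso ::
  "('k::field \<Rightarrow> 'x \<Rightarrow> 'x::ab_group_add) \<Rightarrow> ('k \<Rightarrow> 'y \<Rightarrow> 'y::ab_group_add) \<Rightarrow>
   ('k, 'a) dga \<Rightarrow> ('k, 'b) dga \<Rightarrow> ('a, 'b, 'x) bimod \<Rightarrow> ('a, 'b, 'y) bimod \<Rightarrow>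
   (int \<Rightarrow> int \<Rightarrow> 'x \<Rightarrow> 'y) \<Rightarrow> bool"
where
  "bimod_quasi_iso s s' A B M N f \<longleftrightarrow> f \<in> bimod_hom s s' A B M N 0 \<and>
     (\<forall>i. \<forall>x\<in>bgr M i. bdif N (f i i x) = f (i + 1) (i + 1) (bdif M x)) \<and>
     (\<forall>i. \<forall>z\<in>bgr N i. bdif N z = 0 \<longrightarrow>
        (\<exists>x\<in>bgr M i. bdif M x = 0 \<and> f i i x - z \<in> bdif N ` bgr N (i - 1))) \<and>
     (\<forall>i. \<forall>x\<in>bgr M i. bdif M x = 0 \<and> f i i x \<in> bdif N ` bgr N (i - 1) \<longrightarrow>
        x \<in> bdif M ` bgr M (i - 1))"

text \<open>A dg bimodule is perfect if it lies in the thick closure of \<open>A \<otimes> B\<close> in the derived category of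
  bimodules. The objects of the closure in the homotopy category are h-projective, so
  an isomorphism in the derived category from one of them is given by a quasi-isomorphism of bimodules.\<close>

definition perfect_bimod ::
  "('k::field \<Rightarrow> 'y \<Rightarrow> 'y::ab_group_add) \<Rightarrow>
   ('k, 'a::{ring, monoid_mult}) dga \<Rightarrow> ('k, 'b::{ring, monoid_mult}) dga \<Rightarrow>
   ('a, 'b, 'y) bimod \<Rightarrow> bool"
where
  "perfect_bimod s A B N \<longleftrightarrow>
     (\<exists>P\<in>dg_thick (bimod_dgcat (pointwise (pointwise (*))) A B) (embed_bimod (free_bimod A B)).
        \<exists>f. bimod_quasi_iso (pointwise (pointwise (*))) s A B P N f)"

definition smooth_dga :: "('k::field, 'a::{ring, monoid_mult}) dga \<Rightarrow> bool" where
  "smooth_dga A \<longleftrightarrow> perfect_bimod (ascale A) A A (diagonal_bimod A)"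


section \<open>Spherical functors\<close>

text \<open>The triangulated categories \<open>C\<close> and \<open>D\<close> come with dg enhancements \<open>(CC, EC)\<close> and \<open>(DD, ED)\<close>,
  along which all exact functors are required to have dg lifts. The functor \<open>S\<close> has right adjoint \<open>R\<close>
  (unit \<open>\<eta>\<close>, counit \<open>\<epsilon>\<close>) and left adjoint \<open>L\<close>; the twist and cotwist are \<open>T\<close> and \<open>Q\<close>.\<close>

locale spherical_functor =
  fixes C :: "('k::field, 'oc, 'mc::ab_group_add) tricat"
    and CC :: "('k, 'pc, 'lc::ab_group_add) dgcat" and EC :: "('pc, 'lc, 'oc, 'mc) fnct"
    and D :: "('k, 'od, 'md::ab_group_add) tricat"
    and DD :: "('k, 'pd, 'ld::ab_group_add) dgcat" and ED :: "('pd, 'ld, 'od, 'md) fnct"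
    and S :: "('oc, 'mc, 'od, 'md) fnct"
    and R L :: "('od, 'md, 'oc, 'mc) fnct"
    and \<eta> :: "'oc \<Rightarrow> 'mc" and \<epsilon> :: "'od \<Rightarrow> 'md"
    and T :: "('od, 'md, 'od, 'md) fnct" and Q :: "('oc, 'mc, 'oc, 'mc) fnct"
  assumes triangulated: "triangulated_category C" "triangulated_category D"
    and enhanced: "dg_enhancement CC EC C" "dg_enhancement DD ED D"
    and exact: "dg_exact_functor C CC EC D DD ED S"
      "dg_exact_functor D DD ED C CC EC R" "dg_exact_functor D DD ED C CC EC L"
    and right_adjoint: "adjunction C D S R \<eta> \<epsilon>"
    and left_adjoint: "\<exists>\<eta>' \<epsilon>'. adjunction D C L S \<eta>' \<epsilon>'"
    and twist: "functorial_cone D DD ED (S \<circ>\<^sub>F R) id_fnct \<epsilon> T"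
    and cotwist: "lin_functor C C Q"
      "\<exists>K. functorial_cone C CC EC id_fnct (R \<circ>\<^sub>F S) \<eta> K \<and>
           isomorphic_functors C C Q (shift C (- 1) \<circ>\<^sub>F K)"
    and twist_equiv: "exact_autoequivalence D T"
    and cotwist_equiv: "exact_autoequivalence C Q"
    and right_via_twist: "isomorphic_functors D C R (L \<circ>\<^sub>F T \<circ>\<^sub>F shift D (- 1))"
    and right_via_cotwist: "isomorphic_functors D C R (Q \<circ>\<^sub>F L \<circ>\<^sub>F shift D 1)"

end

theory Submission
  imports Defs "HOL-Real_Asymp.Real_Asymp"
begin

text \<open>Upper bound: the triangle \<open>SR \<rightarrow> Id \<rightarrow> T\<^sub>S\<close> shows that the complexity of \<open>T\<^sub>S\<^sup>n\<^sup>+\<^sup>1 G\<close> exceeds that of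
  \<open>T\<^sub>S\<^sup>n G\<close> by at most that of \<open>S R T\<^sub>S\<^sup>n G\<close>, and the two formulas for \<open>R\<close> give \<open>R T\<^sub>S \<cong> C\<^sub>S R[2]\<close>. Hence
  \<open>\<delta>(G, T\<^sub>S\<^sup>n G) \<le> 1 + M \<Sum>k<n. \<delta>(H, C\<^sub>S\<^sup>k H)\<close> for a generator \<open>H\<close> of \<open>C\<close>, so that the entropy of \<open>T\<^sub>S\<close> is at
  most \<open>max 0 (entropy C\<^sub>S)\<close>. Lower bound: the forms \<open>\<chi>(-, F)\<close> separate the points of the complexified
  numerical Grothendieck group, and \<open>\<bar>\<chi>(T\<^sup>n E, F)\<bar>\<close> is at most a constant times \<open>\<delta>(G, T\<^sup>n G)\<close>, so the entropy of
  an autoequivalence is at least the logarithm of the modulus of every eigenvalue. The two bounds meet because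
  \<open>[T\<^sub>S] = 1 - [S][R]\<close> and \<open>[C\<^sub>S] = 1 - [R][S]\<close> imply \<open>[T\<^sub>S][S]v = [S][C\<^sub>S]v = c [S]v\<close>. The category \<open>D\<close> has a
  split-generator, the image of the free module, and finite type since \<open>A\<close> is proper.\<close>


section \<open>Linear maps on subspaces\<close>

text \<open>At t = 0 every summand of the complexity equals 1, so \<delta> is a natural number: the
  least number of cones on shifts of E that reach an object with direct summand F
  (\<open>cone_length\<close>). A complexity 0 has logarithm -\<infinity>, so positivity has to be
  secured: an eigenvector with nonzero eigenvalue keeps all iterates of a generator nonzero, and an
  autoequivalence has no eigenvalue 0 because it preserves the Euler form. Positive natural numbers
  have nonnegative logarithms, so the entropy of \<open>C\<^sub>S\<close> is at least 0 and the
  assumed bound gives ln |c| \<ge> 0; this removes the maximum with 0 from the upper bound. Since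
  the complexity allows direct summands, all counting is done with retracts, which must be carried
  through triangles. \<open>entropy\<close>, \<open>N_map\<close> and \<open>spectral_radius\<close>
  are given by definite descriptions or a maximum, so existence, uniqueness and finiteness are part
  of the proof.\<close>

lemma linear_on_subspace_extend:
  assumes "vector_space s1" "vector_space s2" "module.subspace s1 V" "linear_on_subspace s1 s2 V f"
  obtains g where "Vector_Spaces.linear s1 s2 g" "\<And>x. x \<in> V \<Longrightarrow> g x = f x"
proof -
  interpret vector_space_pair s1 s2 using assms by (simp add: vector_space_pair_def)
  obtain B where B: "B \<subseteq> V" "\<not> vs1.dependent B" "V \<subseteq> vs1.span B" "card B = vs1.dim V"
    using vs1.basis_exists[of V] by blast
  obtain g where g: "Vector_Spaces.linear s1 s2 g" "\<forall>x\<in>B. g x = f x"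
    using linear_independent_extend[OF B(2)] by blast
  have span: "vs1.span B = V" using B assms(3) by (metis vs1.span_subspace)
  have f0: "f 0 = 0" using assms(3,4) vs1.subspace_0 unfolding linear_on_subspace_def
    by (metis vs1.scale_zero_left vs2.scale_zero_left)
  have "x \<in> V \<and> g x = f x" if "x \<in> vs1.span B" for x
    using that
  proof (induction rule: vs1.span_induct_alt)
    case base
    then show ?case using assms(3) vs1.subspace_0 f0 linear_0[OF g(1)] by auto
  next
    case (step c x y)
    then have "x \<in> V" "s1 c x \<in> V" using B(1) assms(3) vs1.subspace_scale by auto
    then show ?case using step assms(3,4) g B(1) vs1.subspace_add unfolding linear_on_subspace_def
      by (metis linear_add linear_scale)
  qed
  then show ?thesis using that g(1) span by metis
qed

lemma fin_dim_image:
  assumes "vector_space s1" "vector_space s2" "module.subspace s1 V" "linear_on_subspace s1 s2 V f" "fin_dim s1 V"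
  shows "fin_dim s2 (f ` V)"
proof -
  interpret vector_space_pair s1 s2 using assms by (simp add: vector_space_pair_def)
  obtain g where g: "Vector_Spaces.linear s1 s2 g" "\<And>x. x \<in> V \<Longrightarrow> g x = f x"
    using linear_on_subspace_extend assms by metis
  obtain B where B: "finite B" "V \<subseteq> vs1.span B" using assms(5) unfolding fin_dim_def by auto
  have "f ` V = g ` V" using g(2) by auto
  also have "\<dots> \<subseteq> g ` vs1.span B" using B(2) by blast
  also have "\<dots> = vs2.span (g ` B)" using linear_span_image[OF g(1)] by simp
  finally show ?thesis using B(1) unfolding fin_dim_def by blast
qed

lemma fin_dim_subset: "fin_dim s V \<Longrightarrow> U \<subseteq> V \<Longrightarrow> fin_dim s U"
  unfolding fin_dim_def by blast

lemma subspace_image_on: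
  assumes "vector_space s1" "vector_space s2" "module.subspace s1 V" "linear_on_subspace s1 s2 V f"
  shows "module.subspace s2 (f ` V)"
proof -
  interpret vector_space_pair s1 s2 using assms by (simp add: vector_space_pair_def)
  obtain g where g: "Vector_Spaces.linear s1 s2 g" "\<And>x. x \<in> V \<Longrightarrow> g x = f x"
    using linear_on_subspace_extend assms by metis
  have "f ` V = g ` V" using g(2) by auto
  then show ?thesis using linear_subspace_image[OF g(1) assms(3)] by simp
qed

text \<open>A basis \<open>A\<close> of the kernel is extended to a basis \<open>B\<close> of the
  subspace, and \<open>B - A\<close> is mapped bijectively to a basis of the image.\<close>

lemma rank_nullity:
  assumes "vector_space s1" "vector_space s2" "module.subspace s1 V" "linear_on_subspace s1 s2 V f" "fin_dim s1 V"
  shows "vector_space.dim s1 V = vector_space.dim s2 (f ` V) + vector_space.dim s1 {x\<in>V. f x = 0}"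
proof -
  interpret vector_space_pair s1 s2 using assms by (simp add: vector_space_pair_def)
  obtain g where g: "Vector_Spaces.linear s1 s2 g" "\<And>x. x \<in> V \<Longrightarrow> g x = f x"
    using linear_on_subspace_extend assms by metis
  define K where "K = {x\<in>V. g x = 0}"
  have K: "vs1.subspace K"
  proof -
    have "K = V \<inter> {x. g x = 0}" unfolding K_def by auto
    then show ?thesis using vs1.subspace_inter[OF assms(3) linear_subspace_kernel[OF g(1)]] by simp
  qed
  obtain A where A: "A \<subseteq> K" "\<not> vs1.dependent A" "K \<subseteq> vs1.span A" "card A = vs1.dim K"
    using vs1.basis_exists[of K] by blast
  have spA: "vs1.span A = K" using A K by (metis vs1.span_subspace)
  have "A \<subseteq> V" using A(1) K_def by auto
  then obtain B where B: "A \<subseteq> B" "B \<subseteq> V" "\<not> vs1.dependent B" "V \<subseteq> vs1.span B"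
    using vs1.maximal_independent_subset_extend[OF _ A(2)] by metis
  have spB: "vs1.span B = V" using B assms(3) by (metis vs1.span_subspace)
  obtain F where F: "finite F" "V \<subseteq> vs1.span F" using assms(5) unfolding fin_dim_def by auto
  have finB: "finite B" using vs1.independent_span_bound[OF F(1) B(3)] B(2) F(2) by auto
  have inj: "inj_on g (vs1.span (B - A))"
  proof (subst linear_inj_on_iff_eq_0[OF g(1) vs1.subspace_span])
    show "\<forall>x\<in>vs1.span (B - A). g x = 0 \<longrightarrow> x = 0"
    proof (intro ballI impI)
      fix x assume x: "x \<in> vs1.span (B - A)" "g x = 0"
      then have "x \<in> V" using vs1.span_mono[of "B - A" B] spB by auto
      then have xA: "x \<in> vs1.span A" using x spA K_def by auto
      \<comment> \<open>A vector in the spans of both \<open>A\<close> and \<open>B - A\<close> has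
        a representation supported on two disjoint sets, so all its coefficients vanish.\<close>
      have r1: "vs1.representation B x = vs1.representation A x"
        using vs1.representation_extend[OF B(3) xA B(1)] .
      have r2: "vs1.representation B x = vs1.representation (B - A) x"
        using vs1.representation_extend[OF B(3) x(1)] by auto
      have "vs1.representation B x b = 0" for b
      proof (rule ccontr)
        assume n: "vs1.representation B x b \<noteq> 0"
        have "b \<in> A" using n r1 vs1.representation_ne_zero by metis
        moreover have "b \<in> B - A" using n r2 vs1.representation_ne_zero by metis
        ultimately show False by simp
      qed
      moreover have "x \<in> vs1.span B" using \<open>x \<in> V\<close> spB by simp
      ultimately show "x = 0" using vs1.sum_nonzero_representation_eq[OF B(3)] by force
    qed
  qed
  have ind: "\<not> vs2.dependent (g ` (B - A))"
    using linear_independent_injective_image[OF g(1) vs1.independent_mono[OF B(3)] inj] by auto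
  have "g ` V = vs2.span (g ` B)" using linear_span_image[OF g(1), of B] spB by simp
  also have "\<dots> = vs2.span (g ` (B - A))"
  proof (rule subset_antisym)
    have "g ` B \<subseteq> vs2.span (g ` (B - A))"
    proof
      fix y assume "y \<in> g ` B"
      then obtain b where b: "b \<in> B" "y = g b" by auto
      show "y \<in> vs2.span (g ` (B - A))"
      proof (cases "b \<in> A")
        case True
        then have "y = 0" using b A(1) K_def by auto
        then show ?thesis using vs2.span_zero by simp
      qed (use b in \<open>auto intro: vs2.span_base\<close>)
    qed
    then show "vs2.span (g ` B) \<subseteq> vs2.span (g ` (B - A))" using vs2.span_minimal by auto
  qed (rule vs2.span_mono, auto)
  finally have gV: "vs2.dim (g ` V) = card (g ` (B - A))"
    using vs2.dim_span_eq_card_independent[OF ind] by simp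
  have "card (g ` (B - A)) = card (B - A)"
    using inj by (intro card_image) (meson inj_on_subset vs1.span_superset)
  moreover have "vs1.dim V = card B" using spB vs1.dim_span_eq_card_independent[OF B(3)] by simp
  moreover have "card B = card (B - A) + card A" using finB B(1)
    by (metis card_Diff_subset card_mono finite_subset le_add_diff_inverse2)
  moreover have "f ` V = g ` V" "{x\<in>V. f x = 0} = K" using g(2) K_def by auto
  ultimately show ?thesis using gV A(4) by simp
qed

lemma dim_bij_on:
  assumes "vector_space s1" "vector_space s2" "module.subspace s1 V" "linear_on_subspace s1 s2 V f" "fin_dim s1 V"
    and "inj_on f V"
  shows "vector_space.dim s2 (f ` V) = vector_space.dim s1 V"
proof -
  interpret vector_space_pair s1 s2 using assms by (simp add: vector_space_pair_def)
  have "f 0 = 0" using assms(3,4) vs1.subspace_0 unfolding linear_on_subspace_def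
    by (metis vs1.scale_zero_left vs2.scale_zero_left)
  then have "{x\<in>V. f x = 0} = {0}" using assms(6) vs1.subspace_0[OF assms(3)]
    by (auto simp: inj_on_def)
  moreover have "vs1.dim {0} = 0"
    using vs1.dim_span_eq_card_independent[OF vs1.independent_empty] by simp
  ultimately show ?thesis using rank_nullity[OF assms(1-5)] by simp
qed

text \<open>The premise \<open>fin_dim\<close> matters: \<open>dim\<close> is the cardinality of a
  basis, which is 0 for an infinite one as well.\<close>

lemma dim_zero_iff:
  assumes "vector_space s" "module.subspace s V" "fin_dim s V"
  shows "vector_space.dim s V = 0 \<longleftrightarrow> V = {0}"
proof -
  interpret vector_space s by fact
  obtain B where B: "B \<subseteq> V" "independent B" "V \<subseteq> span B" "card B = dim V"
    using basis_exists[of V] by blast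
  obtain F where F: "finite F" "V \<subseteq> span F" using assms(3) unfolding fin_dim_def by auto
  have "finite B" using independent_span_bound[OF F(1) B(2)] B(1) F(2) by auto
  then have "dim V = 0 \<longleftrightarrow> B = {}" using B(4) by auto
  also have "\<dots> \<longleftrightarrow> V = {0}"
  proof
    assume "B = {}"
    then show "V = {0}" using B(3) subspace_0[OF assms(2)] by auto
  next
    assume "V = {0}"
    moreover have "0 \<notin> B" using B(2) dependent_zero by blast
    ultimately show "B = {}" using B(1) by blast
  qed
  finally show ?thesis .
qed

lemma dim_le_of_subset:
  assumes "vector_space s" "fin_dim s V" "U \<subseteq> V"
  shows "vector_space.dim s U \<le> vector_space.dim s V"
proof -
  interpret vector_space s by fact
  obtain B where B: "B \<subseteq> V" "independent B" "V \<subseteq> span B" "card B = dim V"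
    using basis_exists[of V] by blast
  obtain F where F: "finite F" "V \<subseteq> span F" using assms(2) unfolding fin_dim_def by auto
  have "finite B" using independent_span_bound[OF F(1) B(2)] B(1) F(2) by auto
  then show ?thesis using dim_le_card[of U B] B assms(3) by auto
qed

section \<open>Linear categories\<close>

text \<open>The axioms constrain \<open>Hom C X Y\<close> only for objects X and Y; bundling these
  memberships with the morphism lets one fact feed a whole chain of compositions.\<close>

definition arr :: "('k, 'o, 'm, 'z) lincat_scheme \<Rightarrow> 'o \<Rightarrow> 'o \<Rightarrow> 'm \<Rightarrow> bool" where
  "arr C X Y f \<longleftrightarrow> X \<in> Ob C \<and> Y \<in> Ob C \<and> f \<in> Hom C X Y"

definition isom :: "('k, 'o, 'm, 'z) lincat_scheme \<Rightarrow> 'o \<Rightarrow> 'o \<Rightarrow> bool" where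
  "isom C X Y \<longleftrightarrow> (\<exists>f g. arr C X Y f \<and> arr C Y X g \<and> g \<odot>\<^bsub>C\<^esub> f = idn C X \<and> f \<odot>\<^bsub>C\<^esub> g = idn C Y)"

text \<open>Direct summands in a form that functors preserve and that composes. In a triangulated
  category they agree with the summands of \<open>direct_sum\<close>
  (\<open>retract_direct_sum\<close>, \<open>direct_sum_retract\<close>).\<close>

definition retract :: "('k, 'o, 'm, 'z) lincat_scheme \<Rightarrow> 'o \<Rightarrow> 'o \<Rightarrow> bool" where
  "retract C X Y \<longleftrightarrow> (\<exists>i p. arr C X Y i \<and> arr C Y X p \<and> p \<odot>\<^bsub>C\<^esub> i = idn C X)"

lemma isom_iff: "isom C X Y \<longleftrightarrow> X \<in> Ob C \<and> Y \<in> Ob C \<and> iso_ob C X Y"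
  unfolding isom_def iso_ob_def iso_mor_def arr_def by blast

lemma isom_sym: "isom C X Y \<Longrightarrow> isom C Y X"
  unfolding isom_def by blast

lemma isom_retract: "isom C X Y \<Longrightarrow> retract C X Y"
  unfolding isom_def retract_def by blast

context linear_category
begin

lemma arr_cmp: "\<lbrakk>arr C X Y f; arr C Y Z g\<rbrakk> \<Longrightarrow> arr C X Z (g \<odot> f)"
  unfolding arr_def using cmp_hom[of X Y Z f g] by simp

lemma arr_idn: "X \<in> Ob C \<Longrightarrow> arr C X X (idn C X)"
  unfolding arr_def using idn_hom by auto

lemma module_smul: "module (smul C)"
  using vs by (simp add: module_iff_vector_space)

lemma arr_zero: "\<lbrakk>X \<in> Ob C; Y \<in> Ob C\<rbrakk> \<Longrightarrow> arr C X Y 0"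
  unfolding arr_def using module.subspace_0[OF module_smul hom_subspace] by blast

lemma arr_diff: "\<lbrakk>arr C X Y f; arr C X Y g\<rbrakk> \<Longrightarrow> arr C X Y (f - g)"
  unfolding arr_def using module.subspace_diff[OF module_smul hom_subspace] by blast

lemma arr_uminus: "arr C X Y f \<Longrightarrow> arr C X Y (- f)"
  unfolding arr_def using module.subspace_neg[OF module_smul hom_subspace] by blast

lemma assoc: "\<lbrakk>arr C W X f; arr C X Y g; arr C Y Z h\<rbrakk> \<Longrightarrow> (h \<odot> g) \<odot> f = h \<odot> (g \<odot> f)"
  unfolding arr_def using cmp_assoc[of W X Y Z f g h] by simp

lemma idl: "arr C X Y f \<Longrightarrow> idn C Y \<odot> f = f"
  and idr: "arr C X Y f \<Longrightarrow> f \<odot> idn C X = f"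
  unfolding arr_def using cmp_idn_left[of X Y f] cmp_idn_right[of X Y f] by simp_all

lemma add_r: "\<lbrakk>arr C X Y f; arr C X Y f'; arr C Y Z g\<rbrakk> \<Longrightarrow> g \<odot> (f + f') = g \<odot> f + g \<odot> f'"
  unfolding arr_def using cmp_lin_right[of X Y Z g] unfolding linear_on_subspace_def by auto

lemma add_l: "\<lbrakk>arr C X Y f; arr C Y Z g; arr C Y Z g'\<rbrakk> \<Longrightarrow> (g + g') \<odot> f = g \<odot> f + g' \<odot> f"
  unfolding arr_def using cmp_lin_left[of X Y Z f] unfolding linear_on_subspace_def by auto

lemma zero_r: "\<lbrakk>X \<in> Ob C; arr C Y Z g\<rbrakk> \<Longrightarrow> g \<odot> 0 = 0"
  using add_r[OF arr_zero[of X Y] arr_zero[of X Y], of Z g] unfolding arr_def by simp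

lemma zero_l: "\<lbrakk>Z \<in> Ob C; arr C X Y f\<rbrakk> \<Longrightarrow> 0 \<odot> f = 0"
  using add_l[of X Y f Z 0 0] arr_zero[of Y Z] unfolding arr_def by simp

lemma uminus_r:
  assumes "arr C X Y f" "arr C Y Z g" shows "g \<odot> (- f) = - (g \<odot> f)"
proof -
  have "g \<odot> f + g \<odot> (- f) = g \<odot> 0"
    using add_r[OF assms(1) arr_uminus[OF assms(1)] assms(2)] by simp
  also have "\<dots> = 0" using zero_r[of X Y Z g] assms unfolding arr_def by simp
  finally show ?thesis by (rule minus_unique[symmetric])
qed

lemma uminus_l:
  assumes "arr C X Y f" "arr C Y Z g" shows "(- g) \<odot> f = - (g \<odot> f)"
proof -
  have "g \<odot> f + (- g) \<odot> f = 0 \<odot> f"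
    using add_l[OF assms(1,2) arr_uminus[OF assms(2)]] by simp
  also have "\<dots> = 0" using zero_l[of Z X Y f] assms unfolding arr_def by simp
  finally show ?thesis by (rule minus_unique[symmetric])
qed

lemma diff_r: "\<lbrakk>arr C X Y f; arr C X Y f'; arr C Y Z g\<rbrakk> \<Longrightarrow> g \<odot> (f - f') = g \<odot> f - g \<odot> f'"
  using add_r[OF _ arr_uminus, of X Y f f' Z g] uminus_r[of X Y f' Z g] by simp

lemma diff_l: "\<lbrakk>arr C X Y f; arr C Y Z g; arr C Y Z g'\<rbrakk> \<Longrightarrow> (g - g') \<odot> f = g \<odot> f - g' \<odot> f"
  using add_l[OF _ _ arr_uminus, of X Y f Z g g'] uminus_l[of X Y f Z g'] by simp

lemma isom_refl: assumes "X \<in> Ob C" shows "isom C X X"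
proof -
  note i = arr_idn[OF assms]
  show ?thesis unfolding isom_def using i idl[OF i] by blast
qed

lemma retract_refl: "X \<in> Ob C \<Longrightarrow> retract C X X"
  by (rule isom_retract[OF isom_refl])

lemma retract_trans:
  assumes "retract C X Y" "retract C Y Z" shows "retract C X Z"
proof -
  obtain i p where 1: "arr C X Y i" "arr C Y X p" "p \<odot> i = idn C X" using assms(1) unfolding retract_def by auto
  obtain j q where 2: "arr C Y Z j" "arr C Z Y q" "q \<odot> j = idn C Y" using assms(2) unfolding retract_def by auto
  have "(p \<odot> q) \<odot> (j \<odot> i) = p \<odot> ((q \<odot> j) \<odot> i)"
    using assoc[OF arr_cmp[OF 1(1) 2(1)] 2(2) 1(2)] assoc[OF 1(1) 2(1,2)] by simp
  also have "\<dots> = idn C X" using 1 2(3) idl by simp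
  finally show ?thesis unfolding retract_def using arr_cmp[OF 1(1) 2(1)] arr_cmp[OF 2(2) 1(2)] by blast
qed

lemma isom_trans:
  assumes "isom C X Y" "isom C Y Z" shows "isom C X Z"
proof -
  obtain i p where 1: "arr C X Y i" "arr C Y X p" "p \<odot> i = idn C X" "i \<odot> p = idn C Y"
    using assms(1) unfolding isom_def by auto
  obtain j q where 2: "arr C Y Z j" "arr C Z Y q" "q \<odot> j = idn C Y" "j \<odot> q = idn C Z"
    using assms(2) unfolding isom_def by auto
  have "(p \<odot> q) \<odot> (j \<odot> i) = idn C X"
    using assoc[OF arr_cmp[OF 1(1) 2(1)] 2(2) 1(2)] assoc[OF 1(1) 2(1,2)] 1 2 idl by simp
  moreover have "(j \<odot> i) \<odot> (p \<odot> q) = idn C Z"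
    using assoc[OF arr_cmp[OF 2(2) 1(2)] 1(1) 2(1)] assoc[OF 2(2) 1(2,1)] 1 2 idl by simp
  ultimately show ?thesis unfolding isom_def
    using arr_cmp[OF 1(1) 2(1)] arr_cmp[OF 2(2) 1(2)] by blast
qed

lemma zero_ob_from: "\<lbrakk>zero_ob C Z; arr C Z X f\<rbrakk> \<Longrightarrow> f = 0"
  using idr zero_r[of Z Z X f] unfolding zero_ob_def by metis

lemma zero_ob_to: "\<lbrakk>zero_ob C Z; arr C X Z f\<rbrakk> \<Longrightarrow> f = 0"
  using idl zero_l[of Z X Z f] unfolding zero_ob_def by metis

lemma zero_ob_retract:
  assumes "zero_ob C Z" "retract C X Z" shows "zero_ob C X"
proof -
  obtain i p where 1: "arr C X Z i" "arr C Z X p" "p \<odot> i = idn C X" using assms unfolding retract_def by auto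
  then show ?thesis using zero_ob_from[OF assms(1) 1(2)] zero_l[of X X Z i] unfolding zero_ob_def arr_def by auto
qed

end

subsection \<open>Linear functors\<close>

lemma lin_functorD:
  assumes "lin_functor C D F"
  shows lin_functor_ob: "X \<in> Ob C \<Longrightarrow> fob F X \<in> Ob D"
    and lin_functor_arr: "arr C X Y f \<Longrightarrow> arr D (fob F X) (fob F Y) (fmap F X Y f)"
    and lin_functor_lin: "\<lbrakk>X \<in> Ob C; Y \<in> Ob C\<rbrakk> \<Longrightarrow> linear_on_subspace (smul C) (smul D) (Hom C X Y) (fmap F X Y)"
    and lin_functor_idn: "X \<in> Ob C \<Longrightarrow> fmap F X X (idn C X) = idn D (fob F X)"
    and lin_functor_cmp: "\<lbrakk>arr C X Y f; arr C Y Z g\<rbrakk> \<Longrightarrow>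
      fmap F X Z (g \<odot>\<^bsub>C\<^esub> f) = fmap F Y Z g \<odot>\<^bsub>D\<^esub> fmap F X Y f"
proof -
  note d = assms[unfolded lin_functor_def]
  show "X \<in> Ob C \<Longrightarrow> fob F X \<in> Ob D" using d by blast
  then show "arr C X Y f \<Longrightarrow> arr D (fob F X) (fob F Y) (fmap F X Y f)" using d unfolding arr_def by blast
  show "\<lbrakk>X \<in> Ob C; Y \<in> Ob C\<rbrakk> \<Longrightarrow> linear_on_subspace (smul C) (smul D) (Hom C X Y) (fmap F X Y)" using d by simp
  show "X \<in> Ob C \<Longrightarrow> fmap F X X (idn C X) = idn D (fob F X)" using d by simp
  show "\<lbrakk>arr C X Y f; arr C Y Z g\<rbrakk> \<Longrightarrow> fmap F X Z (g \<odot>\<^bsub>C\<^esub> f) = fmap F Y Z g \<odot>\<^bsub>D\<^esub> fmap F X Y f"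
    using d unfolding arr_def by simp
qed

lemma linear_on_subspace_simps:
  assumes "linear_on_subspace s1 s2 V f" "vector_space s1" "vector_space s2" "module.subspace s1 V"
  shows "f 0 = 0" "x \<in> V \<Longrightarrow> f (- x) = - f x" "\<lbrakk>x \<in> V; y \<in> V\<rbrakk> \<Longrightarrow> f (x - y) = f x - f y"
    "\<lbrakk>x \<in> V; y \<in> V\<rbrakk> \<Longrightarrow> f (x + y) = f x + f y" "x \<in> V \<Longrightarrow> f (s1 c x) = s2 c (f x)"
proof -
  obtain g where g: "Vector_Spaces.linear s1 s2 g" "\<And>x. x \<in> V \<Longrightarrow> g x = f x"
    using linear_on_subspace_extend[OF assms(2,3,4,1)] by metis
  interpret vector_space_pair s1 s2 using assms by (simp add: vector_space_pair_def)
  note sub = vs1.subspace_0[OF assms(4)] vs1.subspace_neg[OF assms(4)] vs1.subspace_diff[OF assms(4)]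
    vs1.subspace_add[OF assms(4)] vs1.subspace_scale[OF assms(4)]
  show "f 0 = 0" using linear_0[OF g(1)] g(2)[OF sub(1)] by simp
  show "f (- x) = - f x" if "x \<in> V" using linear_neg[OF g(1)] g(2)[OF sub(2)[OF that]] g(2)[OF that] by simp
  show "f (x - y) = f x - f y" if "x \<in> V" "y \<in> V"
    using linear_diff[OF g(1)] g(2)[OF sub(3)[OF that]] g(2)[OF that(1)] g(2)[OF that(2)] by simp
  show "f (x + y) = f x + f y" if "x \<in> V" "y \<in> V"
    using linear_add[OF g(1)] g(2)[OF sub(4)[OF that]] g(2)[OF that(1)] g(2)[OF that(2)] by simp
  show "f (s1 c x) = s2 c (f x)" if "x \<in> V"
    using linear_scale[OF g(1)] g(2)[OF sub(5)[OF that]] g(2)[OF that] by simp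
qed

lemma lin_functor_fmap_lin:
  assumes "linear_category C" "linear_category D" "lin_functor C D F"
  shows "\<lbrakk>X \<in> Ob C; Y \<in> Ob C\<rbrakk> \<Longrightarrow> fmap F X Y 0 = 0"
    and "arr C X Y f \<Longrightarrow> fmap F X Y (- f) = - fmap F X Y f"
    and "\<lbrakk>arr C X Y f; arr C X Y g\<rbrakk> \<Longrightarrow> fmap F X Y (f + g) = fmap F X Y f + fmap F X Y g"
  using linear_on_subspace_simps[OF lin_functor_lin[OF assms(3)]] linear_category.vs[OF assms(1)]
    linear_category.vs[OF assms(2)] linear_category.hom_subspace[OF assms(1)]
  unfolding arr_def by auto

lemma lin_functor_isom:
  assumes "lin_functor C D F" "isom C X Y" shows "isom D (fob F X) (fob F Y)"
proof -
  obtain f g where fg: "arr C X Y f" "arr C Y X g" "g \<odot>\<^bsub>C\<^esub> f = idn C X" "f \<odot>\<^bsub>C\<^esub> g = idn C Y"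
    using assms(2) unfolding isom_def by auto
  then have "X \<in> Ob C" "Y \<in> Ob C" unfolding arr_def by auto
  then show ?thesis unfolding isom_def
    using lin_functor_arr[OF assms(1) fg(1)] lin_functor_arr[OF assms(1) fg(2)]
      lin_functor_cmp[OF assms(1) fg(1,2)] lin_functor_cmp[OF assms(1) fg(2,1)] lin_functor_idn[OF assms(1)] fg(3,4)
    by metis
qed

lemma lin_functor_retract:
  assumes "lin_functor C D F" "retract C X Y" shows "retract D (fob F X) (fob F Y)"
proof -
  obtain f g where fg: "arr C X Y f" "arr C Y X g" "g \<odot>\<^bsub>C\<^esub> f = idn C X"
    using assms(2) unfolding retract_def by auto
  then have "X \<in> Ob C" unfolding arr_def by auto
  then show ?thesis unfolding retract_def
    using lin_functor_arr[OF assms(1) fg(1)] lin_functor_arr[OF assms(1) fg(2)]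
      lin_functor_cmp[OF assms(1) fg(1,2)] lin_functor_idn[OF assms(1)] fg(3)
    by metis
qed

lemma lin_functor_zero_ob:
  assumes "linear_category C" "linear_category D" "lin_functor C D F" "zero_ob C X"
  shows "zero_ob D (fob F X)"
  using assms lin_functor_idn[OF assms(3), of X] lin_functor_fmap_lin(1)[OF assms(1-3), of X X]
    lin_functor_ob[OF assms(3)] unfolding zero_ob_def by auto

lemma isomorphic_functors_isom:
  assumes "lin_functor C D F" "lin_functor C D G" "isomorphic_functors C D F G" "X \<in> Ob C"
  shows "isom D (fob F X) (fob G X)"
  using assms(3,4) lin_functor_ob[OF assms(1)] lin_functor_ob[OF assms(2)]
  unfolding isomorphic_functors_def nat_iso_def isom_iff iso_ob_def by auto

lemma lin_functor_comp:
  assumes "lin_functor C D F" "lin_functor D E G" shows "lin_functor C E (G \<circ>\<^sub>F F)"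
proof -
  note F = lin_functor_ob[OF assms(1)] lin_functor_arr[OF assms(1)] lin_functor_idn[OF assms(1)]
  note G = lin_functor_ob[OF assms(2)] lin_functor_arr[OF assms(2)] lin_functor_idn[OF assms(2)]
  have lin: "linear_on_subspace (smul C) (smul E) (Hom C X Y) (\<lambda>f. fmap G (fob F X) (fob F Y) (fmap F X Y f))"
    if XY: "X \<in> Ob C" "Y \<in> Ob C" for X Y
  proof -
    have "fmap F X Y f \<in> Hom D (fob F X) (fob F Y)" if "f \<in> Hom C X Y" for f
      using F(2)[of X Y f] that XY unfolding arr_def by simp
    then show ?thesis
      using lin_functor_lin[OF assms(1) XY] lin_functor_lin[OF assms(2) F(1)[OF XY(1)] F(1)[OF XY(2)]]
      unfolding linear_on_subspace_def by simp
  qed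
  show ?thesis
    unfolding lin_functor_def
  proof (intro conjI ballI)
    show "fob (G \<circ>\<^sub>F F) ` Ob C \<subseteq> Ob E" using F(1) G(1) unfolding fcomp_def by auto
    show "fmap (G \<circ>\<^sub>F F) X X (idn C X) = idn E (fob (G \<circ>\<^sub>F F) X)" if "X \<in> Ob C" for X
      using F(1,3) G(3) that unfolding fcomp_def by simp
    fix X Y assume XY: "X \<in> Ob C" "Y \<in> Ob C"
    show "linear_on_subspace (smul C) (smul E) (Hom C X Y) (fmap (G \<circ>\<^sub>F F) X Y)"
      using lin[OF XY] unfolding fcomp_def by simp
    show "fmap (G \<circ>\<^sub>F F) X Y ` Hom C X Y \<subseteq> Hom E (fob (G \<circ>\<^sub>F F) X) (fob (G \<circ>\<^sub>F F) Y)"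
    proof (intro image_subsetI)
      fix f assume "f \<in> Hom C X Y"
      then have "arr C X Y f" using XY unfolding arr_def by simp
      from G(2)[OF F(2)[OF this]] show "fmap (G \<circ>\<^sub>F F) X Y f \<in> Hom E (fob (G \<circ>\<^sub>F F) X) (fob (G \<circ>\<^sub>F F) Y)"
        unfolding fcomp_def arr_def by simp
    qed
    fix Z f g assume "Z \<in> Ob C" "f \<in> Hom C X Y" "g \<in> Hom C Y Z"
    then have f: "arr C X Y f" and g: "arr C Y Z g" using XY unfolding arr_def by auto
    show "fmap (G \<circ>\<^sub>F F) X Z (g \<odot>\<^bsub>C\<^esub> f) = fmap (G \<circ>\<^sub>F F) Y Z g \<odot>\<^bsub>E\<^esub> fmap (G \<circ>\<^sub>F F) X Y f"
      using lin_functor_cmp[OF assms(1) f g] lin_functor_cmp[OF assms(2) F(2)[OF f] F(2)[OF g]]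
      unfolding fcomp_def by simp
  qed
qed

lemma lin_functor_id: "lin_functor C C id_fnct"
  unfolding lin_functor_def id_fnct_def linear_on_subspace_def by auto

lemma fob_fcomp [simp]: "fob (G \<circ>\<^sub>F F) X = fob G (fob F X)"
  and fob_id [simp]: "fob id_fnct X = X"
  unfolding fcomp_def id_fnct_def by auto

section \<open>Triangulated categories\<close>

text \<open>Complexity and classes depend only on the objects of a triangle; forgetting the maps
  makes the signs of rotation disappear.\<close>

definition extension :: "('k, 'o, 'm) tricat \<Rightarrow> 'o \<Rightarrow> 'o \<Rightarrow> 'o \<Rightarrow> bool" where
  "extension C X Y Z \<longleftrightarrow> (\<exists>f g h. tri C X Y Z f g h)"

context triangulated_category
begin

section \<open>Shifts and rotations of triangles\<close>

lemma tri_arr: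
  assumes "tri C X Y Z f g h"
  shows "arr C X Y f" "arr C Y Z g" "arr C Z (sh_ob C 1 X) h"
  using tri_type[OF assms] lin_functor_ob[OF shift_functor] unfolding arr_def by auto

lemma extension_ob: "extension C X Y Z \<Longrightarrow> X \<in> Ob C \<and> Y \<in> Ob C \<and> Z \<in> Ob C"
  unfolding extension_def using tri_type by blast

lemma shift_ob: "X \<in> Ob C \<Longrightarrow> sh_ob C n X \<in> Ob C"
  using lin_functor_ob[OF shift_functor] .

lemma shift_shift: "X \<in> Ob C \<Longrightarrow> sh_ob C m (sh_ob C n X) = sh_ob C (m + n) X"
  by (simp add: shift_add)

lemma shift_arr: "arr C X Y f \<Longrightarrow> arr C (sh_ob C n X) (sh_ob C n Y) (sh_map C n X Y f)"
  by (rule lin_functor_arr[OF shift_functor])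

lemma shift_cmp: "\<lbrakk>arr C X Y f; arr C Y Z g\<rbrakk> \<Longrightarrow> sh_map C n X Z (g \<odot> f) = sh_map C n Y Z g \<odot> sh_map C n X Y f"
  by (rule lin_functor_cmp[OF shift_functor])

lemma shift_map_map: "arr C X Y f \<Longrightarrow>
    sh_map C m (sh_ob C n X) (sh_ob C n Y) (sh_map C n X Y f) = sh_map C (m + n) X Y f"
  unfolding arr_def by (simp add: shift_add)

lemmas shift_lin = lin_functor_fmap_lin[OF linear_category_axioms linear_category_axioms shift_functor]

lemma shift_isom: "isom C X Y \<Longrightarrow> isom C (sh_ob C n X) (sh_ob C n Y)"
  by (rule lin_functor_isom[OF shift_functor])

lemma shift_retract: "retract C X Y \<Longrightarrow> retract C (sh_ob C n X) (sh_ob C n Y)"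
  by (rule lin_functor_retract[OF shift_functor])

lemma shift_zero_ob: "zero_ob C X \<Longrightarrow> zero_ob C (sh_ob C n X)"
  by (rule lin_functor_zero_ob[OF linear_category_axioms linear_category_axioms shift_functor])

lemma shift_inj:
  assumes "arr C X Y f" "arr C X Y g" "sh_map C n X Y f = sh_map C n X Y g" shows "f = g"
proof -
  have "sh_map C (- n) (sh_ob C n X) (sh_ob C n Y) (sh_map C n X Y h) = h" if "arr C X Y h" for h
    using shift_map_map[OF that, of "- n" n] shift_zero(2)[of X Y h] that unfolding arr_def by simp
  then show ?thesis using assms by metis
qed

lemma shift_map_surj:
  assumes X: "X \<in> Ob C" "Y \<in> Ob C" and g: "arr C (sh_ob C n X) (sh_ob C n Y) g"
  obtains f where "arr C X Y f" "sh_map C n X Y f = g"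
proof
  let ?f = "sh_map C (- n) (sh_ob C n X) (sh_ob C n Y) g"
  have XY: "sh_ob C (- n) (sh_ob C n X) = X" "sh_ob C (- n) (sh_ob C n Y) = Y"
    using X by (simp_all add: shift_shift shift_zero)
  show f: "arr C X Y ?f" using shift_arr[OF g, of "- n"] XY by simp
  show "sh_map C n X Y ?f = g"
    using shift_map_map[OF g, of n "- n"] XY shift_zero(2)[of _ _ g] g unfolding arr_def by simp
qed

lemma tri_rot: "tri C X Y Z f g h \<Longrightarrow> tri C Y Z (sh_ob C 1 X) g h (- sh_map C 1 X Y f)"
  using tri_rotate tri_type by metis

text \<open>The shift is an automorphism, so W is literally the shift of W[-1], and the rotation
  axiom can be read backwards once \<open>- k\<close> is written as a shifted morphism.\<close>

lemma tri_rot_back: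
  assumes "tri C Y Z W g h k"
  obtains f where "tri C (sh_ob C (- 1) W) Y Z f g h"
proof -
  note a = tri_arr[OF assms]
  have ob: "Y \<in> Ob C" "Z \<in> Ob C" "W \<in> Ob C" using a unfolding arr_def by auto
  have W: "sh_ob C 1 (sh_ob C (- 1) W) = W" using ob by (simp add: shift_shift shift_zero)
  have k': "arr C (sh_ob C 1 (sh_ob C (- 1) W)) (sh_ob C 1 Y) (- k)" using arr_uminus[OF a(3)] W by simp
  obtain f where f: "arr C (sh_ob C (- 1) W) Y f" "sh_map C 1 (sh_ob C (- 1) W) Y f = - k"
    using shift_map_surj[OF shift_ob[OF ob(3)] ob(1) k'] by blast
  have "tri C (sh_ob C (- 1) W) Y Z f g h"
    using tri_rotate[of "sh_ob C (- 1) W" Y Z f g h] f a W assms ob shift_ob unfolding arr_def by auto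
  then show ?thesis using that by blast
qed

lemma extension_rotate: "extension C X Y Z \<Longrightarrow> extension C Y Z (sh_ob C 1 X)"
  unfolding extension_def using tri_rot by blast

lemma extension_rotate_back: "extension C X Y Z \<Longrightarrow> extension C (sh_ob C (- 1) Z) X Y"
  unfolding extension_def using tri_rot_back by metis

text \<open>Three rotations shift every term by one; the signs they put on the maps are invisible to
  \<open>extension\<close>.\<close>

lemma extension_shift:
  assumes "extension C X Y Z" shows "extension C (sh_ob C n X) (sh_ob C n Y) (sh_ob C n Z)"
proof (induction n rule: int_induct[where k = 0])
  case base
  then show ?case using assms extension_ob by (simp add: shift_zero)
next
  case (step1 i)
  then show ?case using extension_rotate[OF extension_rotate[OF extension_rotate[OF step1(2)]]]
      extension_ob[OF assms] by (simp add: shift_shift add.commute)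
next
  case (step2 i)
  then show ?case using extension_rotate_back[OF extension_rotate_back[OF extension_rotate_back[OF step2(2)]]]
      extension_ob[OF assms] by (simp add: shift_shift)
qed

section \<open>Exactness of Hom, splittings and direct sums\<close>

lemma tri_comp_zero: assumes "tri C X Y Z f g h" shows "g \<odot> f = 0" "h \<odot> g = 0"
proof -
  have *: "g \<odot> f = 0" if t: "tri C X Y Z f g h" for X Y Z f g h
  proof -
    obtain W where W: "zero_ob C W" using ex_zero by blast
    note a = tri_arr[OF t]
    have X: "X \<in> Ob C" using a unfolding arr_def by auto
    \<comment> \<open>The triangle X = X \<rightarrow> 0 maps to the given one by the identity and
      f, so g f factors through the zero object W.\<close>
    obtain c where c: "c \<in> Hom C W Z" "c \<odot> 0 = g \<odot> f"
      using tri_complete[OF tri_idn[OF X W] t, of "idn C X" f] idn_hom[OF X] a(1) unfolding arr_def by auto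
    then show ?thesis using zero_r[of X W Z c] X W a(2) unfolding zero_ob_def arr_def by auto
  qed
  show "g \<odot> f = 0" using *[OF assms] .
  show "h \<odot> g = 0" using *[OF tri_rot[OF assms]] .
qed

text \<open>Exactness of Hom(-, W) at Y: the condition on a makes (0, a) the start of a morphism
  into the triangle 0 \<rightarrow> W = W, and its third component is the factorisation.\<close>

lemma tri_factor_left:
  assumes t: "tri C X Y Z f g h" and a: "arr C Y W a" "a \<odot> f = 0"
  obtains b where "arr C Z W b" "b \<odot> g = a"
proof -
  obtain V where V: "zero_ob C V" using ex_zero by blast
  note ar = tri_arr[OF t]
  have W: "W \<in> Ob C" "X \<in> Ob C" "V \<in> Ob C" using a V ar unfolding arr_def zero_ob_def by auto
  have "tri C W W (sh_ob C 1 V) (idn C W) 0 0" using tri_idn[OF W(1) shift_zero_ob[OF V]] .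
  then have "tri C V W W 0 (idn C W) 0"
    using tri_rotate[of V W W 0 "idn C W" 0] arr_zero arr_idn shift_ob W shift_lin(1)[OF W(3) W(1), of 1]
    unfolding arr_def by auto
  then obtain c where "c \<in> Hom C Z W" "c \<odot> g = idn C W \<odot> a"
    using tri_complete[OF t, of V W W 0 "idn C W" 0 0 a] a zero_l[OF W(1) arr_zero[OF W(2,3)]]
      arr_zero[OF W(2,3)] unfolding arr_def by auto
  then show ?thesis using that[of c] idl[OF a(1)] W ar unfolding arr_def by auto
qed

text \<open>Exactness of Hom(W, -) at Y. The completion axiom only produces third components, so
  both triangles are rotated once; the third component is then the shift of the required b.\<close>

lemma tri_factor_right:
  assumes t: "tri C X Y Z f g h" and a: "arr C W Y a" "g \<odot> a = 0"
  obtains b where "arr C W X b" "f \<odot> b = a"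
proof -
  obtain V where V: "zero_ob C V" using ex_zero by blast
  note ar = tri_arr[OF t]
  have W: "W \<in> Ob C" "X \<in> Ob C" "Y \<in> Ob C" "Z \<in> Ob C" "V \<in> Ob C"
    using a V ar unfolding arr_def zero_ob_def by auto
  have "tri C W V (sh_ob C 1 W) 0 0 (- idn C (sh_ob C 1 W))"
    using tri_rot[OF tri_idn[OF W(1) V]] lin_functor_idn[OF shift_functor W(1)] by simp
  moreover have "0 \<odot> 0 = g \<odot> a" using a(2) zero_r[OF W(1) arr_zero[OF W(5,4)]] by simp
  ultimately obtain c where c: "c \<in> Hom C (sh_ob C 1 W) (sh_ob C 1 X)"
    "sh_map C 1 W Y a \<odot> (- idn C (sh_ob C 1 W)) = (- sh_map C 1 X Y f) \<odot> c"
    using tri_complete[OF _ tri_rot[OF t], of W V "sh_ob C 1 W" 0 0 "- idn C (sh_ob C 1 W)" a 0]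
      a(1) arr_zero[OF W(5,4)] unfolding arr_def by auto
  have c': "arr C (sh_ob C 1 W) (sh_ob C 1 X) c" using c(1) W shift_ob unfolding arr_def by auto
  obtain b where b: "arr C W X b" "sh_map C 1 W X b = c"
    using shift_map_surj[OF W(1,2) c'] .
  have "- sh_map C 1 W Y a = - (sh_map C 1 X Y f \<odot> c)"
    using c(2) uminus_r[OF arr_idn shift_arr[OF a(1)]] idr[OF shift_arr[OF a(1)]] shift_ob[OF W(1)]
      uminus_l[OF c' shift_arr[OF ar(1)]] by simp
  then have "sh_map C 1 W Y a = sh_map C 1 W Y (f \<odot> b)" using shift_cmp[OF b(1) ar(1)] b(2) by simp
  then have "a = f \<odot> b" by (rule shift_inj[OF a(1) arr_cmp[OF b(1) ar(1)]])
  then show ?thesis using that b(1) by simp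
qed

lemma extension_isom:
  assumes "extension C X Y Z" "isom C X X'" "isom C Y Y'" "isom C Z Z'"
  shows "extension C X' Y' Z'"
proof -
  obtain f g h where t: "tri C X Y Z f g h" using assms(1) unfolding extension_def by auto
  note ar = tri_arr[OF t]
  obtain a a' where a: "arr C X X' a" "arr C X' X a'" "a' \<odot> a = idn C X" "a \<odot> a' = idn C X'"
    using assms(2) unfolding isom_def by auto
  obtain b b' where b: "arr C Y Y' b" "arr C Y' Y b'" "b' \<odot> b = idn C Y" "b \<odot> b' = idn C Y'"
    using assms(3) unfolding isom_def by auto
  obtain c c' where c: "arr C Z Z' c" "arr C Z' Z c'" "c' \<odot> c = idn C Z" "c \<odot> c' = idn C Z'"
    using assms(4) unfolding isom_def by auto
  have 1: "arr C X' Y' ((b \<odot> f) \<odot> a')" "((b \<odot> f) \<odot> a') \<odot> a = b \<odot> f"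
    using arr_cmp[OF a(2) arr_cmp[OF ar(1) b(1)]] assoc[OF a(1,2) arr_cmp[OF ar(1) b(1)]] a(3)
      idr[OF arr_cmp[OF ar(1) b(1)]] by simp_all
  have 2: "arr C Y' Z' ((c \<odot> g) \<odot> b')" "((c \<odot> g) \<odot> b') \<odot> b = c \<odot> g"
    using arr_cmp[OF b(2) arr_cmp[OF ar(2) c(1)]] assoc[OF b(1,2) arr_cmp[OF ar(2) c(1)]] b(3)
      idr[OF arr_cmp[OF ar(2) c(1)]] by simp_all
  let ?a1 = "sh_map C 1 X X' a"
  note a1 = shift_arr[OF a(1), of 1]
  have 3: "arr C Z' (sh_ob C 1 X') ((?a1 \<odot> h) \<odot> c')" "((?a1 \<odot> h) \<odot> c') \<odot> c = ?a1 \<odot> h"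
    using arr_cmp[OF c(2) arr_cmp[OF ar(3) a1]] assoc[OF c(1,2) arr_cmp[OF ar(3) a1]] c(3)
      idr[OF arr_cmp[OF ar(3) a1]] by simp_all
  have "tri C X' Y' Z' ((b \<odot> f) \<odot> a') ((c \<odot> g) \<odot> b') ((?a1 \<odot> h) \<odot> c')"
  proof (rule tri_iso[OF t])
    show "iso_mor C X X' a" "iso_mor C Y Y' b" "iso_mor C Z Z' c"
      using a b c unfolding iso_mor_def arr_def by auto
  qed (use 1 2 3 in \<open>auto simp: arr_def\<close>)
  then show ?thesis unfolding extension_def by blast
qed

lemma extension_zero_right: "\<lbrakk>X \<in> Ob C; zero_ob C Z\<rbrakk> \<Longrightarrow> extension C X X Z"
  unfolding extension_def using tri_idn by blast

lemma extension_zero_left: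
  assumes "X \<in> Ob C" "zero_ob C Z" shows "extension C Z X X"
  using extension_rotate_back[OF extension_zero_right[OF assms(1) shift_zero_ob[OF assms(2), of 1]]] assms
  by (simp add: shift_shift shift_zero zero_ob_def)

text \<open>f has a right inverse because g = 0 and a left inverse because the map from Z[-1] is
  0.\<close>

lemma isom_of_extension_zero_right:
  assumes e: "extension C X Y Z" and Z: "zero_ob C Z" shows "isom C X Y"
proof -
  obtain f g h where t: "tri C X Y Z f g h" using e unfolding extension_def by auto
  note ar = tri_arr[OF t]
  have ob: "X \<in> Ob C" "Y \<in> Ob C" using ar unfolding arr_def by auto
  have "g = 0" using zero_ob_to[OF Z ar(2)] .
  then have "g \<odot> idn C Y = 0" using idr[OF ar(2)] by simp
  then obtain b where b: "arr C Y X b" "f \<odot> b = idn C Y"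
    using tri_factor_right[OF t arr_idn[OF ob(2)]] by blast
  obtain w where w: "tri C (sh_ob C (- 1) Z) X Y w f g" using tri_rot_back[OF t] .
  have "w = 0" using zero_ob_from[OF shift_zero_ob[OF Z] tri_arr(1)[OF w]] .
  then have "idn C X \<odot> w = 0" using idl[OF tri_arr(1)[OF w]] by simp
  then obtain b' where b': "arr C Y X b'" "b' \<odot> f = idn C X"
    using tri_factor_left[OF w arr_idn[OF ob(1)]] by blast
  have "b' = b" using assoc[OF b(1) ar(1) b'(1)] b b' idr[OF b'(1)] idl[OF b(1)] by simp
  then show ?thesis unfolding isom_def using b b' ar(1) by blast
qed

text \<open>The shift of i is split by the shift of p, and its composite with h vanishes in the
  rotated triangle.\<close>

lemma section_splits:
  assumes "tri C X S Z i g h" and "arr C S X p" "p \<odot> i = idn C X"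
  shows "h = 0"
proof -
  note ar = tri_arr[OF assms(1)]
  have X: "X \<in> Ob C" "Z \<in> Ob C" using ar unfolding arr_def by auto
  have "(- sh_map C 1 X S i) \<odot> h = 0" using tri_comp_zero(2)[OF tri_rot[OF assms(1)]] .
  then have 0: "sh_map C 1 X S i \<odot> h = 0" using uminus_l[OF ar(3) shift_arr[OF ar(1)]] by simp
  have "h = idn C (sh_ob C 1 X) \<odot> h" using idl[OF ar(3)] by simp
  also have "\<dots> = (sh_map C 1 S X p \<odot> sh_map C 1 X S i) \<odot> h"
    using shift_cmp[OF ar(1) assms(2), of 1] assms(3) lin_functor_idn[OF shift_functor X(1)] by simp
  also have "\<dots> = 0"
    using assoc[OF ar(3) shift_arr[OF ar(1)] shift_arr[OF assms(2)]] 0 zero_r[OF X(2) shift_arr[OF assms(2)]] by simp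
  finally show ?thesis .
qed

text \<open>The cone Z of the inclusion i is shown to be Y: the projection q descends to
  \<open>u\<close> on Z, and \<open>w\<close> is the image of the other inclusion j.\<close>

lemma direct_sum_extension:
  assumes "X \<in> Ob C" "Y \<in> Ob C" "direct_sum C X Y S"
  shows "extension C X S Y"
proof -
  obtain i j p q where *: "arr C X S i" "arr C Y S j" "arr C S X p" "arr C S Y q"
    "p \<odot> i = idn C X" "q \<odot> j = idn C Y" "p \<odot> j = 0" "q \<odot> i = 0"
    "i \<odot> p + j \<odot> q = idn C S" and S: "S \<in> Ob C"
    using assms unfolding direct_sum_def arr_def by blast
  obtain Z g h where t: "tri C X S Z i g h" using tri_ex[of X S i] * unfolding arr_def by blast
  note ar = tri_arr[OF t]
  have Z: "Z \<in> Ob C" using ar unfolding arr_def by auto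
  obtain u where u: "arr C Z Y u" "u \<odot> g = q" using tri_factor_left[OF t *(4,8)] .
  define w where "w = g \<odot> j"
  have w: "arr C Y Z w" unfolding w_def using arr_cmp[OF *(2) ar(2)] .
  have uw: "u \<odot> w = idn C Y" unfolding w_def using assoc[OF *(2) ar(2) u(1)] u(2) *(6) by simp
  have wu: "arr C Z Z (w \<odot> u)" using arr_cmp[OF u(1) w] .
  have "(w \<odot> u) \<odot> g = g \<odot> (j \<odot> q)"
    using assoc[OF ar(2) u(1) w] u(2) assoc[OF *(4,2) ar(2)] unfolding w_def by simp
  also have "j \<odot> q = idn C S - i \<odot> p" using *(9) by (simp add: eq_diff_eq add.commute)
  also have "g \<odot> (idn C S - i \<odot> p) = g - g \<odot> (i \<odot> p)"
    using diff_r[OF arr_idn[OF S] arr_cmp[OF *(3,1)] ar(2)] idr[OF ar(2)] by simp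
  also have "g \<odot> (i \<odot> p) = 0"
    using assoc[OF *(3,1) ar(2)] tri_comp_zero(1)[OF t] zero_l[OF Z *(3)] by simp
  finally have "(w \<odot> u - idn C Z) \<odot> g = 0"
    using diff_l[OF ar(2) wu arr_idn[OF Z]] idl[OF ar(2)] by simp
  \<comment> \<open>The defect of \<open>w \<odot> u\<close> vanishes after composition with g, so
    it factors through h, which is 0 as i is split.\<close>
  then obtain k where k: "arr C (sh_ob C 1 X) Z k" "k \<odot> h = w \<odot> u - idn C Z"
    using tri_factor_left[OF tri_rot[OF t] arr_diff[OF wu arr_idn[OF Z]]] by blast
  have "k \<odot> h = 0" using section_splits[OF t *(3,5)] zero_r[OF Z k(1)] by simp
  then have "w \<odot> u = idn C Z" using k(2) by simp
  then have "isom C Z Y" unfolding isom_def using u w uw by blast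
  then show ?thesis
    using extension_isom[of X S Z X S Y] t isom_refl assms S unfolding extension_def by blast
qed

text \<open>The complement is the cone of the section i: its connecting map is 0 by
  \<open>section_splits\<close>, so g has a section s.\<close>

lemma retract_direct_sum:
  assumes "retract C X S" obtains Z where "Z \<in> Ob C" "direct_sum C X Z S"
proof -
  obtain i p where ip: "arr C X S i" "arr C S X p" "p \<odot> i = idn C X" using assms unfolding retract_def by auto
  obtain Z g h where t: "tri C X S Z i g h" using tri_ex[of X S i] ip unfolding arr_def by blast
  note ar = tri_arr[OF t]
  have ob: "X \<in> Ob C" "S \<in> Ob C" "Z \<in> Ob C" using ar unfolding arr_def by auto
  have "h \<odot> idn C Z = 0" using section_splits[OF t ip(2,3)] idr[OF ar(3)] by simp
  then obtain s where s: "arr C Z S s" "g \<odot> s = idn C Z"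
    using tri_factor_right[OF tri_rot[OF t] arr_idn[OF ob(3)]] by blast
  have gi: "g \<odot> i = 0" using tri_comp_zero(1)[OF t] .
  \<comment> \<open>Removing the X-component of s makes it orthogonal to p without changing its
    composite with g.\<close>
  define j where "j = s - i \<odot> (p \<odot> s)"
  note ps = arr_cmp[OF s(1) ip(2)]
  have j: "arr C Z S j" unfolding j_def using arr_diff[OF s(1) arr_cmp[OF ps ip(1)]] .
  have pj: "p \<odot> j = 0" unfolding j_def
    using diff_r[OF s(1) arr_cmp[OF ps ip(1)] ip(2)] assoc[OF ps ip(1,2)] ip(3) idl[OF ps] by simp
  have gj: "g \<odot> j = idn C Z" unfolding j_def
    using diff_r[OF s(1) arr_cmp[OF ps ip(1)] ar(2)] assoc[OF ps ip(1) ar(2)] gi zero_l[OF ob(3) ps] s(2) by simp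
  note ip' = arr_cmp[OF ip(2,1)] and jg = arr_cmp[OF ar(2) j]
  \<comment> \<open>The error in the decomposition of the identity. It is killed by g, so it factors
    through i, and it is killed by p, so that factor is 0.\<close>
  define e where "e = idn C S - i \<odot> p - j \<odot> g"
  have e: "arr C S S e" unfolding e_def using arr_diff[OF arr_diff[OF arr_idn[OF ob(2)] ip'] jg] .
  have "g \<odot> e = 0" unfolding e_def
    using diff_r[OF arr_diff[OF arr_idn[OF ob(2)] ip'] jg ar(2)] diff_r[OF arr_idn[OF ob(2)] ip' ar(2)]
      idr[OF ar(2)] assoc[OF ip(2,1) ar(2)] gi zero_l[OF ob(3) ip(2)] assoc[OF ar(2) j ar(2)] gj idl[OF ar(2)] by simp
  then obtain k where k: "arr C S X k" "i \<odot> k = e" using tri_factor_right[OF t e] by blast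
  have "k = p \<odot> e" using assoc[OF k(1) ip(1,2)] ip(3) idl[OF k(1)] k(2) by simp
  also have "\<dots> = 0" unfolding e_def
    using diff_r[OF arr_diff[OF arr_idn[OF ob(2)] ip'] jg ip(2)] diff_r[OF arr_idn[OF ob(2)] ip' ip(2)]
      idr[OF ip(2)] assoc[OF ip(2,1,2)] ip(3) idl[OF ip(2)] assoc[OF ar(2) j ip(2)] pj zero_l[OF ob(1) ar(2)] by simp
  finally have "e = 0" using k(2) zero_r[OF ob(2) ip(1)] by simp
  then have "i \<odot> p + j \<odot> g = idn C S" unfolding e_def by (simp add: algebra_simps)
  then have "direct_sum C X Z S" unfolding direct_sum_def
    using ip ar(2) j pj gj gi ob unfolding arr_def by blast
  then show ?thesis using that ob(3) by blast
qed

lemma direct_sum_retract: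
  assumes "X \<in> Ob C" "Z \<in> Ob C" "direct_sum C X Z S" shows "retract C X S"
  using assms unfolding direct_sum_def retract_def arr_def by blast

text \<open>The endomorphism of a triangle that is the identity on the outer terms is \<open>1 + d\<close> with \<open>d\<^sup>2 = 0\<close>
  on the middle one, hence invertible.\<close>

lemma retract_extension:
  assumes e: "extension C X Y Z" and X: "retract C X X'" and Z: "retract C Z Z'"
  obtains Y' where "extension C X' Y' Z'" "retract C Y Y'"
proof -
  obtain f g h where t: "tri C X Y Z f g h" using e unfolding extension_def by auto
  note ar = tri_arr[OF t]
  obtain i p where ip: "arr C X X' i" "arr C X' X p" "p \<odot> i = idn C X" using X unfolding retract_def by auto
  obtain j q where jq: "arr C Z Z' j" "arr C Z' Z q" "q \<odot> j = idn C Z" using Z unfolding retract_def by auto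
  have ob: "X \<in> Ob C" "Y \<in> Ob C" "Z \<in> Ob C" "X' \<in> Ob C" "Z' \<in> Ob C"
    using ar ip jq unfolding arr_def by auto
  let ?i = "sh_map C 1 X X' i" and ?p = "sh_map C 1 X' X p"
  note i1 = shift_arr[OF ip(1), of 1] and p1 = shift_arr[OF ip(2), of 1]
  \<comment> \<open>The connecting map is transported to one from Z' to X'[1]; the new middle term
    is the cone \<open>W\<close> of \<open>h'\<close>, shifted back by one.\<close>
  define h' where "h' = (?i \<odot> h) \<odot> q"
  note ih = arr_cmp[OF ar(3) i1]
  have h': "arr C Z' (sh_ob C 1 X') h'" unfolding h'_def using arr_cmp[OF jq(2) ih] .
  have pi: "?p \<odot> ?i = idn C (sh_ob C 1 X)"
    using shift_cmp[OF ip(1,2), of 1] ip(3) lin_functor_idn[OF shift_functor ob(1)] by simp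
  have hj: "h' \<odot> j = ?i \<odot> h" unfolding h'_def using assoc[OF jq(1,2) ih] jq(3) idr[OF ih] by simp
  have ph: "?p \<odot> h' = h \<odot> q"
    unfolding h'_def using assoc[OF jq(2) ih p1] assoc[OF ar(3) i1 p1] pi idl[OF ar(3)] by simp
  have th: "tri C Z (sh_ob C 1 X) (sh_ob C 1 Y) h (- sh_map C 1 X Y f) (- sh_map C 1 Y Z g)"
    using tri_rot[OF tri_rot[OF t]] .
  obtain W k l where th': "tri C Z' (sh_ob C 1 X') W h' k l" using tri_ex h' unfolding arr_def by blast
  have obW: "W \<in> Ob C" using tri_arr[OF th'] unfolding arr_def by auto
  note ar' = tri_arr[OF th'] and ar1 = tri_arr[OF th]
  obtain a where a: "arr C (sh_ob C 1 Y) W a" "a \<odot> (- sh_map C 1 X Y f) = k \<odot> ?i"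
      "sh_map C 1 Z Z' j \<odot> (- sh_map C 1 Y Z g) = l \<odot> a"
    using tri_complete[OF th th', of j ?i] jq(1) i1 hj obW shift_ob[OF ob(2)] unfolding arr_def by auto
  obtain b where b: "arr C W (sh_ob C 1 Y) b" "b \<odot> k = (- sh_map C 1 X Y f) \<odot> ?p"
      "sh_map C 1 Z' Z q \<odot> l = (- sh_map C 1 Y Z g) \<odot> b"
    using tri_complete[OF th' th, of q ?p] jq(2) p1 ph obW shift_ob[OF ob(2)] unfolding arr_def by auto
  let ?Y = "sh_ob C 1 Y" and ?f = "- sh_map C 1 X Y f" and ?g = "- sh_map C 1 Y Z g"
  have Y1: "?Y \<in> Ob C" using shift_ob[OF ob(2)] .
  note ba = arr_cmp[OF a(1) b(1)]
  define d where "d = b \<odot> a - idn C ?Y"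
  have d: "arr C ?Y ?Y d" unfolding d_def using arr_diff[OF ba arr_idn[OF Y1]] .
  have "(b \<odot> a) \<odot> ?f = ?f"
  proof -
    have "(b \<odot> a) \<odot> ?f = b \<odot> (k \<odot> ?i)" using assoc[OF ar1(2) a(1) b(1)] a(2) by simp
    also have "\<dots> = (?f \<odot> ?p) \<odot> ?i" using assoc[OF i1 ar'(2) b(1)] b(2) by simp
    also have "\<dots> = ?f" using assoc[OF i1 p1 ar1(2)] pi idr[OF ar1(2)] by simp
    finally show ?thesis .
  qed
  then have df: "d \<odot> ?f = 0" unfolding d_def using diff_l[OF ar1(2) ba arr_idn[OF Y1]] idl[OF ar1(2)] by simp
  have "?g \<odot> (b \<odot> a) = ?g"
  proof -
    note j1 = shift_arr[OF jq(1), of 1] and q1 = shift_arr[OF jq(2), of 1]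
    have "?g \<odot> (b \<odot> a) = (sh_map C 1 Z' Z q \<odot> l) \<odot> a" using assoc[OF a(1) b(1) ar1(3)] b(3) by simp
    also have "\<dots> = sh_map C 1 Z' Z q \<odot> (sh_map C 1 Z Z' j \<odot> ?g)" using assoc[OF a(1) ar'(3) q1] a(3) by simp
    also have "\<dots> = idn C (sh_ob C 1 Z) \<odot> ?g"
      using assoc[OF ar1(3) j1 q1] shift_cmp[OF jq(1,2), of 1] jq(3) lin_functor_idn[OF shift_functor ob(3)] by simp
    also have "\<dots> = ?g" using idl[OF ar1(3)] by simp
    finally show ?thesis .
  qed
  then have gd: "?g \<odot> d = 0" unfolding d_def using diff_r[OF ba arr_idn[OF Y1] ar1(3)] idr[OF ar1(3)] by simp
  \<comment> \<open>d kills the incoming map, so it factors as d' ?g, and ?g d = 0; hence d d = d'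
    (?g d) = 0.\<close>
  obtain d' where d': "arr C (sh_ob C 1 Z) ?Y d'" "d' \<odot> ?g = d" using tri_factor_left[OF tri_rot[OF th] d df] .
  have dd: "d \<odot> d = 0" using assoc[OF d ar1(3) d'(1)] d'(2) gd zero_r[OF Y1 d'(1)] by simp
  have ba_d: "b \<odot> a = idn C ?Y + d" unfolding d_def by simp
  have inv: "(idn C ?Y - d) \<odot> (b \<odot> a) = idn C ?Y"
    unfolding ba_d using add_r[OF arr_idn[OF Y1] d arr_diff[OF arr_idn[OF Y1] d]]
      idr[OF arr_diff[OF arr_idn[OF Y1] d]] diff_l[OF d arr_idn[OF Y1] d] idl[OF d] dd by simp
  have eb: "arr C W ?Y ((idn C ?Y - d) \<odot> b)" using arr_cmp[OF b(1) arr_diff[OF arr_idn[OF Y1] d]] .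
  have "((idn C ?Y - d) \<odot> b) \<odot> a = idn C ?Y"
    using assoc[OF a(1) b(1) arr_diff[OF arr_idn[OF Y1] d]] inv by simp
  then have "retract C ?Y W" unfolding retract_def using a(1) eb by blast
  then have "retract C Y (sh_ob C (- 1) W)"
    using shift_retract[of ?Y W "- 1"] ob(2) by (simp add: shift_shift shift_zero)
  moreover have "extension C X' (sh_ob C (- 1) W) Z'"
    using extension_rotate_back[OF extension_rotate_back[of Z' "sh_ob C 1 X'" W]] th' ob(4)
    unfolding extension_def by (auto simp: shift_shift shift_zero)
  ultimately show ?thesis using that by blast
qed

text \<open>Y' plays the role of the preimage of Z' under Y \<rightarrow> Z. It is the fibre of the
  composite Y \<rightarrow> Z \<rightarrow> E, and the octahedron on this composite identifies its
  extension by X and Z'.\<close>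

lemma extension_octahedral:
  assumes "extension C X Y Z" "extension C Z' Z E"
  obtains Y' where "extension C X Y' Z'" "extension C Y' Y E"
proof -
  obtain u v w where t1: "tri C X Y Z u v w" using assms(1) unfolding extension_def by auto
  obtain f g h where t2: "tri C Z' Z E f g h" using assms(2) unfolding extension_def by auto
  have gv: "arr C Y E (g \<odot> v)" using arr_cmp tri_arr t1 t2 by blast
  obtain W k r where t3: "tri C Y E W (g \<odot> v) k r" using tri_ex gv unfolding arr_def by blast
  have "extension C (sh_ob C 1 X) W (sh_ob C 1 Z')"
    using octahedral[OF tri_rot[OF t1] tri_rot[OF t2] t3] unfolding extension_def by blast
  from extension_shift[OF this, of "- 1"] have "extension C X (sh_ob C (- 1) W) Z'"
    using extension_ob[OF assms(1)] extension_ob[OF assms(2)] by (simp add: shift_shift shift_zero)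
  moreover have "extension C (sh_ob C (- 1) W) Y E" using t3 extension_rotate_back unfolding extension_def by blast
  ultimately show ?thesis using that by blast
qed

end

subsection \<open>Exact functors\<close>

lemma exact_functor_lin: "exact_functor C D F \<Longrightarrow> lin_functor C D F"
  unfolding exact_functor_def by auto

lemma exact_functor_extension: "\<lbrakk>exact_functor C D F; extension C X Y Z\<rbrakk> \<Longrightarrow> extension D (fob F X) (fob F Y) (fob F Z)"
  unfolding exact_functor_def extension_def by blast

text \<open>\<open>exact_functor\<close> compares the functor with the shift by 1 only. Negative
  powers are reached by using this comparison at X[i - 1] and undoing one shift.\<close>

lemma exact_functor_shift:
  assumes "triangulated_category C" "triangulated_category D" "exact_functor C D F" "X \<in> Ob C"
  shows "isom D (fob F (sh_ob C n X)) (sh_ob D n (fob F X))"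
proof -
  interpret C: triangulated_category C by fact
  interpret D: triangulated_category D by fact
  note lin = exact_functor_lin[OF assms(3)]
  have 1: "isom D (fob F (sh_ob C 1 Y)) (sh_ob D 1 (fob F Y))" if "Y \<in> Ob C" for Y
    using assms(3) that C.shift_ob D.shift_ob lin_functor_ob[OF lin]
    unfolding exact_functor_def nat_iso_def isom_iff iso_ob_def by auto
  show ?thesis
  proof (induction n rule: int_induct[where k = 0])
    case base
    then show ?case using assms(4) lin_functor_ob[OF lin] by (simp add: C.shift_zero D.shift_zero D.isom_refl)
  next
    case (step1 i)
    have "isom D (fob F (sh_ob C 1 (sh_ob C i X))) (sh_ob D 1 (sh_ob D i (fob F X)))"
      using D.isom_trans[OF 1[OF C.shift_ob[OF assms(4)]] D.shift_isom[OF step1(2)]] .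
    then show ?case using assms(4) lin_functor_ob[OF lin] by (simp add: C.shift_shift D.shift_shift add.commute)
  next
    case (step2 i)
    have "isom D (fob F (sh_ob C i X)) (sh_ob D 1 (fob F (sh_ob C (i - 1) X)))"
      using 1[OF C.shift_ob[OF assms(4), of "i - 1"]] assms(4) by (simp add: C.shift_shift)
    then have "isom D (sh_ob D 1 (fob F (sh_ob C (i - 1) X))) (sh_ob D i (fob F X))"
      using D.isom_trans[OF isom_sym step2(2)] by blast
    from D.shift_isom[OF this, of "- 1"] show ?case
      using assms(4) lin_functor_ob[OF lin] C.shift_ob by (simp add: D.shift_shift D.shift_zero)
  qed
qed

section \<open>Complexity and entropy\<close>

text \<open>The towers of the complexity at t = 0: the shifts n are forgotten and only the number of
  steps is recorded.\<close>

inductive built :: "('k, 'o, 'm::ab_group_add) tricat \<Rightarrow> 'o \<Rightarrow> nat \<Rightarrow> 'o \<Rightarrow> bool"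
  for C :: "('k, 'o, 'm::ab_group_add) tricat" and E :: 'o
where
  built_zero: "zero_ob C X \<Longrightarrow> built C E 0 X"
| built_step: "\<lbrakk>built C E k X; extension C X Y (sh_ob C n E)\<rbrakk> \<Longrightarrow> built C E (Suc k) Y"

text \<open>The retract replaces the complement F' in the definition of complexity.\<close>

definition level :: "('k, 'o, 'm::ab_group_add) tricat \<Rightarrow> 'o \<Rightarrow> nat \<Rightarrow> 'o \<Rightarrow> bool" where
  "level C E k F \<longleftrightarrow> (\<exists>B. built C E k B \<and> retract C F B)"

text \<open>The least number is meaningful only if some level exists, which explains the
  \<open>level\<close> premise of the lemmas about it.\<close>

definition cone_length :: "('k, 'o, 'm::ab_group_add) tricat \<Rightarrow> 'o \<Rightarrow> 'o \<Rightarrow> nat" where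
  "cone_length C E F = (LEAST k. level C E k F)"

lemma cone_length_le: "level C E k F \<Longrightarrow> cone_length C E F \<le> k"
  unfolding cone_length_def by (rule Least_le)

lemma level_cone_length: "level C E k F \<Longrightarrow> level C E (cone_length C E F) F"
  unfolding cone_length_def by (rule LeastI)

section \<open>Calculus of levels and cone lengths\<close>

context triangulated_category
begin

lemma zero_ob_isom_transfer: "\<lbrakk>zero_ob C X; isom C X Y\<rbrakk> \<Longrightarrow> zero_ob C Y"
  by (rule zero_ob_retract[OF _ isom_retract[OF isom_sym]])

lemma built_isom: assumes "built C E k X" "isom C X Y" shows "built C E k Y"
  using assms(1)
proof (cases rule: built.cases)
  case built_zero
  then show ?thesis using zero_ob_isom_transfer[OF _ assms(2)] built.built_zero by simp
next
  case (built_step k' X' n)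
  have "extension C X' Y (sh_ob C n E)"
    using extension_isom[OF built_step(3) isom_refl assms(2) isom_refl] extension_ob[OF built_step(3)] by blast
  then show ?thesis using built_step built.built_step by simp
qed

text \<open>Induction along the tower of Z: the octahedron turns the last cone of Z into a last cone
  of Y, leaving an extension of the shorter tower by X.\<close>

lemma built_extension:
  assumes "built C E l Z" "built C E k X" "extension C X Y Z"
  shows "built C E (k + l) Y"
  using assms(1,3)
proof (induction arbitrary: Y rule: built.induct)
  case (built_zero Z)
  then show ?case using built_isom[OF assms(2)] isom_of_extension_zero_right by simp
next
  case (built_step l Z' Z n)
  obtain Y' where "extension C X Y' Z'" "extension C Y' Y (sh_ob C n E)"
    using extension_octahedral[OF built_step(4,2)] .
  then show ?case using built.built_step[OF built_step(3)] by simp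
qed

lemma built_shift:
  assumes "built C E k X" "E \<in> Ob C" shows "built C E k (sh_ob C n X)"
  using assms(1)
proof (induction rule: built.induct)
  case (built_zero X)
  then show ?case by (intro built.built_zero shift_zero_ob)
next
  case (built_step k X Y m)
  show ?case
    using built.built_step[OF built_step(3), of "sh_ob C n Y" "n + m"] extension_shift[OF built_step(2), of n] assms(2)
    by (simp add: shift_shift)
qed

lemma level_ob: "level C E k F \<Longrightarrow> F \<in> Ob C"
  unfolding level_def retract_def arr_def by auto

lemma level_zero: "zero_ob C F \<Longrightarrow> level C E 0 F"
  unfolding level_def using built_zero retract_refl zero_ob_def by metis

lemma level_retract: "\<lbrakk>level C E k F; retract C F' F\<rbrakk> \<Longrightarrow> level C E k F'"
  unfolding level_def using retract_trans by metis

lemma level_isom: "\<lbrakk>level C E k F; isom C F F'\<rbrakk> \<Longrightarrow> level C E k F'"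
  by (rule level_retract[OF _ isom_retract[OF isom_sym]])

lemma level_shift: "\<lbrakk>level C E k F; E \<in> Ob C\<rbrakk> \<Longrightarrow> level C E k (sh_ob C n F)"
  unfolding level_def using built_shift shift_retract by metis

lemma level_self: "E \<in> Ob C \<Longrightarrow> level C E 1 E"
proof -
  assume E: "E \<in> Ob C"
  obtain Z where Z: "zero_ob C Z" using ex_zero by blast
  have "built C E (Suc 0) E"
    using built_step[OF built_zero[OF Z], of E 0] extension_zero_left[OF E Z] shift_zero(1)[OF E] by simp
  then show ?thesis unfolding level_def using retract_refl[OF E] by auto
qed

text \<open>The triangle is first enlarged by \<open>retract_extension\<close> to one whose ends are
  honestly built, with Y a retract of the new middle term.\<close>

lemma level_extension:
  assumes "level C E k X" "level C E l Z" "extension C X Y Z" shows "level C E (k + l) Y"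
proof -
  obtain B B' where B: "built C E k B" "retract C X B" "built C E l B'" "retract C Z B'"
    using assms unfolding level_def by auto
  obtain Y' where "extension C B Y' B'" "retract C Y Y'"
    using retract_extension[OF assms(3) B(2,4)] .
  then show ?thesis unfolding level_def using built_extension[OF B(3,1)] by blast
qed

text \<open>Each of the l cones on a shift of F is replaced by k cones on shifts of E. This is the
  source of submultiplicativity.\<close>

lemma level_trans:
  assumes "level C E k F" "level C F l X" "E \<in> Ob C" shows "level C E (k * l) X"
proof -
  have "level C E (k * l) B" if "built C F l B" for B
    using that
  proof (induction rule: built.induct)
    case (built_zero X)
    then show ?case using level_zero by simp
  next
    case (built_step l X Y n)
    then show ?case using level_extension[OF built_step(3) level_shift[OF assms(1,3)] built_step(2)]
      by (simp add: algebra_simps)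
  qed
  then show ?thesis using assms(2) level_retract unfolding level_def by blast
qed

lemma thick_closure_ob: "X \<in> thick_closure C G \<Longrightarrow> X \<in> Ob C"
proof (induction rule: thick_closure.induct)
  case (shift X n)
  then show ?case by (simp add: shift_ob)
next
  case (cone X Y Z f g h)
  then show ?case using tri_type by blast
qed

text \<open>Every closure operation preserves finiteness of the level; in the cone case, Z is an
  extension of X[1] by Y.\<close>

lemma thick_closure_level: "X \<in> thick_closure C G \<Longrightarrow> \<exists>k. level C G k X"
proof (induction rule: thick_closure.induct)
  case gen
  then show ?case using level_self by blast
next
  case (shift X n)
  then obtain k where k: "level C G k X" by blast
  then obtain k' B where "built C G k' B" "retract C X B" unfolding level_def by blast
  have "level C G k (sh_ob C n X)"
  proof (cases "G \<in> Ob C")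
    case True
    then show ?thesis using level_shift k by blast
  next
    case False
    \<comment> \<open>If G is not an object there is nothing to start from, and the closure is
      empty.\<close>
    have "X \<in> thick_closure C G \<Longrightarrow> False" for X
      by (induction rule: thick_closure.induct) (use False in auto)
    then show ?thesis using shift by blast
  qed
  then show ?case by blast
next
  case (cone X Y Z f g h)
  then obtain k l where kl: "level C G k X" "level C G l Y" by blast
  have G: "G \<in> Ob C"
  proof (rule ccontr)
    assume False: "G \<notin> Ob C"
    have "X \<in> thick_closure C G \<Longrightarrow> False" for X
      by (induction rule: thick_closure.induct) (use False in auto)
    then show False using cone by blast
  qed
  have "extension C Y Z (sh_ob C 1 X)"
    using cone(3) extension_rotate unfolding extension_def by blast
  then show ?case using level_extension[OF kl(2) level_shift[OF kl(1) G]] by blast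
next
  case (iso X Y)
  then show ?case using level_isom level_ob isom_iff by metis
next
  case (summand S X Y)
  from summand.IH obtain k where k: "level C G k S" by (rule exE)
  from level_retract[OF k direct_sum_retract[OF summand.hyps(2-4)]] show ?case by (rule exI)
qed

lemma split_generator_level: "\<lbrakk>split_generator C G; X \<in> Ob C\<rbrakk> \<Longrightarrow> level C G (cone_length C G X) X"
  using thick_closure_level[of X G] level_cone_length[of C G _ X] unfolding split_generator_def by auto

lemma built_iff_tower:
  "built C E k B \<longleftrightarrow> (\<exists>A n. zero_ob C (A 0) \<and> A k = B \<and>
      (\<forall>i\<in>{1..k}. \<exists>f g h. tri C (A (i - 1)) (A i) (sh_ob C (n i) E) f g h))"
proof
  assume "built C E k B"
  then show "\<exists>A n. zero_ob C (A 0) \<and> A k = B \<and>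
      (\<forall>i\<in>{1..k}. \<exists>f g h. tri C (A (i - 1)) (A i) (sh_ob C (n i) E) f g h)"
  proof (induction rule: built.induct)
    case (built_zero X)
    then show ?case by (intro exI[of _ "\<lambda>_. X"]) auto
  next
    case (built_step k X Y m)
    then obtain A n where A: "zero_ob C (A 0)" "A k = X"
      "\<forall>i\<in>{1..k}. \<exists>f g h. tri C (A (i - 1)) (A i) (sh_ob C (n i) E) f g h" by blast
    show ?case
    proof (rule exI[of _ "A(Suc k := Y)"], rule exI[of _ "n(Suc k := m)"], intro conjI ballI)
      show "zero_ob C ((A(Suc k := Y)) 0)" "(A(Suc k := Y)) (Suc k) = Y" using A by auto
      fix i assume i: "i \<in> {1..Suc k}"
      show "\<exists>f g h. tri C ((A(Suc k := Y)) (i - 1)) ((A(Suc k := Y)) i) (sh_ob C ((n(Suc k := m)) i) E) f g h"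
      proof (cases "i = Suc k")
        case True
        then show ?thesis using built_step(2) A(2) unfolding extension_def by simp
      next
        case False
        then show ?thesis using A(3) i by auto
      qed
    qed
  qed
next
  assume "\<exists>A n. zero_ob C (A 0) \<and> A k = B \<and>
      (\<forall>i\<in>{1..k}. \<exists>f g h. tri C (A (i - 1)) (A i) (sh_ob C (n i) E) f g h)"
  then obtain A n where A: "zero_ob C (A 0)" "A k = B"
    "\<forall>i\<in>{1..k}. \<exists>f g h. tri C (A (i - 1)) (A i) (sh_ob C (n i) E) f g h" by blast
  have "i \<le> k \<Longrightarrow> built C E i (A i)" for i
  proof (induction i)
    case 0
    then show ?case using A(1) built_zero by simp
  next
    case (Suc i)
    have "extension C (A i) (A (Suc i)) (sh_ob C (n (Suc i)) E)"
      using A(3)[rule_format, of "Suc i"] Suc(2) unfolding extension_def by simp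
    then show ?case using Suc built_step by (meson Suc_leD)
  qed
  then show "built C E k B" using A(2) by blast
qed

text \<open>At t = 0 the sum over a tower is its length, so the infimum runs over a nonempty set of
  natural numbers and is attained. For a zero object both sides are 0.\<close>

lemma complexity_eq_cone_length:
  assumes "level C E k F"
  shows "complexity C 0 E F = ereal (real (cone_length C E F))"
proof (cases "zero_ob C F")
  case True
  then show ?thesis unfolding complexity_def using cone_length_le[OF level_zero[OF True], of E]
    by (simp add: zero_ereal_def)
next
  case False
  have F: "F \<in> Ob C" using level_ob[OF assms] .
  have lev: "level C E k F \<longleftrightarrow> (\<exists>n F' A. F' \<in> Ob C \<and> zero_ob C (A 0) \<and> direct_sum C F F' (A k) \<and>
              (\<forall>i\<in>{1..k}. \<exists>f g h. tri C (A (i - 1)) (A i) (sh_ob C (n i) E) f g h))" for k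
  proof -
    have "retract C F B \<longleftrightarrow> (\<exists>F'\<in>Ob C. direct_sum C F F' B)" for B
      using retract_direct_sum[of F B] direct_sum_retract[OF F] by metis
    then show ?thesis unfolding level_def built_iff_tower by metis
  qed
  have "{ereal (\<Sum>i=1..k. exp (real_of_int (n i) * 0)) | (k::nat) (n :: nat \<Rightarrow> int).
            \<exists>F' A. F' \<in> Ob C \<and> zero_ob C (A 0) \<and> direct_sum C F F' (A k) \<and>
              (\<forall>i\<in>{1..k}. \<exists>f g h. tri C (A (i - 1)) (A i) (sh_ob C (n i) E) f g h)}
      = {ereal (real k) | k. level C E k F}"
    unfolding lev by auto
  then have "complexity C 0 E F = Inf {ereal (real k) | k. level C E k F}"
    unfolding complexity_def using False by simp
  also have "\<dots> = ereal (real (cone_length C E F))"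
  proof (rule antisym)
    show "Inf {ereal (real k) | k. level C E k F} \<le> ereal (real (cone_length C E F))"
      using level_cone_length[OF assms] by (intro Inf_lower) blast
    show "ereal (real (cone_length C E F)) \<le> Inf {ereal (real k) | k. level C E k F}"
      using cone_length_le by (intro Inf_greatest) fastforce
  qed
  finally show ?thesis .
qed

lemma cone_length_trans:
  assumes "level C E k F" "level C F l X" "E \<in> Ob C"
  shows "cone_length C E X \<le> cone_length C E F * l"
  using cone_length_le[OF level_trans[OF level_cone_length[OF assms(1)] assms(2,3)]] .

end

lemma exact_functor_built:
  assumes "triangulated_category C" "triangulated_category D" "exact_functor C D F" "built C E k X" "E \<in> Ob C"
  shows "built D (fob F E) k (fob F X)"
  using assms(4)
proof (induction rule: built.induct)
  case (built_zero X)
  then show ?case using lin_functor_zero_ob[OF _ _ exact_functor_lin[OF assms(3)]] assms(1,2) built.built_zero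
    triangulated_category.axioms(1) by metis
next
  case (built_step k X Y n)
  interpret C: triangulated_category C by fact
  interpret D: triangulated_category D by fact
  have "extension D (fob F X) (fob F Y) (fob F (sh_ob C n E))"
    using exact_functor_extension[OF assms(3) built_step(2)] .
  then have "extension D (fob F X) (fob F Y) (sh_ob D n (fob F E))"
    using D.extension_isom[OF _ D.isom_refl D.isom_refl exact_functor_shift[OF assms(1-3,5)]] D.extension_ob by blast
  then show ?case using built.built_step[OF built_step(3)] by blast
qed

lemma exact_functor_level:
  assumes "triangulated_category C" "triangulated_category D" "exact_functor C D F" "level C E k X" "E \<in> Ob C"
  shows "level D (fob F E) k (fob F X)"
  using assms(4) exact_functor_built[OF assms(1-3) _ assms(5)] lin_functor_retract[OF exact_functor_lin[OF assms(3)]]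
  unfolding level_def by blast

subsection \<open>Fekete's lemma\<close>

text \<open>The limit is the infimum of the quotients. Writing n = q m + r with a nearly optimal m,
  the remainder contributes a bounded amount that disappears after division by n.\<close>

lemma fekete:
  fixes u :: "nat \<Rightarrow> real"
  assumes sub: "\<And>m n. u (m + n) \<le> u m + u n" and nn: "\<And>n. 0 \<le> u n"
  obtains h where "0 \<le> h" "(\<lambda>n. u n / real n) \<longlonglongrightarrow> h"
proof -
  \<comment> \<open>The index 0 is excluded: u 0 / 0 is 0 and would pull the infimum down to
    0.\<close>
  define h where "h = (INF n\<in>{1..}. u n / real n)"
  have bdd: "bdd_below ((\<lambda>n. u n / real n) ` {1..})" using nn by (intro bdd_belowI[of _ 0]) auto
  have h: "h \<le> u n / real n" if "n \<ge> 1" for n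
    unfolding h_def using that by (intro cINF_lower[OF bdd]) auto
  have h0: "0 \<le> h" unfolding h_def using nn by (intro cINF_greatest) auto
  have "(\<lambda>n. u n / real n) \<longlonglongrightarrow> h"
  proof (rule LIMSEQ_I)
    fix e :: real assume e: "e > 0"
    obtain m where m: "m \<ge> 1" "u m / real m < h + e / 2"
      using e cINF_less_iff[OF _ bdd, of "h + e / 2"] unfolding h_def by auto
    \<comment> \<open>A common bound for the finitely many possible remainders r < m.\<close>
    define M where "M = (\<Sum>r<m. u r)"
    have M: "u r \<le> M" if "r < m" for r unfolding M_def using that nn by (intro member_le_sum) auto
    have M0: "0 \<le> M" unfolding M_def using nn by (intro sum_nonneg) auto
    have mult: "u (q * m + r) \<le> real q * u m + u r" for q r
    proof (induction q)
      case (Suc q)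
      have "u (Suc q * m + r) = u (m + (q * m + r))" by (simp add: algebra_simps)
      also have "\<dots> \<le> u m + (real q * u m + u r)" using sub[of m "q * m + r"] Suc by simp
      finally show ?case by (simp add: algebra_simps)
    qed simp
    obtain N where N: "real N > 2 * M / e" using reals_Archimedean2 by blast
    show "\<exists>N. \<forall>n\<ge>N. norm (u n / real n - h) < e"
    proof (intro exI allI impI)
      fix n assume n: "n \<ge> Suc N"
      then have n0: "real n > 0" by simp
      let ?q = "n div m"
      have "u n \<le> real ?q * u m + M"
        using mult[of ?q "n mod m"] M[of "n mod m"] m(1) by simp
      also have "real ?q * u m \<le> real n * (u m / real m)"
      proof -
        have "real ?q * real m \<le> real n" by (metis div_times_less_eq_dividend of_nat_le_iff of_nat_mult)
        then have "real ?q \<le> real n / real m" using m(1) by (simp add: field_simps)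
        then show ?thesis using mult_right_mono[OF _ nn[of m]] by fastforce
      qed
      finally have "u n / real n \<le> u m / real m + M / real n"
        using n0 by (simp add: field_simps)
      moreover have "M / real n < e / 2"
      proof -
        have "2 * M / e < real n" using N n by simp
        then show ?thesis using e n0 by (simp add: field_simps)
      qed
      ultimately have "u n / real n < h + e" using m(2) by linarith
      moreover have "h \<le> u n / real n" using h n by simp
      ultimately show "norm (u n / real n - h) < e" by simp
    qed
  qed
  then show ?thesis using that h0 by blast
qed

subsection \<open>Existence of the entropy\<close>

context triangulated_category
begin

text \<open>The description in \<open>entropy\<close> is uniquely satisfied only because a
  split-generator exists; otherwise its condition would be vacuous. Positivity keeps
  \<open>elog\<close> away from -\<infinity>.\<close>

lemma entropy_eqI:
  assumes "split_generator C G0"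
    and Ob: "\<And>X. X \<in> Ob C \<Longrightarrow> fob \<Phi> X \<in> Ob C"
    and pos: "\<And>G n. split_generator C G \<Longrightarrow> 0 < cone_length C G ((fob \<Phi> ^^ n) G)"
    and lim: "\<And>G. split_generator C G \<Longrightarrow>
      (\<lambda>n. ln (real (cone_length C G ((fob \<Phi> ^^ n) G))) / real n) \<longlonglongrightarrow> h"
  shows "entropy C 0 \<Phi> = ereal h"
proof -
  have iter: "(fob \<Phi> ^^ n) X \<in> Ob C" if "X \<in> Ob C" for n X
    using that Ob by (induction n) auto
  have "(\<lambda>n. elog (complexity C 0 G ((fob \<Phi> ^^ n) G)) / ereal (real n)) \<longlonglongrightarrow> ereal h"
    if G: "split_generator C G" for G
  proof -
    have "elog (complexity C 0 G ((fob \<Phi> ^^ n) G)) / ereal (real n)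
        = ereal (ln (real (cone_length C G ((fob \<Phi> ^^ n) G))) / real n)" if "n > 0" for n
    proof -
      have "complexity C 0 G ((fob \<Phi> ^^ n) G) = ereal (real (cone_length C G ((fob \<Phi> ^^ n) G)))"
        using complexity_eq_cone_length split_generator_level[OF G iter] G unfolding split_generator_def by blast
      then show ?thesis using pos[OF G, of n] that unfolding elog_def by simp
    qed
    then have ev: "eventually (\<lambda>n. elog (complexity C 0 G ((fob \<Phi> ^^ n) G)) / ereal (real n)
        = ereal (ln (real (cone_length C G ((fob \<Phi> ^^ n) G))) / real n)) sequentially"
      using eventually_sequentiallyI[of 1] by (metis (mono_tags, lifting) One_nat_def Suc_le_lessD)
    have "(\<lambda>n. ereal (ln (real (cone_length C G ((fob \<Phi> ^^ n) G))) / real n)) \<longlonglongrightarrow> ereal h"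
      using lim[OF G] by simp
    then show ?thesis using tendsto_cong[OF ev] by blast
  qed
  note * = this
  show ?thesis unfolding entropy_def
  proof (rule the_equality)
    show "\<forall>G. split_generator C G \<longrightarrow>
        (\<lambda>n. elog (complexity C 0 G ((fob \<Phi> ^^ n) G)) / ereal (real n)) \<longlonglongrightarrow> ereal h"
      using * by blast
    fix h' assume "\<forall>G. split_generator C G \<longrightarrow>
        (\<lambda>n. elog (complexity C 0 G ((fob \<Phi> ^^ n) G)) / ereal (real n)) \<longlonglongrightarrow> h'"
    then show "h' = ereal h" using * assms(1) LIMSEQ_unique by blast
  qed
qed

lemma iterate_ob: "\<lbrakk>lin_functor C C \<Phi>; X \<in> Ob C\<rbrakk> \<Longrightarrow> (fob \<Phi> ^^ n) X \<in> Ob C"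
  by (induction n) (auto intro: lin_functor_ob)

lemma iterate_level:
  assumes "exact_functor C C \<Phi>" "E \<in> Ob C" "level C E k X"
  shows "level C ((fob \<Phi> ^^ n) E) k ((fob \<Phi> ^^ n) X)"
proof (induction n)
  case 0
  then show ?case using assms by simp
next
  case (Suc n)
  have "(fob \<Phi> ^^ n) E \<in> Ob C" using iterate_ob[OF exact_functor_lin[OF assms(1)] assms(2)] .
  from exact_functor_level[OF triangulated_category_axioms triangulated_category_axioms assms(1) Suc this]
  show ?case by simp
qed

text \<open>A tower from G to \<Phi>^n G is carried by \<Phi>^m to one from \<Phi>^m G to
  \<Phi>^(m+n) G, so cone lengths are submultiplicative in n and their logarithms subadditive. By
  positivity these logarithms are nonnegative.\<close>

lemma entropy_limit:
  assumes ex: "exact_functor C C \<Phi>" and G0: "split_generator C G0"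
    and pos: "\<And>G n. split_generator C G \<Longrightarrow> 0 < cone_length C G ((fob \<Phi> ^^ n) G)"
  obtains h where "0 \<le> h" "entropy C 0 \<Phi> = ereal h"
    "(\<lambda>n. ln (real (cone_length C G0 ((fob \<Phi> ^^ n) G0))) / real n) \<longlonglongrightarrow> h"
proof -
  define u where "u G n = ln (real (cone_length C G ((fob \<Phi> ^^ n) G)))" for G n
  have lin: "lin_functor C C \<Phi>" using exact_functor_lin[OF ex] .
  have ob: "G \<in> Ob C" if "split_generator C G" for G using that unfolding split_generator_def by simp
  have lev: "level C G (cone_length C G ((fob \<Phi> ^^ n) X)) ((fob \<Phi> ^^ n) X)"
    if "split_generator C G" "X \<in> Ob C" for G X n
    using split_generator_level[OF that(1) iterate_ob[OF lin that(2)]] .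
  have u0: "0 \<le> u G n" if "split_generator C G" for G n
    unfolding u_def using pos[OF that, of n] by simp
  have sub: "u G (m + n) \<le> u G m + u G n" if G: "split_generator C G" for G m n
  proof -
    have "cone_length C G ((fob \<Phi> ^^ (m + n)) G)
        \<le> cone_length C G ((fob \<Phi> ^^ m) G) * cone_length C G ((fob \<Phi> ^^ n) G)"
      using cone_length_trans[OF lev[OF G ob[OF G], of m] iterate_level[OF ex ob[OF G] lev[OF G ob[OF G], of n], of m] ob[OF G]]
      by (simp add: funpow_add)
    then have "real (cone_length C G ((fob \<Phi> ^^ (m + n)) G))
        \<le> real (cone_length C G ((fob \<Phi> ^^ m) G)) * real (cone_length C G ((fob \<Phi> ^^ n) G))"
      by (metis of_nat_le_iff of_nat_mult)
    then have "u G (m + n) \<le> ln (real (cone_length C G ((fob \<Phi> ^^ m) G)) * real (cone_length C G ((fob \<Phi> ^^ n) G)))"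
      unfolding u_def using pos[OF G, of "m + n"] by (intro ln_mono) auto
    also have "\<dots> = u G m + u G n"
      unfolding u_def using pos[OF G, of m] pos[OF G, of n] by (simp add: ln_mult)
    finally show ?thesis .
  qed
  obtain h where h: "0 \<le> h" "(\<lambda>n. u G0 n / real n) \<longlonglongrightarrow> h"
    using fekete[of "u G0", OF sub[OF G0] u0[OF G0]] .
  \<comment> \<open>Passing from G to G' costs the factor \<open>?a\<close>, and passing back from
    \<Phi>^n G' to \<Phi>^n G the factor \<open>?b\<close>, both independent of n.\<close>
  have indep: "\<exists>K. \<forall>n. u G n \<le> K + u G' n" if G: "split_generator C G" "split_generator C G'" for G G'
  proof -
    let ?a = "cone_length C G G'" and ?b = "cone_length C G' G"
    have lab: "level C G ?a G'" "level C G' ?b G" using split_generator_level G ob by blast+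
    have bound: "cone_length C G ((fob \<Phi> ^^ n) G) \<le> ?a * cone_length C G' ((fob \<Phi> ^^ n) G') * ?b" for n
      using cone_length_le[OF level_trans[OF level_trans[OF lab(1) lev[OF G(2) ob[OF G(2)]] ob[OF G(1)]]
        iterate_level[OF ex ob[OF G(2)] lab(2)] ob[OF G(1)]]] .
    \<comment> \<open>The left side of \<open>bound\<close> is positive, so all factors on the right
      are, and the logarithm of the product splits.\<close>
    have "0 < ?a * cone_length C G' ((fob \<Phi> ^^ 0) G') * ?b"
      using bound[of 0] pos[OF G(1), of 0] by linarith
    then have ab: "?a > 0" "?b > 0" by simp_all
    have "u G n \<le> (ln (real ?a) + ln (real ?b)) + u G' n" for n
    proof -
      have "u G n \<le> ln (real ?a * real (cone_length C G' ((fob \<Phi> ^^ n) G')) * real ?b)"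
        unfolding u_def
      proof (intro ln_mono)
        show "real (cone_length C G ((fob \<Phi> ^^ n) G)) \<le> real ?a * real (cone_length C G' ((fob \<Phi> ^^ n) G')) * real ?b"
          using bound[of n] by (metis of_nat_le_iff of_nat_mult)
      qed (use pos[OF G(1), of n] in simp)
      also have "\<dots> = (ln (real ?a) + ln (real ?b)) + u G' n"
        unfolding u_def using ab pos[OF G(2), of n] by (simp add: ln_mult)
      finally show ?thesis .
    qed
    then show ?thesis by blast
  qed
  have lim: "(\<lambda>n. u G n / real n) \<longlonglongrightarrow> h" if G: "split_generator C G" for G
  proof -
    obtain K where K: "\<And>n. u G n \<le> K + u G0 n" using indep[OF G G0] by blast
    obtain K' where K': "\<And>n. u G0 n \<le> K' + u G n" using indep[OF G0 G] by blast
    have "(\<lambda>n. u G0 n / real n - K' / real n) \<longlonglongrightarrow> h - 0"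
      by (intro tendsto_diff h(2) lim_const_over_n)
    moreover have "(\<lambda>n. u G0 n / real n + K / real n) \<longlonglongrightarrow> h + 0"
      by (intro tendsto_add h(2) lim_const_over_n)
    moreover have "u G0 n / real n - K' / real n \<le> u G n / real n" for n
      using K'[of n] by (simp add: diff_divide_distrib[symmetric] divide_right_mono)
    moreover have "u G n / real n \<le> u G0 n / real n + K / real n" for n
      using K[of n] by (simp add: add_divide_distrib[symmetric] divide_right_mono add.commute)
    ultimately show ?thesis
      using tendsto_sandwich[of "\<lambda>n. u G0 n / real n - K' / real n" "\<lambda>n. u G n / real n" sequentially
        "\<lambda>n. u G0 n / real n + K / real n" h] by simp
  qed
  have "entropy C 0 \<Phi> = ereal h"
    using entropy_eqI[OF G0 lin_functor_ob[OF lin] pos] lim unfolding u_def by blast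
  then show ?thesis using that[OF h(1)] h(2) unfolding u_def by blast
qed

end

section \<open>Morphism spaces and the Euler form\<close>

abbreviation hom_dim :: "('k::field, 'o, 'm::ab_group_add, 'z) lincat_scheme \<Rightarrow> 'o \<Rightarrow> 'o \<Rightarrow> nat" where
  "hom_dim C X Y \<equiv> vector_space.dim (smul C) (Hom C X Y)"

lemma fin_dim_by_exact:
  assumes vs: "vector_space s1" "vector_space s2" and V: "module.subspace s1 V" and f: "linear_on_subspace s1 s2 V f"
    and im: "fin_dim s2 (f ` V)" and ker: "fin_dim s1 {x\<in>V. f x = 0}"
  shows "fin_dim s1 V"
proof -
  interpret vector_space_pair s1 s2 using vs by (simp add: vector_space_pair_def)
  obtain g where g: "Vector_Spaces.linear s1 s2 g" "\<And>x. x \<in> V \<Longrightarrow> g x = f x"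
    using linear_on_subspace_extend[OF vs V f] by metis
  obtain B where B: "B \<subseteq> f ` V" "vs2.independent B" "f ` V \<subseteq> vs2.span B"
    using vs2.basis_exists[of "f ` V"] by metis
  obtain F where F: "finite F" "f ` V \<subseteq> vs2.span F" using im unfolding fin_dim_def by auto
  have finB: "finite B" using vs2.independent_span_bound[OF F(1) B(2)] B(1) F(2) by auto
  obtain A where A: "A \<subseteq> V" "finite A" "B = f ` A" using finite_subset_image[OF finB B(1)] by metis
  obtain K where K: "finite K" "{x\<in>V. f x = 0} \<subseteq> vs1.span K" using ker unfolding fin_dim_def by auto
  have "V \<subseteq> vs1.span (A \<union> K)"
  proof
    fix x assume x: "x \<in> V"
    have "g ` A = f ` A" using g(2) A(1) by (intro image_cong) auto
    then have "f x \<in> g ` vs1.span A" using x B(3) A(3) linear_span_image[OF g(1), of A] by auto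
    then obtain y where y: "y \<in> vs1.span A" "f x = g y" by auto
    have yV: "y \<in> V" using y(1) vs1.span_minimal[OF A(1) V] by auto
    have "f (x - y) = 0"
      using linear_on_subspace_simps(3)[OF f vs V x yV] y(2) g(2)[OF yV] by simp
    then have "x - y \<in> vs1.span K" using K(2) vs1.subspace_diff[OF V x yV] by auto
    moreover have "x = y + (x - y)" by simp
    ultimately show "x \<in> vs1.span (A \<union> K)"
      using y(1) vs1.span_add vs1.span_mono[of A "A \<union> K"] vs1.span_mono[of K "A \<union> K"]
      by (metis Un_upper1 Un_upper2 subsetD)
  qed
  then show ?thesis unfolding fin_dim_def using A(2) K(1) by (meson finite_UnI)
qed

lemma fin_dim_zero: "vector_space s \<Longrightarrow> fin_dim s {0}"
  unfolding fin_dim_def using module.span_zero[of s] by (intro exI[of _ "{}"]) (simp add: module_iff_vector_space)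

context linear_category
begin

lemma precomp_linear:
  "\<lbrakk>arr C X Y f; W \<in> Ob C\<rbrakk> \<Longrightarrow> linear_on_subspace (smul C) (smul C) (Hom C Y W) (\<lambda>a. a \<odot> f)"
  unfolding arr_def using cmp_lin_left[of X Y W f] by simp

lemma postcomp_linear:
  "\<lbrakk>arr C X Y f; W \<in> Ob C\<rbrakk> \<Longrightarrow> linear_on_subspace (smul C) (smul C) (Hom C W X) (\<lambda>a. f \<odot> a)"
  unfolding arr_def using cmp_lin_right[of W X Y f] by simp

lemma retract_hom_left:
  assumes "retract C X Y" "W \<in> Ob C" "fin_dim (smul C) (Hom C Y W)"
  shows "fin_dim (smul C) (Hom C X W)" "hom_dim C X W \<le> hom_dim C Y W"
proof -
  obtain i p where ip: "arr C X Y i" "arr C Y X p" "p \<odot> i = idn C X" using assms(1) unfolding retract_def by auto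
  have XY: "X \<in> Ob C" "Y \<in> Ob C" using ip unfolding arr_def by auto
  have inv1: "(a \<odot> p) \<odot> i = a" if "a \<in> Hom C X W" for a
    using assoc[OF ip(1,2), of W a] idr[of X W a] ip(3) that XY assms(2) unfolding arr_def by simp
  have im: "(\<lambda>a. a \<odot> p) ` Hom C X W \<subseteq> Hom C Y W"
    using arr_cmp[OF ip(2)] XY assms(2) unfolding arr_def by auto
  have "Hom C X W \<subseteq> (\<lambda>a. a \<odot> i) ` Hom C Y W"
  proof
    fix a assume a: "a \<in> Hom C X W"
    then show "a \<in> (\<lambda>a. a \<odot> i) ` Hom C Y W" using inv1[OF a] im by force
  qed
  then show fd: "fin_dim (smul C) (Hom C X W)"
    using fin_dim_subset fin_dim_image[OF vs vs hom_subspace[OF XY(2) assms(2)] precomp_linear[OF ip(1) assms(2)] assms(3)]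
    by blast
  have "inj_on (\<lambda>a. a \<odot> p) (Hom C X W)" using inv1 by (rule inj_on_inverseI)
  from dim_bij_on[OF vs vs hom_subspace[OF XY(1) assms(2)] precomp_linear[OF ip(2) assms(2)] fd this]
  show "hom_dim C X W \<le> hom_dim C Y W" using dim_le_of_subset[OF vs assms(3) im] by simp
qed

lemma retract_hom_right:
  assumes "retract C X Y" "W \<in> Ob C" "fin_dim (smul C) (Hom C W Y)"
  shows "fin_dim (smul C) (Hom C W X)" "hom_dim C W X \<le> hom_dim C W Y"
proof -
  obtain i p where ip: "arr C X Y i" "arr C Y X p" "p \<odot> i = idn C X" using assms(1) unfolding retract_def by auto
  have XY: "X \<in> Ob C" "Y \<in> Ob C" using ip unfolding arr_def by auto
  have inv1: "p \<odot> (i \<odot> a) = a" if "a \<in> Hom C W X" for a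
    using assoc[OF _ ip(1,2), of W a] idl[of W X a] ip(3) that XY assms(2) unfolding arr_def by simp
  have im: "(\<lambda>a. i \<odot> a) ` Hom C W X \<subseteq> Hom C W Y"
    using arr_cmp[OF _ ip(1)] XY assms(2) unfolding arr_def by auto
  have "Hom C W X \<subseteq> (\<lambda>a. p \<odot> a) ` Hom C W Y"
  proof
    fix a assume a: "a \<in> Hom C W X"
    then show "a \<in> (\<lambda>a. p \<odot> a) ` Hom C W Y" using inv1[OF a] im by force
  qed
  then show fd: "fin_dim (smul C) (Hom C W X)"
    using fin_dim_subset fin_dim_image[OF vs vs hom_subspace[OF assms(2) XY(2)] postcomp_linear[OF ip(2) assms(2)] assms(3)]
    by blast
  have "inj_on (\<lambda>a. i \<odot> a) (Hom C W X)" using inv1 by (rule inj_on_inverseI)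
  from dim_bij_on[OF vs vs hom_subspace[OF assms(2) XY(1)] postcomp_linear[OF ip(1) assms(2)] fd this]
  show "hom_dim C W X \<le> hom_dim C W Y" using dim_le_of_subset[OF vs assms(3) im] by simp
qed

end

text \<open>The condition of \<open>finite_type\<close> for a single pair, so that it can be
  propagated from a generator to all objects.\<close>

definition hom_finite :: "('k::field, 'o, 'm::ab_group_add) tricat \<Rightarrow> 'o \<Rightarrow> 'o \<Rightarrow> bool" where
  "hom_finite C E F \<longleftrightarrow> finite {i. Hom C E (sh_ob C i F) \<noteq> {0}} \<and>
     (\<forall>i. fin_dim (smul C) (Hom C E (sh_ob C i F)))"

lemma finite_type_iff: "finite_type C \<longleftrightarrow> (\<forall>E\<in>Ob C. \<forall>F\<in>Ob C. hom_finite C E F)"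
  unfolding finite_type_def hom_finite_def by blast

abbreviation ext_dim :: "('k::field, 'o, 'm::ab_group_add) tricat \<Rightarrow> 'o \<Rightarrow> 'o \<Rightarrow> int \<Rightarrow> nat" where
  "ext_dim C E F i \<equiv> hom_dim C E (sh_ob C i F)"

text \<open>\<open>Sum_any\<close> sums over all degrees with finite support implied, so degree
  shifts become reindexing by a bijection of the integers.\<close>

definition total_dim :: "('k::field, 'o, 'm::ab_group_add) tricat \<Rightarrow> 'o \<Rightarrow> 'o \<Rightarrow> nat" where
  "total_dim C E F = Sum_any (ext_dim C E F)"

lemma ksign_simps [simp]: "ksign i (0::'a::ab_group_add) = 0"
  "ksign i (x + y) = ksign i x + ksign i y" "ksign i x = 0 \<longleftrightarrow> x = 0"
  "ksign (i - 1) x = - ksign i x" "ksign (i + 1) x = - ksign i x"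
  unfolding ksign_def by auto

section \<open>Long exact sequences of morphism spaces and dimension counts\<close>

context triangulated_category
begin

text \<open>The kernel of composition with f is the image of composition with g, so rank and nullity
  are both ranks of maps in the sequence. Applied to a triangle and two of its rotations, this is
  the long exact sequence.\<close>

lemma tri_hom_dims:
  assumes t: "tri C X Y Z f g h" and W: "W \<in> Ob C"
    and fd: "fin_dim (smul C) (Hom C X W)" "fin_dim (smul C) (Hom C Z W)"
  shows "fin_dim (smul C) (Hom C Y W)"
    and "hom_dim C Y W = vector_space.dim (smul C) ((\<lambda>a. a \<odot> f) ` Hom C Y W)
           + vector_space.dim (smul C) ((\<lambda>a. a \<odot> g) ` Hom C Z W)"
proof -
  note ar = tri_arr[OF t]
  have ob: "X \<in> Ob C" "Y \<in> Ob C" "Z \<in> Ob C" using ar unfolding arr_def by auto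
  have ker: "{a \<in> Hom C Y W. a \<odot> f = 0} = (\<lambda>a. a \<odot> g) ` Hom C Z W"
  proof (intro equalityI subsetI)
    fix a assume "a \<in> {a \<in> Hom C Y W. a \<odot> f = 0}"
    then have a: "arr C Y W a" "a \<odot> f = 0" using ob W unfolding arr_def by auto
    obtain b where "arr C Z W b" "b \<odot> g = a" using tri_factor_left[OF t a] .
    then show "a \<in> (\<lambda>a. a \<odot> g) ` Hom C Z W" unfolding arr_def by blast
  next
    fix a assume "a \<in> (\<lambda>a. a \<odot> g) ` Hom C Z W"
    then obtain b where b: "arr C Z W b" "a = b \<odot> g" using ob W unfolding arr_def by blast
    then show "a \<in> {a \<in> Hom C Y W. a \<odot> f = 0}"
      using arr_cmp[OF ar(2) b(1)] assoc[OF ar(1,2) b(1)] tri_comp_zero(1)[OF t] zero_r[OF ob(1) b(1)]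
      unfolding arr_def by simp
  qed
  note V = hom_subspace[OF ob(2) W] and lin = precomp_linear[OF ar(1) W]
  have "(\<lambda>a. a \<odot> f) ` Hom C Y W \<subseteq> Hom C X W"
    using arr_cmp[OF ar(1)] ob W unfolding arr_def by auto
  then have "fin_dim (smul C) ((\<lambda>a. a \<odot> f) ` Hom C Y W)" using fin_dim_subset fd(1) by blast
  moreover have "fin_dim (smul C) ((\<lambda>a. a \<odot> g) ` Hom C Z W)"
    using fin_dim_image[OF vs vs hom_subspace[OF ob(3) W] precomp_linear[OF ar(2) W] fd(2)] .
  ultimately show fdY: "fin_dim (smul C) (Hom C Y W)"
    using fin_dim_by_exact[OF vs vs V lin] ker by simp
  show "hom_dim C Y W = vector_space.dim (smul C) ((\<lambda>a. a \<odot> f) ` Hom C Y W)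
           + vector_space.dim (smul C) ((\<lambda>a. a \<odot> g) ` Hom C Z W)"
    using rank_nullity[OF vs vs V lin fdY] ker by simp
qed

lemma tri_hom_right:
  assumes e: "extension C X Y Z" and W: "W \<in> Ob C"
  shows "\<lbrakk>fin_dim (smul C) (Hom C W X); fin_dim (smul C) (Hom C W Z)\<rbrakk> \<Longrightarrow> fin_dim (smul C) (Hom C W Y)"
    and "\<lbrakk>Hom C W X = {0}; Hom C W Z = {0}\<rbrakk> \<Longrightarrow> Hom C W Y = {0}"
proof -
  obtain f g h where t: "tri C X Y Z f g h" using e unfolding extension_def by auto
  note ar = tri_arr[OF t]
  have ob: "X \<in> Ob C" "Y \<in> Ob C" "Z \<in> Ob C" using ar unfolding arr_def by auto
  have ker: "{a \<in> Hom C W Y. g \<odot> a = 0} \<subseteq> (\<lambda>a. f \<odot> a) ` Hom C W X"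
  proof
    fix a assume "a \<in> {a \<in> Hom C W Y. g \<odot> a = 0}"
    then have a: "arr C W Y a" "g \<odot> a = 0" using ob W unfolding arr_def by auto
    obtain b where "arr C W X b" "f \<odot> b = a" using tri_factor_right[OF t a] .
    then show "a \<in> (\<lambda>a. f \<odot> a) ` Hom C W X" unfolding arr_def by blast
  qed
  have im: "(\<lambda>a. g \<odot> a) ` Hom C W Y \<subseteq> Hom C W Z"
    using arr_cmp[OF _ ar(2)] ob W unfolding arr_def by auto
  note V = hom_subspace[OF W ob(2)] and lin = postcomp_linear[OF ar(2) W]
  show "fin_dim (smul C) (Hom C W Y)" if "fin_dim (smul C) (Hom C W X)" "fin_dim (smul C) (Hom C W Z)"
    using fin_dim_by_exact[OF vs vs V lin fin_dim_subset[OF that(2) im]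
        fin_dim_subset[OF fin_dim_image[OF vs vs hom_subspace[OF W ob(1)] postcomp_linear[OF ar(1) W] that(1)] ker]] .
  show "Hom C W Y = {0}" if "Hom C W X = {0}" "Hom C W Z = {0}"
  proof -
    have "Hom C W Y \<subseteq> (\<lambda>a. f \<odot> a) ` {0}" using ker im that by auto
    then show ?thesis using zero_r[OF W ar(1)] arr_zero[OF W ob(2)] unfolding arr_def by auto
  qed
qed

lemma hom_shift_bij:
  assumes "X \<in> Ob C" "Y \<in> Ob C"
  shows "bij_betw (sh_map C n X Y) (Hom C X Y) (Hom C (sh_ob C n X) (sh_ob C n Y))"
proof (rule bij_betw_imageI)
  show "inj_on (sh_map C n X Y) (Hom C X Y)"
    using shift_inj[of X Y _ _ n] assms unfolding arr_def by (intro inj_onI) simp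
  show "sh_map C n X Y ` Hom C X Y = Hom C (sh_ob C n X) (sh_ob C n Y)"
  proof (intro equalityI subsetI)
    fix a assume "a \<in> sh_map C n X Y ` Hom C X Y"
    then show "a \<in> Hom C (sh_ob C n X) (sh_ob C n Y)"
      using shift_arr[of X Y _ n] assms unfolding arr_def by auto
  next
    fix a assume "a \<in> Hom C (sh_ob C n X) (sh_ob C n Y)"
    then obtain b where "arr C X Y b" "sh_map C n X Y b = a"
      using shift_map_surj[OF assms, of n a] shift_ob assms unfolding arr_def by auto
    then show "a \<in> sh_map C n X Y ` Hom C X Y" unfolding arr_def by blast
  qed
qed

lemma hom_shift:
  assumes "X \<in> Ob C" "Y \<in> Ob C"
  shows "fin_dim (smul C) (Hom C (sh_ob C n X) (sh_ob C n Y)) \<longleftrightarrow> fin_dim (smul C) (Hom C X Y)"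
    and "fin_dim (smul C) (Hom C X Y) \<Longrightarrow> hom_dim C (sh_ob C n X) (sh_ob C n Y) = hom_dim C X Y"
proof -
  have *: "fin_dim (smul C) (Hom C (sh_ob C n X) (sh_ob C n Y))"
    if "X \<in> Ob C" "Y \<in> Ob C" "fin_dim (smul C) (Hom C X Y)" for X Y n
    using fin_dim_image[OF vs vs hom_subspace[OF that(1,2)] lin_functor_lin[OF shift_functor that(1,2)] that(3)]
      hom_shift_bij[OF that(1,2), of n] unfolding bij_betw_def by metis
  show "fin_dim (smul C) (Hom C (sh_ob C n X) (sh_ob C n Y)) \<longleftrightarrow> fin_dim (smul C) (Hom C X Y)"
    using *[OF assms] *[of "sh_ob C n X" "sh_ob C n Y" "- n"] assms shift_ob
    by (auto simp: shift_shift shift_zero)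
  show "hom_dim C (sh_ob C n X) (sh_ob C n Y) = hom_dim C X Y" if "fin_dim (smul C) (Hom C X Y)"
    using dim_bij_on[OF vs vs hom_subspace[OF assms] lin_functor_lin[OF shift_functor assms] that]
      hom_shift_bij[OF assms, of n] unfolding bij_betw_def by metis
qed

lemma hom_shift_left:
  assumes "X \<in> Ob C" "Y \<in> Ob C"
  shows "fin_dim (smul C) (Hom C (sh_ob C n X) (sh_ob C i Y)) \<longleftrightarrow> fin_dim (smul C) (Hom C X (sh_ob C (i - n) Y))"
    and "fin_dim (smul C) (Hom C X (sh_ob C (i - n) Y)) \<Longrightarrow>
      hom_dim C (sh_ob C n X) (sh_ob C i Y) = hom_dim C X (sh_ob C (i - n) Y)"
  using hom_shift[OF assms(1) shift_ob[OF assms(2), of "i - n"], of n] assms by (simp_all add: shift_shift)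

lemma ext_support:
  assumes "E \<in> Ob C" "F \<in> Ob C" "hom_finite C E F"
  shows "{i. Hom C E (sh_ob C i F) \<noteq> {0}} = {i. ext_dim C E F i \<noteq> 0}" "finite {i. ext_dim C E F i \<noteq> 0}"
proof -
  show *: "{i. Hom C E (sh_ob C i F) \<noteq> {0}} = {i. ext_dim C E F i \<noteq> 0}"
    using dim_zero_iff[OF vs hom_subspace[OF assms(1) shift_ob[OF assms(2)]]] assms(3) unfolding hom_finite_def by simp
  show "finite {i. ext_dim C E F i \<noteq> 0}" using assms(3) unfolding hom_finite_def *[symmetric] by simp
qed

lemma hom_finiteI:
  assumes "E \<in> Ob C" "F \<in> Ob C" "\<And>i. fin_dim (smul C) (Hom C E (sh_ob C i F))" "finite {i. ext_dim C E F i \<noteq> 0}"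
  shows "hom_finite C E F"
  using assms(3,4) dim_zero_iff[OF vs hom_subspace[OF assms(1) shift_ob[OF assms(2)]]] unfolding hom_finite_def by simp

lemma euler_form_eq:
  assumes "E \<in> Ob C" "F \<in> Ob C" "hom_finite C E F"
  shows "euler_form C E F = Sum_any (\<lambda>i. ksign i (int (ext_dim C E F i)))"
  unfolding euler_form_def ext_support(1)[OF assms] Sum_any.expand_set by simp

lemma hom_finite_shift_left:
  assumes "X \<in> Ob C" "F \<in> Ob C" "hom_finite C X F"
  shows "hom_finite C (sh_ob C n X) F" "total_dim C (sh_ob C n X) F = total_dim C X F"
proof -
  have d: "ext_dim C (sh_ob C n X) F i = ext_dim C X F (i - n)" for i
    using hom_shift_left(2)[OF assms(1,2)] assms(3) unfolding hom_finite_def by blast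
  have "{i. ext_dim C X F (i - n) \<noteq> 0} = (\<lambda>i. i + n) ` {i. ext_dim C X F i \<noteq> 0}"
    by (auto simp: image_iff intro!: exI[of _ "_ - n"])
  then have "finite {i. ext_dim C X F (i - n) \<noteq> 0}" using ext_support(2)[OF assms] by simp
  then show "hom_finite C (sh_ob C n X) F"
    using hom_finiteI[OF shift_ob[OF assms(1)] assms(2)] hom_shift_left(1)[OF assms(1,2)] assms(3) d
    unfolding hom_finite_def by simp
  show "total_dim C (sh_ob C n X) F = total_dim C X F"
    unfolding total_dim_def d
    by (rule Sum_any.reindex_cong[of "\<lambda>i. i + n"])
      (auto simp: bij_def inj_def surj_def comp_def intro!: exI[of _ "_ - n"])
qed

lemma hom_finite_retract_left:
  assumes "retract C X Y" "F \<in> Ob C" "hom_finite C Y F"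
  shows "hom_finite C X F" "total_dim C X F \<le> total_dim C Y F"
proof -
  have ob: "X \<in> Ob C" "Y \<in> Ob C" using assms(1) unfolding retract_def arr_def by auto
  have le: "ext_dim C X F i \<le> ext_dim C Y F i" for i
    using retract_hom_left(2)[OF assms(1) shift_ob[OF assms(2)]] assms(3) unfolding hom_finite_def by blast
  have sup: "{i. ext_dim C X F i \<noteq> 0} \<subseteq> {i. ext_dim C Y F i \<noteq> 0}"
  proof
    fix i assume "i \<in> {i. ext_dim C X F i \<noteq> 0}"
    then show "i \<in> {i. ext_dim C Y F i \<noteq> 0}" using le[of i] by simp
  qed
  show "hom_finite C X F"
    using hom_finiteI[OF ob(1) assms(2)] retract_hom_left(1)[OF assms(1) shift_ob[OF assms(2)]] assms(3)
      finite_subset[OF sup ext_support(2)[OF ob(2) assms(2,3)]] unfolding hom_finite_def by blast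
  show "total_dim C X F \<le> total_dim C Y F"
    unfolding total_dim_def Sum_any.expand_superset[OF ext_support(2)[OF ob(2) assms(2,3)] sup] Sum_any.expand_set
    using le by (intro sum_mono)
qed

text \<open>Let a i, b i, c i be the ranks of composition with f, g, h on morphisms to F[i]. The
  dimensions are then a i + b i for Y, b i + c i for Z and c (i + 1) + a i for X; the ranks c cancel
  in the alternating sum and only increase the right side of the bound.\<close>

lemma hom_finite_extension_left:
  assumes e: "extension C X Y Z" and F: "F \<in> Ob C" and fin: "hom_finite C X F" "hom_finite C Z F"
  shows "hom_finite C Y F" "total_dim C Y F \<le> total_dim C X F + total_dim C Z F"
    "euler_form C Y F = euler_form C X F + euler_form C Z F"
proof -
  obtain f g h where t: "tri C X Y Z f g h" using e unfolding extension_def by auto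
  note ar = tri_arr[OF t]
  have ob: "X \<in> Ob C" "Y \<in> Ob C" "Z \<in> Ob C" using ar unfolding arr_def by auto
  note t1 = tri_rot[OF t]
  let ?d = "vector_space.dim (smul C)" and ?F = "\<lambda>i. sh_ob C i F" and ?X = "sh_ob C 1 X" and ?Y = "sh_ob C 1 Y"
  let ?f = "- sh_map C 1 X Y f"
  define a where "a i = ?d ((\<lambda>a. a \<odot> f) ` Hom C Y (?F i))" for i
  define b where "b i = ?d ((\<lambda>a. a \<odot> g) ` Hom C Z (?F i))" for i
  define c where "c i = ?d ((\<lambda>a. a \<odot> h) ` Hom C ?X (?F i))" for i
  have Fi: "?F i \<in> Ob C" for i using shift_ob[OF F] .
  have fdX: "fin_dim (smul C) (Hom C X (?F i))" and fdZ: "fin_dim (smul C) (Hom C Z (?F i))" for i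
    using fin unfolding hom_finite_def by auto
  have fdY: "fin_dim (smul C) (Hom C Y (?F i))" for i using tri_hom_dims(1)[OF t Fi fdX fdZ] .
  have fdX1: "fin_dim (smul C) (Hom C ?X (?F i))" and fdY1: "fin_dim (smul C) (Hom C ?Y (?F i))" for i
    using hom_shift_left(1)[OF ob(1) F] hom_shift_left(1)[OF ob(2) F] fdX fdY by simp_all
  have y: "ext_dim C Y F i = a i + b i" for i
    unfolding a_def b_def using tri_hom_dims(2)[OF t Fi fdX fdZ] .
  have z: "ext_dim C Z F i = b i + c i" for i
    unfolding b_def c_def using tri_hom_dims(2)[OF t1 Fi fdY fdX1] .
  \<comment> \<open>In the twice rotated triangle the map is \<open>?f\<close>, the negative of the
    shift of f. Its rank in degree i is that of f in degree i - 1, as the shift is bijective on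
    morphisms and the sign does not change the image.\<close>
  have af: "a (i - 1) = ?d ((\<lambda>a. a \<odot> ?f) ` Hom C ?Y (?F i))" for i
  proof -
    let ?s = "sh_map C 1 X (?F (i - 1))"
    have Fi1: "sh_ob C 1 (?F (i - 1)) = ?F i" using F by (simp add: shift_shift)
    let ?I = "(\<lambda>a. a \<odot> f) ` Hom C Y (?F (i - 1))"
    have sub: "?I \<subseteq> Hom C X (?F (i - 1))" using arr_cmp[OF ar(1)] ob Fi unfolding arr_def by auto
    have "(\<lambda>a. a \<odot> ?f) ` Hom C ?Y (?F i) = ?s ` ?I"
    proof (intro equalityI subsetI)
      fix u assume "u \<in> (\<lambda>a. a \<odot> ?f) ` Hom C ?Y (?F i)"
      then obtain v where v: "arr C ?Y (?F i) v" "u = v \<odot> ?f" using shift_ob ob Fi unfolding arr_def by auto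
      obtain w where w: "arr C Y (?F (i - 1)) w" "sh_map C 1 Y (?F (i - 1)) w = - v"
        using shift_map_surj[OF ob(2) Fi[of "i - 1"], of 1 "- v"] arr_uminus[OF v(1)] Fi1 by auto
      have "u = - (v \<odot> sh_map C 1 X Y f)" using v(2) uminus_r[OF shift_arr[OF ar(1)] v(1)] by simp
      also have "\<dots> = (- v) \<odot> sh_map C 1 X Y f" using uminus_l[OF shift_arr[OF ar(1)] v(1)] by simp
      also have "\<dots> = ?s (w \<odot> f)" using shift_cmp[OF ar(1) w(1), of 1] w(2) by simp
      finally show "u \<in> ?s ` ?I" using w(1) unfolding arr_def by blast
    next
      fix u assume "u \<in> ?s ` ?I"
      then obtain w where w: "arr C Y (?F (i - 1)) w" "u = ?s (w \<odot> f)" using ob Fi unfolding arr_def by auto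
      note sw = shift_arr[OF w(1), of 1, unfolded Fi1]
      have "u = sh_map C 1 Y (?F (i - 1)) w \<odot> sh_map C 1 X Y f" using w(2) shift_cmp[OF ar(1) w(1), of 1] by simp
      also have "\<dots> = (- sh_map C 1 Y (?F (i - 1)) w) \<odot> ?f"
        using uminus_l[OF arr_uminus[OF shift_arr[OF ar(1)]] sw] uminus_r[OF shift_arr[OF ar(1)] sw] by simp
      finally show "u \<in> (\<lambda>a. a \<odot> ?f) ` Hom C ?Y (?F i)" using arr_uminus[OF sw] unfolding arr_def by blast
    qed
    moreover have "?d (?s ` ?I) = ?d ?I"
    proof (rule dim_bij_on[OF vs vs])
      show "module.subspace (smul C) ?I" using subspace_image_on[OF vs vs hom_subspace[OF ob(2) Fi] precomp_linear[OF ar(1) Fi]] .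
      show "fin_dim (smul C) ?I" using fin_dim_subset[OF fdX sub] .
      show "linear_on_subspace (smul C) (smul C) ?I ?s"
        using lin_functor_lin[OF shift_functor ob(1) Fi] sub unfolding linear_on_subspace_def by blast
      show "inj_on ?s ?I" using hom_shift_bij[OF ob(1) Fi] sub unfolding bij_betw_def by (meson inj_on_subset)
    qed
    ultimately show ?thesis unfolding a_def by simp
  qed
  have x: "ext_dim C X F i = c (i + 1) + a i" for i
  proof -
    have "ext_dim C X F i = hom_dim C ?X (?F (i + 1))"
      using hom_shift_left(2)[OF ob(1) F, of "i + 1" 1] fdX by simp
    also have "\<dots> = c (i + 1) + a i"
      using tri_hom_dims(2)[OF tri_rot[OF t1] Fi[of "i + 1"] fdZ[of "i + 1"] fdY1[of "i + 1"]] af[of "i + 1"] unfolding c_def by simp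
    finally show ?thesis .
  qed
  have fx: "finite {i. ext_dim C X F i \<noteq> 0}" and fz: "finite {i. ext_dim C Z F i \<noteq> 0}"
    using ext_support(2)[OF ob(1) F fin(1)] ext_support(2)[OF ob(3) F fin(2)] .
  have fa: "finite {i. a i \<noteq> 0}" using x by (intro finite_subset[OF _ fx]) auto
  have fb: "finite {i. b i \<noteq> 0}" and fc: "finite {i. c i \<noteq> 0}" using z by (intro finite_subset[OF _ fz], auto)+
  have fc1: "finite {i. c (i + 1) \<noteq> 0}" using x by (intro finite_subset[OF _ fx]) auto
  have fy: "finite {i. ext_dim C Y F i \<noteq> 0}" unfolding y
    by (rule finite_subset[OF _ finite_UnI[OF fa fb]]) auto
  show hf: "hom_finite C Y F" using hom_finiteI[OF ob(2) F fdY fy] .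
  show "total_dim C Y F \<le> total_dim C X F + total_dim C Z F"
    unfolding total_dim_def x y z Sum_any.distrib[OF fa fb] Sum_any.distrib[OF fc1 fa] Sum_any.distrib[OF fb fc] by simp
  let ?S = "\<lambda>u. Sum_any (\<lambda>i. ksign i (int (u i)))"
  have S: "?S (\<lambda>i. u i + v i) = ?S u + ?S v" if "finite {i. u i \<noteq> 0}" "finite {i. v i \<noteq> 0}" for u v :: "int \<Rightarrow> nat"
    using Sum_any.distrib[of "\<lambda>i. ksign i (int (u i))" "\<lambda>i. ksign i (int (v i))"] that by simp
  \<comment> \<open>Moving the index by one reverses the sign, so the ranks c enter X and Z with
    opposite signs.\<close>
  have "?S c = Sum_any (\<lambda>i. ksign (i + 1) (int (c (i + 1))))"
    by (rule Sum_any.reindex_cong[of "\<lambda>i. i + 1"]) (auto simp: bij_def inj_def surj_def comp_def intro!: exI[of _ "_ - 1"])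
  also have "\<dots> = Sum_any (\<lambda>i. - ksign i (int (c (i + 1))))" by simp
  also have "\<dots> = - ?S (\<lambda>i. c (i + 1))"
    unfolding Sum_any.expand_set by (simp add: sum_negf)
  finally have tele: "?S (\<lambda>i. c (i + 1)) = - ?S c" by simp
  show "euler_form C Y F = euler_form C X F + euler_form C Z F"
    unfolding euler_form_eq[OF ob(1) F fin(1)] euler_form_eq[OF ob(2) F hf] euler_form_eq[OF ob(3) F fin(2)]
      x y z S[OF fa fb] S[OF fc1 fa] S[OF fb fc] tele by simp
qed

lemma hom_finite_zero_left:
  assumes "zero_ob C X" "F \<in> Ob C"
  shows "hom_finite C X F" "total_dim C X F = 0"
proof -
  have X: "X \<in> Ob C" using assms unfolding zero_ob_def by auto
  have "Hom C X (sh_ob C i F) = {0}" for i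
    using zero_ob_from[OF assms(1), of "sh_ob C i F"] arr_zero[OF X, of "sh_ob C i F"] shift_ob[OF assms(2)] X
    unfolding arr_def by auto
  moreover have "vector_space.dim (smul C) {0} = 0"
    using dim_zero_iff[OF vs module.subspace_single_0[OF module_smul] fin_dim_zero[OF vs]] by simp
  ultimately show "hom_finite C X F" "total_dim C X F = 0"
    unfolding hom_finite_def total_dim_def using fin_dim_zero[OF vs] by simp_all
qed

text \<open>Each cone adds at most the total dimension for one shift of G. This inequality links the
  Euler form to the complexity.\<close>

lemma level_hom_finite_left:
  assumes "level C G k E" "G \<in> Ob C" "F \<in> Ob C" "hom_finite C G F"
  shows "hom_finite C E F" "total_dim C E F \<le> k * total_dim C G F"
proof -
  have *: "hom_finite C B F \<and> total_dim C B F \<le> k * total_dim C G F" if "built C G k B" for B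
    using that
  proof (induction rule: built.induct)
    case (built_zero X)
    then show ?case using hom_finite_zero_left[OF _ assms(3)] by simp
  next
    case (built_step k X Y n)
    note s = hom_finite_shift_left[OF assms(2-4), of n]
    show ?case using hom_finite_extension_left(1,2)[OF built_step(2) assms(3) _ s(1)] built_step(3) s(2) by auto
  qed
  obtain B where B: "built C G k B" "retract C E B" using assms(1) unfolding level_def by auto
  show "hom_finite C E F" "total_dim C E F \<le> k * total_dim C G F"
    using hom_finite_retract_left[OF B(2) assms(3)] *[OF B(1)] by auto
qed

lemma level_hom_finite_right:
  assumes "level C G k F" "G \<in> Ob C" "E \<in> Ob C" "hom_finite C E G"
  shows "hom_finite C E F"
proof -
  have *: "hom_finite C E B" if "built C G k B" for B
    using that
  proof (induction rule: built.induct)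
    case (built_zero X)
    have "Hom C E (sh_ob C i X) = {0}" for i
    proof -
      have Z: "zero_ob C (sh_ob C i X)" using shift_zero_ob built_zero .
      then have "sh_ob C i X \<in> Ob C" unfolding zero_ob_def by simp
      then show ?thesis
        using zero_ob_to[OF Z, of E] arr_zero[OF assms(3), of "sh_ob C i X"] assms(3)
        unfolding arr_def by auto
    qed
    then show ?case unfolding hom_finite_def using fin_dim_zero[OF vs] by simp
  next
    case (built_step k X Y n)
    have sG: "sh_ob C i (sh_ob C n G) = sh_ob C (i + n) G" for i using assms(2) by (simp add: shift_shift)
    note e = extension_shift[OF built_step(2)]
    have "{i. Hom C E (sh_ob C i Y) \<noteq> {0}}
        \<subseteq> {i. Hom C E (sh_ob C i X) \<noteq> {0}} \<union> (\<lambda>i. i - n) ` {i. Hom C E (sh_ob C i G) \<noteq> {0}}"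
    proof
      fix i assume i: "i \<in> {i. Hom C E (sh_ob C i Y) \<noteq> {0}}"
      then have "Hom C E (sh_ob C i X) \<noteq> {0} \<or> Hom C E (sh_ob C (i + n) G) \<noteq> {0}"
        using tri_hom_right(2)[OF e[of i] assms(3)] sG by auto
      moreover have "i = (i + n) - n" by simp
      ultimately show "i \<in> {i. Hom C E (sh_ob C i X) \<noteq> {0}} \<union> (\<lambda>i. i - n) ` {i. Hom C E (sh_ob C i G) \<noteq> {0}}"
        by blast
    qed
    then show ?case
      using built_step(3) assms(4) tri_hom_right(1)[OF e assms(3)] sG finite_subset unfolding hom_finite_def
      by (metis (no_types, lifting) finite_UnI finite_imageI)
  qed
  obtain B where B: "built C G k B" "retract C F B" using assms(1) unfolding level_def by auto
  have ob: "F \<in> Ob C" "B \<in> Ob C" using B(2) unfolding retract_def arr_def by auto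
  note r = retract_hom_right[OF shift_retract[OF B(2)] assms(3)]
  have fdB: "fin_dim (smul C) (Hom C E (sh_ob C i B))" for i using *[OF B(1)] unfolding hom_finite_def by auto
  have "{i. ext_dim C E F i \<noteq> 0} \<subseteq> {i. ext_dim C E B i \<noteq> 0}"
  proof
    fix i assume "i \<in> {i. ext_dim C E F i \<noteq> 0}"
    then show "i \<in> {i. ext_dim C E B i \<noteq> 0}" using r(2)[OF fdB, of i] by simp
  qed
  then show ?thesis
    using hom_finiteI[OF assms(3) ob(1) r(1)[OF fdB]] ext_support(2)[OF assms(3) ob(2) *[OF B(1)]] finite_subset by blast
qed

lemma finite_type_of_generator:
  assumes "split_generator C G" "hom_finite C G G" shows "finite_type C"
  unfolding finite_type_iff
proof (intro ballI)
  fix E F assume "E \<in> Ob C" "F \<in> Ob C"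
  have G: "G \<in> Ob C" using assms(1) unfolding split_generator_def by simp
  note lev = split_generator_level[OF assms(1)]
  have "hom_finite C G F" using level_hom_finite_right[OF lev[OF \<open>F \<in> Ob C\<close>] G G assms(2)] .
  then show "hom_finite C E F" using level_hom_finite_left(1)[OF lev[OF \<open>E \<in> Ob C\<close>] G \<open>F \<in> Ob C\<close>] by blast
qed

lemma abs_euler_form_le:
  assumes "E \<in> Ob C" "F \<in> Ob C" "hom_finite C E F"
  shows "\<bar>euler_form C E F\<bar> \<le> int (total_dim C E F)"
proof -
  have "{i. ksign i (int (ext_dim C E F i)) \<noteq> 0} = {i. ext_dim C E F i \<noteq> 0}" by auto
  then have "euler_form C E F = (\<Sum>i | ext_dim C E F i \<noteq> 0. ksign i (int (ext_dim C E F i)))"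
    unfolding euler_form_eq[OF assms] Sum_any.expand_set by simp
  also have "\<bar>\<dots>\<bar> \<le> (\<Sum>i | ext_dim C E F i \<noteq> 0. \<bar>ksign i (int (ext_dim C E F i))\<bar>)" by (rule sum_abs)
  also have "\<dots> = int (total_dim C E F)"
    unfolding total_dim_def Sum_any.expand_set by (simp add: ksign_def if_distrib cong: if_cong)
  finally show ?thesis .
qed

end

section \<open>Invariance of the Euler form under isomorphisms, adjunctions and
  autoequivalences\<close>

lemma euler_form_cong:
  assumes "triangulated_category C" "triangulated_category D" "finite_type C" "finite_type D"
    and "E \<in> Ob C" "F \<in> Ob C" "E' \<in> Ob D" "F' \<in> Ob D" "\<And>i. ext_dim C E F i = ext_dim D E' F' i"
  shows "euler_form C E F = euler_form D E' F'"
proof -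
  interpret C: triangulated_category C by fact
  interpret D: triangulated_category D by fact
  show ?thesis
    using C.euler_form_eq[OF assms(5,6)] D.euler_form_eq[OF assms(7,8)] assms(3-9) unfolding finite_type_iff by simp
qed

lemma (in triangulated_category) ext_dim_isom:
  assumes "finite_type C" "W \<in> Ob C" "isom C X Y"
  shows "ext_dim C X W i = ext_dim C Y W i" "ext_dim C W X i = ext_dim C W Y i"
proof -
  have ob: "X \<in> Ob C" "Y \<in> Ob C" using assms(3) unfolding isom_iff by auto
  have fd: "fin_dim (smul C) (Hom C E (sh_ob C i F))" if "E \<in> Ob C" "F \<in> Ob C" for E F i
    using assms(1) that unfolding finite_type_iff hom_finite_def by blast
  show "ext_dim C X W i = ext_dim C Y W i"
    using retract_hom_left(2)[OF isom_retract[OF assms(3)] shift_ob[OF assms(2)] fd[OF ob(2) assms(2), of i]]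
      retract_hom_left(2)[OF isom_retract[OF isom_sym[OF assms(3)]] shift_ob[OF assms(2)] fd[OF ob(1) assms(2), of i]] by simp
  show "ext_dim C W X i = ext_dim C W Y i"
    using retract_hom_right(2)[OF isom_retract[OF shift_isom[OF assms(3)]] assms(2) fd[OF assms(2) ob(2), of i]]
      retract_hom_right(2)[OF isom_retract[OF isom_sym[OF shift_isom[OF assms(3)]]] assms(2) fd[OF assms(2) ob(1), of i]] by simp
qed

lemma (in triangulated_category) euler_form_isom:
  assumes "finite_type C" "W \<in> Ob C" "isom C X Y"
  shows "euler_form C X W = euler_form C Y W" "euler_form C W X = euler_form C W Y"
  using euler_form_cong[OF triangulated_category_axioms triangulated_category_axioms assms(1,1)]
    ext_dim_isom[OF assms] assms(2,3) unfolding isom_iff by blast+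

text \<open>The adjunction bijection is linear, so it preserves dimensions in each degree, and R
  commutes with shifts up to isomorphism.\<close>

lemma euler_form_adjunction:
  assumes tc: "triangulated_category C" "triangulated_category D" and ft: "finite_type C" "finite_type D"
    and S: "exact_functor C D S" and R: "exact_functor D C R" and adj: "adjunction C D S R \<eta> \<epsilon>"
    and E: "E \<in> Ob C" and F: "F \<in> Ob D"
  shows "euler_form D (fob S E) F = euler_form C E (fob R F)"
proof -
  interpret C: triangulated_category C by fact
  interpret D: triangulated_category D by fact
  note linS = exact_functor_lin[OF S] and linR = exact_functor_lin[OF R]
  have SE: "fob S E \<in> Ob D" using lin_functor_ob[OF linS E] .
  have \<eta>: "arr C X (fob R (fob S X)) (\<eta> X)" if "X \<in> Ob C" for X
    using adj that lin_functor_ob[OF linS] lin_functor_ob[OF linR] unfolding adjunction_def nat_trans_def arr_def by simp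
  have \<epsilon>: "arr D (fob S (fob R Y)) Y (\<epsilon> Y)" if "Y \<in> Ob D" for Y
    using adj that lin_functor_ob[OF linS] lin_functor_ob[OF linR] unfolding adjunction_def nat_trans_def arr_def by simp
  have \<eta>nat: "\<eta> Y \<odot>\<^bsub>C\<^esub> f = fmap R (fob S X) (fob S Y) (fmap S X Y f) \<odot>\<^bsub>C\<^esub> \<eta> X" if "arr C X Y f" for X Y f
    using adj that unfolding adjunction_def nat_trans_def arr_def by (simp add: fcomp_def id_fnct_def)
  have \<epsilon>nat: "\<epsilon> Y \<odot>\<^bsub>D\<^esub> fmap S (fob R X) (fob R Y) (fmap R X Y f) = f \<odot>\<^bsub>D\<^esub> \<epsilon> X" if "arr D X Y f" for X Y f
    using adj that unfolding adjunction_def nat_trans_def arr_def by (simp add: fcomp_def id_fnct_def)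
  have tri1: "\<epsilon> (fob S X) \<odot>\<^bsub>D\<^esub> fmap S X (fob R (fob S X)) (\<eta> X) = idn D (fob S X)" if "X \<in> Ob C" for X
    using adj that unfolding adjunction_def by simp
  have tri2: "fmap R (fob S (fob R Y)) Y (\<epsilon> Y) \<odot>\<^bsub>C\<^esub> \<eta> (fob R Y) = idn C (fob R Y)" if "Y \<in> Ob D" for Y
    using adj that unfolding adjunction_def by simp
  have dims: "hom_dim D (fob S E) Y = hom_dim C E (fob R Y)"
    if Y: "Y \<in> Ob D" and fd: "fin_dim (smul D) (Hom D (fob S E) Y)" for Y
  proof -
    let ?\<phi> = "\<lambda>f. fmap R (fob S E) Y f \<odot>\<^bsub>C\<^esub> \<eta> E"
    have RY: "fob R Y \<in> Ob C" using lin_functor_ob[OF linR Y] .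
    have \<phi>: "arr C E (fob R Y) (?\<phi> f)" if "arr D (fob S E) Y f" for f
      using C.arr_cmp[OF \<eta>[OF E] lin_functor_arr[OF linR that]] .
    have inv1: "\<epsilon> Y \<odot>\<^bsub>D\<^esub> fmap S E (fob R Y) (?\<phi> f) = f" if f: "arr D (fob S E) Y f" for f
    proof -
      note Rf = lin_functor_arr[OF linR f]
      have "\<epsilon> Y \<odot>\<^bsub>D\<^esub> fmap S E (fob R Y) (?\<phi> f)
          = \<epsilon> Y \<odot>\<^bsub>D\<^esub> (fmap S (fob R (fob S E)) (fob R Y) (fmap R (fob S E) Y f) \<odot>\<^bsub>D\<^esub> fmap S E (fob R (fob S E)) (\<eta> E))"
        using lin_functor_cmp[OF linS \<eta>[OF E] Rf] by simp
      also have "\<dots> = (f \<odot>\<^bsub>D\<^esub> \<epsilon> (fob S E)) \<odot>\<^bsub>D\<^esub> fmap S E (fob R (fob S E)) (\<eta> E)"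
        using D.assoc[OF lin_functor_arr[OF linS \<eta>[OF E]] lin_functor_arr[OF linS Rf] \<epsilon>[OF Y]] \<epsilon>nat[OF f] by simp
      also have "\<dots> = f"
        using D.assoc[OF lin_functor_arr[OF linS \<eta>[OF E]] \<epsilon>[OF SE] f] tri1[OF E] D.idr[OF f] by simp
      finally show ?thesis .
    qed
    have inv2: "?\<phi> (\<epsilon> Y \<odot>\<^bsub>D\<^esub> fmap S E (fob R Y) g) = g" if g: "arr C E (fob R Y) g" for g
    proof -
      note Sg = lin_functor_arr[OF linS g]
      have "?\<phi> (\<epsilon> Y \<odot>\<^bsub>D\<^esub> fmap S E (fob R Y) g)
          = fmap R (fob S (fob R Y)) Y (\<epsilon> Y) \<odot>\<^bsub>C\<^esub> (fmap R (fob S E) (fob S (fob R Y)) (fmap S E (fob R Y) g) \<odot>\<^bsub>C\<^esub> \<eta> E)"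
        using lin_functor_cmp[OF linR Sg \<epsilon>[OF Y]]
          C.assoc[OF \<eta>[OF E] lin_functor_arr[OF linR Sg] lin_functor_arr[OF linR \<epsilon>[OF Y]]] by simp
      also have "\<dots> = fmap R (fob S (fob R Y)) Y (\<epsilon> Y) \<odot>\<^bsub>C\<^esub> (\<eta> (fob R Y) \<odot>\<^bsub>C\<^esub> g)"
        using \<eta>nat[OF g] by simp
      also have "\<dots> = g"
        using C.assoc[OF g \<eta>[OF RY] lin_functor_arr[OF linR \<epsilon>[OF Y]]] tri2[OF Y] C.idl[OF g] by simp
      finally show ?thesis .
    qed
    have im: "?\<phi> ` Hom D (fob S E) Y = Hom C E (fob R Y)"
    proof (intro equalityI subsetI)
      fix g assume "g \<in> ?\<phi> ` Hom D (fob S E) Y"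
      then show "g \<in> Hom C E (fob R Y)" using \<phi> SE Y unfolding arr_def by auto
    next
      fix g assume "g \<in> Hom C E (fob R Y)"
      then have g: "arr C E (fob R Y) g" using E RY unfolding arr_def by simp
      have "\<epsilon> Y \<odot>\<^bsub>D\<^esub> fmap S E (fob R Y) g \<in> Hom D (fob S E) Y"
        using D.arr_cmp[OF lin_functor_arr[OF linS g] \<epsilon>[OF Y]] unfolding arr_def by simp
      then show "g \<in> ?\<phi> ` Hom D (fob S E) Y" using inv2[OF g] by (metis (no_types, lifting) imageI)
    qed
    have "inj_on ?\<phi> (Hom D (fob S E) Y)"
    proof (rule inj_onI)
      fix f f' assume "f \<in> Hom D (fob S E) Y" "f' \<in> Hom D (fob S E) Y" "?\<phi> f = ?\<phi> f'"
      then have "arr D (fob S E) Y f" "arr D (fob S E) Y f'" "?\<phi> f = ?\<phi> f'" using SE Y unfolding arr_def by auto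
      then show "f = f'" using inv1 by metis
    qed
    moreover have "linear_on_subspace (smul D) (smul C) (Hom D (fob S E) Y) ?\<phi>"
    proof -
      have "fmap R (fob S E) Y f \<in> Hom C (fob R (fob S E)) (fob R Y)" if "f \<in> Hom D (fob S E) Y" for f
        using lin_functor_arr[OF linR, of "fob S E" Y f] that SE Y unfolding arr_def by simp
      then show ?thesis
        using lin_functor_lin[OF linR SE Y] C.precomp_linear[OF \<eta>[OF E] RY] unfolding linear_on_subspace_def by simp
    qed
    ultimately show ?thesis
      using dim_bij_on[OF D.vs C.vs D.hom_subspace[OF SE Y] _ fd] im by metis
  qed
  have RF: "fob R F \<in> Ob C" using lin_functor_ob[OF linR F] .
  have "ext_dim D (fob S E) F i = ext_dim C E (fob R F) i" for i
  proof -
    have "fin_dim (smul D) (Hom D (fob S E) (sh_ob D i F))"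
      using ft(2) SE F unfolding finite_type_iff hom_finite_def by blast
    from dims[OF D.shift_ob[OF F] this]
    have "ext_dim D (fob S E) F i = hom_dim C E (fob R (sh_ob D i F))" .
    \<comment> \<open>The isomorphism of R(F[i]) with (R F)[i] is applied in degree 0, where
      \<open>ext_dim\<close> is the plain \<open>hom_dim\<close>.\<close>
    moreover have "isom C (fob R (sh_ob D i F)) (sh_ob C i (fob R F))"
      using exact_functor_shift[OF tc(2,1) R F] .
    then have "ext_dim C E (fob R (sh_ob D i F)) 0 = ext_dim C E (sh_ob C i (fob R F)) 0"
      using C.ext_dim_isom(2)[OF ft(1) E] by blast
    ultimately show ?thesis using C.shift_zero(1) C.shift_ob RF lin_functor_ob[OF linR D.shift_ob[OF F]] by simp
  qed
  then show ?thesis using euler_form_cong[OF tc(2,1) ft(2,1) SE F E RF] by simp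
qed

lemma (in triangulated_category) euler_form_autoequivalence:
  assumes ft: "finite_type C" and T: "exact_autoequivalence C T" and E: "E \<in> Ob C" and F: "F \<in> Ob C"
  shows "euler_form C (fob T E) (fob T F) = euler_form C E F"
proof -
  have ex: "exact_functor C C T" and eq: "equivalence C C T" using T unfolding exact_autoequivalence_def by auto
  note lin = exact_functor_lin[OF ex]
  have T: "fob T E \<in> Ob C" "fob T F \<in> Ob C" using lin_functor_ob[OF lin] E F by auto
  have "ext_dim C (fob T E) (fob T F) i = ext_dim C E F i" for i
  proof -
    let ?F = "sh_ob C i F"
    have F': "?F \<in> Ob C" using shift_ob[OF F] .
    have "bij_betw (fmap T E ?F) (Hom C E ?F) (Hom C (fob T E) (fob T ?F))"
      using eq E F' unfolding equivalence_def by blast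
    moreover have "fin_dim (smul C) (Hom C E ?F)" using ft E F unfolding finite_type_iff hom_finite_def by blast
    ultimately have "hom_dim C (fob T E) (fob T ?F) = hom_dim C E ?F"
      using dim_bij_on[OF vs vs hom_subspace[OF E F'] lin_functor_lin[OF lin E F']] unfolding bij_betw_def by metis
    moreover have "ext_dim C (fob T E) (fob T ?F) 0 = ext_dim C (fob T E) (sh_ob C i (fob T F)) 0"
      using ext_dim_isom(2)[OF ft T(1) exact_functor_shift[OF triangulated_category_axioms triangulated_category_axioms ex F]] .
    ultimately show ?thesis using shift_zero(1) shift_ob T lin_functor_ob[OF lin F'] by simp
  qed
  then show ?thesis
    using euler_form_cong[OF triangulated_category_axioms triangulated_category_axioms ft ft T E F] by simp
qed

section \<open>The numerical Grothendieck group\<close>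

lemma (in comm_group) rcoset_eq_iff:
  assumes "subgroup H G" "a \<in> carrier G" "b \<in> carrier G"
  shows "H #> a = H #> b \<longleftrightarrow> a \<otimes> inv b \<in> H"
proof
  assume "H #> a = H #> b"
  then have "a \<in> H #> b" using rcos_self[OF assms(2,1)] by simp
  then obtain h where "h \<in> H" "a = h \<otimes> b" unfolding r_coset_def by auto
  then show "a \<otimes> inv b \<in> H"
    using assms subgroup.mem_carrier[OF assms(1)] by (simp add: m_assoc)
next
  assume *: "a \<otimes> inv b \<in> H"
  have "a = (a \<otimes> inv b) \<otimes> b" using assms by (simp add: m_assoc)
  then have "a \<in> H #> b" unfolding r_coset_def using * by auto
  then show "H #> a = H #> b" using repr_independence[OF _ assms(3,1)] by simp
qed

lemma (in comm_group) rcoset_mult: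
  assumes "subgroup H G" "a \<in> carrier G" "b \<in> carrier G"
  shows "(H #> a) \<otimes>\<^bsub>G Mod H\<^esub> (H #> b) = H #> (a \<otimes> b)"
  using normal.rcos_sum[OF subgroup_imp_normal[OF assms(1)] assms(2,3)] unfolding FactGroup_def by simp

lemma (in comm_group) rcoset_inv:
  assumes "subgroup H G" "a \<in> carrier G"
  shows "inv\<^bsub>G Mod H\<^esub> (H #> a) = H #> (inv a)"
  using normal.inv_FactGroup[OF subgroup_imp_normal[OF assms(1)], of "H #> a"]
    normal.rcos_inv[OF subgroup_imp_normal[OF assms(1)] assms(2)] assms
  unfolding FactGroup_def RCOSETS_def by auto

text \<open>The additive extension of \<chi>(-, F) to formal sums of objects.
  \<open>frag_extend\<close> takes values in a free abelian group, so the integers are encoded as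
  the one on the single generator ().\<close>

definition chi :: "('k::field, 'o, 'm::ab_group_add) tricat \<Rightarrow> 'o \<Rightarrow> ('o \<Rightarrow>\<^sub>0 int) \<Rightarrow> int" where
  "chi C F a = Poly_Mapping.lookup (frag_extend (\<lambda>X. frag_cmul (euler_form C X F) (frag_of ())) a) ()"

lemma chi_simps [simp]: "chi C F 0 = 0" "chi C F (a + b) = chi C F a + chi C F b"
  "chi C F (a - b) = chi C F a - chi C F b" "chi C F (- a) = - chi C F a"
  "chi C F (frag_of X) = euler_form C X F"
  unfolding chi_def by (simp_all add: frag_extend_add frag_extend_diff frag_extend_minus lookup_add lookup_minus)

locale numerical = triangulated_category +
  assumes ft: "finite_type C"
begin

abbreviation FA where "FA \<equiv> free_Abelian_group (Ob C)"

lemma euler_additive: "\<lbrakk>extension C X Y Z; F \<in> Ob C\<rbrakk> \<Longrightarrow> euler_form C Y F = euler_form C X F + euler_form C Z F"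
  using hom_finite_extension_left(3) ft extension_ob unfolding finite_type_iff by metis

lemma comm_FA: "comm_group FA" by (rule abelian_free_Abelian_group)

lemma relations_carrier: "grothendieck_relations C \<subseteq> carrier FA"
proof
  fix a assume "a \<in> grothendieck_relations C"
  then obtain X Y Z f g h where a: "a = frag_of X - frag_of Y + frag_of Z" "tri C X Y Z f g h"
    unfolding grothendieck_relations_def by auto
  have "Poly_Mapping.keys a \<subseteq> Poly_Mapping.keys (frag_of X) \<union> Poly_Mapping.keys (frag_of Y) \<union> Poly_Mapping.keys (frag_of Z)"
    unfolding a(1) using keys_add[of "frag_of X - frag_of Y" "frag_of Z"] keys_diff[of "frag_of X" "frag_of Y"] by blast
  then show "a \<in> carrier FA" using tri_type[OF a(2)] by auto
qed

lemma K_subgroup: "subgroup (K_subgroup C) FA"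
  unfolding K_subgroup_def by (rule group.generate_is_subgroup[OF group_free_Abelian_group relations_carrier])

lemma K_sub_carrier: "a \<in> K_subgroup C \<Longrightarrow> a \<in> carrier FA"
  using subgroup.subset[OF K_subgroup] by blast

lemma K_sub_add: "\<lbrakk>a \<in> K_subgroup C; b \<in> K_subgroup C\<rbrakk> \<Longrightarrow> a + b \<in> K_subgroup C"
  using subgroup.m_closed[OF K_subgroup] by simp

lemma K_sub_minus: "a \<in> K_subgroup C \<Longrightarrow> - a \<in> K_subgroup C"
  using subgroup.m_inv_closed[OF K_subgroup] K_sub_carrier by fastforce

lemma K_sub_diff: "\<lbrakk>a \<in> K_subgroup C; b \<in> K_subgroup C\<rbrakk> \<Longrightarrow> a - b \<in> K_subgroup C"
  using K_sub_add[OF _ K_sub_minus] by (metis diff_conv_add_uminus)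

lemma K_sub_rel: "extension C X Y Z \<Longrightarrow> frag_of X - frag_of Y + frag_of Z \<in> K_subgroup C"
  unfolding K_subgroup_def grothendieck_relations_def extension_def by (rule generate.incl) blast

lemma chi_K_sub:
  assumes "a \<in> K_subgroup C" "F \<in> Ob C" shows "chi C F a = 0"
proof -
  have rel: "chi C F h = 0" if "h \<in> grothendieck_relations C" for h
    using that euler_additive assms(2) unfolding grothendieck_relations_def extension_def by force
  show ?thesis using assms(1) unfolding K_subgroup_def
  proof (induction rule: generate.induct)
    case (inv h)
    have "inv\<^bsub>FA\<^esub> h = - h" using subsetD[OF relations_carrier inv] by simp
    then show ?case using rel[OF inv] by simp
  qed (use rel in auto)
qed

text \<open>Modulo the relations a direct sum represents a sum and a shift represents a negative, so
  every formal combination is equivalent to a single object.\<close>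

lemma carrier_repr:
  assumes "a \<in> carrier FA" shows "\<exists>E\<in>Ob C. a - frag_of E \<in> K_subgroup C"
proof -
  obtain Z where Z: "zero_ob C Z" using ex_zero by blast
  then have ZO: "Z \<in> Ob C" unfolding zero_ob_def by simp
  have Z0: "frag_of Z \<in> K_subgroup C" using K_sub_rel[OF extension_zero_left[OF ZO Z]] by simp
  have "Poly_Mapping.keys a \<subseteq> Ob C" using assms by simp
  then show ?thesis
  proof (induction rule: frag_induction)
    case zero
    then show ?case using ZO K_sub_minus[OF Z0] by (intro bexI[of _ Z]) simp_all
  next
    case (one x)
    have "0 \<in> K_subgroup C" using K_sub_diff[OF Z0 Z0] by simp
    then show ?case using one by (intro bexI[of _ x]) simp_all
  next
    case (diff a b)
    then obtain E E' where E: "E \<in> Ob C" "a - frag_of E \<in> K_subgroup C" "E' \<in> Ob C" "b - frag_of E' \<in> K_subgroup C"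
      by blast
    let ?E = "sh_ob C 1 E'"
    have E1: "?E \<in> Ob C" using shift_ob[OF E(3)] .
    obtain S where S: "direct_sum C E ?E S" using ex_direct_sum[OF E(1) E1] by blast
    note ext = direct_sum_extension[OF E(1) E1 S]
    have "extension C E' Z ?E" using extension_rotate[OF extension_zero_left[OF E(3) Z]]
      extension_rotate[OF extension_zero_right[OF E(3) Z]] by blast
    from K_sub_rel[OF this] have 1: "frag_of E' - frag_of Z + frag_of ?E \<in> K_subgroup C" .
    \<comment> \<open>A combination of elements of \<open>K_subgroup C\<close> in which everything
      except a - b and S cancels.\<close>
    have "(a - frag_of E) - (b - frag_of E') + (frag_of E - frag_of S + frag_of ?E)
        - ((frag_of E' - frag_of Z + frag_of ?E) + frag_of Z) \<in> K_subgroup C"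
      by (rule K_sub_diff[OF K_sub_add[OF K_sub_diff[OF E(2,4)] K_sub_rel[OF ext]] K_sub_add[OF 1 Z0]])
    also have "(a - frag_of E) - (b - frag_of E') + (frag_of E - frag_of S + frag_of ?E)
        - ((frag_of E' - frag_of Z + frag_of ?E) + frag_of Z) = (a - b) - frag_of S" by (simp add: algebra_simps)
    finally show ?case using extension_ob[OF ext] by blast
  qed
qed

lemma comm_K: "comm_group (K_group C)"
  unfolding K_group_def by (rule comm_group.abelian_FactGroup[OF comm_FA K_subgroup])

lemma K_coset_eq_iff:
  assumes "a \<in> carrier FA" "b \<in> carrier FA"
  shows "K_subgroup C #>\<^bsub>FA\<^esub> a = K_subgroup C #>\<^bsub>FA\<^esub> b \<longleftrightarrow> a - b \<in> K_subgroup C"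
  using comm_group.rcoset_eq_iff[OF comm_FA K_subgroup assms] assms by simp

lemma carrier_K: "carrier (K_group C) = {K_class C E | E. E \<in> Ob C}"
proof -
  have "\<exists>E\<in>Ob C. K_subgroup C #>\<^bsub>FA\<^esub> a = K_class C E" if a: "a \<in> carrier FA" for a
  proof -
    obtain E where E: "E \<in> Ob C" "a - frag_of E \<in> K_subgroup C" using carrier_repr[OF a] by blast
    then show ?thesis using K_coset_eq_iff[OF a, of "frag_of E"] unfolding K_class_def by auto
  qed
  then have "carrier (K_group C) \<subseteq> {K_class C E | E. E \<in> Ob C}"
    unfolding K_group_def carrier_FactGroup by blast
  moreover have "K_class C E \<in> carrier (K_group C)" if "E \<in> Ob C" for E
    unfolding K_class_def K_group_def FactGroup_def RCOSETS_def using that by auto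
  ultimately show ?thesis by (intro equalityI subsetI) auto
qed

lemma num_radical_gen: "{K_class C E | E. E \<in> Ob C \<and> (\<forall>F\<in>Ob C. euler_form C E F = 0)} \<subseteq> carrier (K_group C)"
  unfolding carrier_K by blast

lemma num_radical_subgroup: "subgroup (num_radical C) (K_group C)"
  unfolding num_radical_def
  by (rule group.generate_is_subgroup[OF comm_group.axioms(2)[OF comm_K] num_radical_gen])

text \<open>The radical is defined by generators; this shows that passing to the generated subgroup
  introduces nothing on which some \<chi>(-, F) is nonzero.\<close>

lemma num_radical_chi:
  assumes "x \<in> num_radical C"
  shows "\<exists>a\<in>carrier FA. x = K_subgroup C #>\<^bsub>FA\<^esub> a \<and> (\<forall>F\<in>Ob C. chi C F a = 0)"
  using assms unfolding num_radical_def
proof (induction rule: generate.induct)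
  case one
  have "0 \<in> K_subgroup C" using subgroup.one_closed[OF K_subgroup] by simp
  then have "K_subgroup C #>\<^bsub>FA\<^esub> 0 = K_subgroup C"
    using group.coset_join2[OF group_free_Abelian_group _ K_subgroup, of 0] by simp
  then show ?case unfolding K_group_def FactGroup_def by (intro bexI[of _ 0]) auto
next
  case (incl h)
  then show ?case unfolding K_class_def by force
next
  case (inv h)
  then obtain E where E: "E \<in> Ob C" "\<forall>F\<in>Ob C. euler_form C E F = 0" "h = K_class C E" by blast
  have "inv\<^bsub>K_group C\<^esub> h = K_subgroup C #>\<^bsub>FA\<^esub> (- frag_of E)"
    using comm_group.rcoset_inv[OF comm_FA K_subgroup, of "frag_of E"] E unfolding K_group_def K_class_def by simp
  then show ?case using E(1,2) by (intro bexI[of _ "- frag_of E"]) auto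
next
  case (eng x y)
  then obtain a b where ab: "a \<in> carrier FA" "x = K_subgroup C #>\<^bsub>FA\<^esub> a" "\<forall>F\<in>Ob C. chi C F a = 0"
    "b \<in> carrier FA" "y = K_subgroup C #>\<^bsub>FA\<^esub> b" "\<forall>F\<in>Ob C. chi C F b = 0" by blast
  have "x \<otimes>\<^bsub>K_group C\<^esub> y = K_subgroup C #>\<^bsub>FA\<^esub> (a + b)"
    using comm_group.rcoset_mult[OF comm_FA K_subgroup ab(1,4)] ab unfolding K_group_def by simp
  moreover have "a + b \<in> carrier FA" using keys_add[of a b] ab(1,4) by auto
  ultimately show ?case using ab(3,6) by (intro bexI[of _ "a + b"]) auto
qed

lemma K_class_carrier: "E \<in> Ob C \<Longrightarrow> K_class C E \<in> carrier (K_group C)"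
  unfolding carrier_K by blast

lemma K_class_diff:
  assumes "E \<in> Ob C" "E' \<in> Ob C"
  shows "K_class C E \<otimes>\<^bsub>K_group C\<^esub> inv\<^bsub>K_group C\<^esub> (K_class C E') = K_subgroup C #>\<^bsub>FA\<^esub> (frag_of E - frag_of E')"
proof -
  have "inv\<^bsub>K_group C\<^esub> (K_class C E') = K_subgroup C #>\<^bsub>FA\<^esub> (- frag_of E')"
    using comm_group.rcoset_inv[OF comm_FA K_subgroup, of "frag_of E'"] assms unfolding K_group_def K_class_def by simp
  then show ?thesis
    using comm_group.rcoset_mult[OF comm_FA K_subgroup, of "frag_of E" "- frag_of E'"] assms
    unfolding K_group_def K_class_def by simp
qed

text \<open>If the Euler forms agree, the difference of the two classes is the class of one object X
  by \<open>carrier_repr\<close>, and X is then itself a generator of the radical.\<close>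

lemma N_class_eq_iff:
  assumes "E \<in> Ob C" "E' \<in> Ob C"
  shows "N_class C E = N_class C E' \<longleftrightarrow> (\<forall>F\<in>Ob C. euler_form C E F = euler_form C E' F)"
proof -
  have dc: "frag_of E - frag_of E' \<in> carrier FA"
    using keys_diff[of "frag_of E" "frag_of E'"] assms by auto
  have "N_class C E = N_class C E' \<longleftrightarrow> K_subgroup C #>\<^bsub>FA\<^esub> (frag_of E - frag_of E') \<in> num_radical C"
    unfolding N_class_def
    using comm_group.rcoset_eq_iff[OF comm_K num_radical_subgroup K_class_carrier[OF assms(1)] K_class_carrier[OF assms(2)]]
      K_class_diff[OF assms] by simp
  also have "\<dots> \<longleftrightarrow> (\<forall>F\<in>Ob C. euler_form C E F = euler_form C E' F)"
  proof
    assume "K_subgroup C #>\<^bsub>FA\<^esub> (frag_of E - frag_of E') \<in> num_radical C"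
    then obtain a where a: "a \<in> carrier FA" "\<forall>F\<in>Ob C. chi C F a = 0"
      "K_subgroup C #>\<^bsub>FA\<^esub> (frag_of E - frag_of E') = K_subgroup C #>\<^bsub>FA\<^esub> a"
      using num_radical_chi by blast
    then have "frag_of E - frag_of E' - a \<in> K_subgroup C" using K_coset_eq_iff[OF dc] by simp
    then show "\<forall>F\<in>Ob C. euler_form C E F = euler_form C E' F" using chi_K_sub a(2) by fastforce
  next
    assume eq: "\<forall>F\<in>Ob C. euler_form C E F = euler_form C E' F"
    obtain X where X: "X \<in> Ob C" "frag_of E - frag_of E' - frag_of X \<in> K_subgroup C" using carrier_repr[OF dc] by blast
    have "euler_form C X F = 0" if "F \<in> Ob C" for F
      using chi_K_sub[OF X(2) that] eq that by simp
    then have "K_class C X \<in> num_radical C" unfolding num_radical_def using X(1) by (intro generate.incl) blast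
    moreover have "K_class C X = K_subgroup C #>\<^bsub>FA\<^esub> (frag_of E - frag_of E')"
      unfolding K_class_def using K_coset_eq_iff[OF dc, of "frag_of X"] X by simp
    ultimately show "K_subgroup C #>\<^bsub>FA\<^esub> (frag_of E - frag_of E') \<in> num_radical C" by simp
  qed
  finally show ?thesis .
qed

lemma carrier_N: "carrier (N_group C) = {N_class C E | E. E \<in> Ob C}"
proof -
  have "carrier (N_group C) = {num_radical C #>\<^bsub>K_group C\<^esub> x | x. x \<in> carrier (K_group C)}"
    unfolding N_group_def FactGroup_def RCOSETS_def by auto
  then show ?thesis unfolding carrier_K N_class_def by blast
qed

lemma N_class_carrier: "E \<in> Ob C \<Longrightarrow> N_class C E \<in> carrier (N_group C)"
  unfolding carrier_N by blast

lemma comm_N: "comm_group (N_group C)"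
  unfolding N_group_def by (rule comm_group.abelian_FactGroup[OF comm_K num_radical_subgroup])

lemma N_class_extension:
  assumes "extension C X Y Z"
  shows "N_class C Y = N_class C X \<otimes>\<^bsub>N_group C\<^esub> N_class C Z"
proof -
  have ob: "X \<in> Ob C" "Y \<in> Ob C" "Z \<in> Ob C" using extension_ob[OF assms] by auto
  have XZ: "frag_of X + frag_of Z \<in> carrier FA" using keys_add[of "frag_of X" "frag_of Z"] ob by auto
  have "K_class C X \<otimes>\<^bsub>K_group C\<^esub> K_class C Z = K_subgroup C #>\<^bsub>FA\<^esub> (frag_of X + frag_of Z)"
    using comm_group.rcoset_mult[OF comm_FA K_subgroup, of "frag_of X" "frag_of Z"] ob
    unfolding K_group_def K_class_def by simp
  also have "\<dots> = K_class C Y"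
    unfolding K_class_def using K_coset_eq_iff[OF XZ, of "frag_of Y"] K_sub_rel[OF assms] ob
    by (simp add: algebra_simps)
  finally show ?thesis
    unfolding N_class_def
    using comm_group.rcoset_mult[OF comm_K num_radical_subgroup K_class_carrier[OF ob(1)] K_class_carrier[OF ob(3)]]
    unfolding N_group_def by simp
qed

lemma additive_on_extension:
  assumes "additive_on (N_group C) \<phi>" "extension C X Y Z"
  shows "\<phi> (N_class C Y) = \<phi> (N_class C X) + \<phi> (N_class C Z)"
  using assms N_class_extension[OF assms(2)] N_class_carrier extension_ob[OF assms(2)] unfolding additive_on_def by auto

text \<open>Direct sums and shifts realise an integral combination of classes by an actual object.
  This turns integral relations between Euler forms into the numerical triviality of one
  object.\<close>

lemma int_combination:
  assumes "finite I" "I \<subseteq> Ob C"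
  shows "\<exists>X\<in>Ob C. (\<forall>F\<in>Ob C. euler_form C X F = (\<Sum>E\<in>I. m E * euler_form C E F)) \<and>
      (\<forall>\<phi>. additive_on (N_group C) \<phi> \<longrightarrow> \<phi> (N_class C X) = (\<Sum>E\<in>I. of_int (m E) * \<phi> (N_class C E)))"
  using assms
proof (induction I rule: finite_induct)
  case empty
  obtain Z where Z: "zero_ob C Z" using ex_zero by blast
  then have ZO: "Z \<in> Ob C" unfolding zero_ob_def by simp
  note e = extension_zero_left[OF ZO Z]
  show ?case using ZO additive_on_extension[OF _ e] euler_additive[OF e] by (intro bexI[of _ Z]) auto
next
  case (insert E I)
  have E: "E \<in> Ob C" using insert by simp
  obtain X0 where X0: "X0 \<in> Ob C" "\<forall>F\<in>Ob C. euler_form C X0 F = (\<Sum>E\<in>I. m E * euler_form C E F)"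
    "\<forall>\<phi>. additive_on (N_group C) \<phi> \<longrightarrow> \<phi> (N_class C X0) = (\<Sum>E\<in>I. of_int (m E) * \<phi> (N_class C E))"
    using insert by blast
  let ?P = "\<lambda>X k. X \<in> Ob C \<and> (\<forall>F\<in>Ob C. euler_form C X F = euler_form C X0 F + k * euler_form C E F) \<and>
      (\<forall>\<phi>. additive_on (N_group C) \<phi> \<longrightarrow> \<phi> (N_class C X) = \<phi> (N_class C X0) + of_int k * \<phi> (N_class C E))"
  have "\<exists>X. ?P X k" for k :: int
  proof (induction k rule: int_induct[where k = 0])
    case base
    then show ?case using X0(1) by (intro exI[of _ X0]) simp
  next
    case (step1 k)
    then obtain X where X: "?P X k" by blast
    obtain S where "direct_sum C X E S" using ex_direct_sum X E by blast
    then have S: "extension C X S E" using direct_sum_extension X E by blast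
    have "?P S (k + 1)"
      using X euler_additive[OF S] additive_on_extension[OF _ S] extension_ob[OF S]
      by (auto simp: algebra_simps)
    then show ?case by blast
  next
    case (step2 k)
    then obtain X where X: "?P X k" by blast
    obtain Z where Z: "zero_ob C Z" using ex_zero by blast
    note e = extension_rotate[OF extension_zero_right[OF E Z]]
    note z = extension_zero_left[OF _ Z, of Z]
    have ZO: "Z \<in> Ob C" using Z unfolding zero_ob_def by simp
    obtain S where "direct_sum C X (sh_ob C 1 E) S" using ex_direct_sum X shift_ob[OF E] by blast
    then have S: "extension C X S (sh_ob C 1 E)" using direct_sum_extension X shift_ob[OF E] by blast
    have 1: "euler_form C (sh_ob C 1 E) F = - euler_form C E F" if "F \<in> Ob C" for F
      using euler_additive[OF e that] euler_additive[OF z[OF ZO] that] by simp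
    have 2: "\<phi> (N_class C (sh_ob C 1 E)) = - \<phi> (N_class C E)" if "additive_on (N_group C) \<phi>" for \<phi>
      using additive_on_extension[OF that e] additive_on_extension[OF that z[OF ZO]] by (simp add: add_eq_0_iff)
    have "\<phi> (N_class C S) = \<phi> (N_class C X0) + of_int (k - 1) * \<phi> (N_class C E)"
      if "additive_on (N_group C) \<phi>" for \<phi>
      using additive_on_extension[OF that S] 2[OF that] X that by (simp add: algebra_simps)
    moreover have "euler_form C S F = euler_form C X0 F + (k - 1) * euler_form C E F" if "F \<in> Ob C" for F
      using euler_additive[OF S that] 1[OF that] X that by (simp add: algebra_simps)
    ultimately have "?P S (k - 1)" using extension_ob[OF S] by blast
    then show ?case by blast
  qed
  then obtain X where X: "?P X (m E)" by blast
  show ?case using X X0 insert(1,2) by (intro bexI[of _ X]) (auto simp: algebra_simps)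
qed

text \<open>Such an object has the class of a zero object, whose class is its own double.\<close>

lemma additive_on_trivial:
  assumes "X \<in> Ob C" "\<And>F. F \<in> Ob C \<Longrightarrow> euler_form C X F = 0" "additive_on (N_group C) \<phi>"
  shows "\<phi> (N_class C X) = 0"
proof -
  obtain Z where Z: "zero_ob C Z" using ex_zero by blast
  then have ZO: "Z \<in> Ob C" unfolding zero_ob_def by simp
  note e = extension_zero_left[OF ZO Z]
  have "N_class C X = N_class C Z"
    using N_class_eq_iff[OF assms(1) ZO] assms(2) euler_additive[OF e] by simp
  then show ?thesis using additive_on_extension[OF assms(3) e] by simp
qed

end

section \<open>The complexified numerical Grothendieck group\<close>

declare plus_fun_def [simp del] zero_fun_def [simp del]

subsection \<open>Eigenvalues\<close>

context vector_space
begin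

lemma linear_on_subspace_sum:
  assumes f: "linear_on_subspace scale scale' V f" and V: "subspace V" and v': "vector_space scale'"
    and I: "finite I" "\<And>E. E \<in> I \<Longrightarrow> g E \<in> V"
  shows "f (\<Sum>E\<in>I. scale (a E) (g E)) = (\<Sum>E\<in>I. scale' (a E) (f (g E))) \<and> (\<Sum>E\<in>I. scale (a E) (g E)) \<in> V"
  using I
proof (induction I rule: finite_induct)
  case empty
  then show ?case
    using linear_on_subspace_simps(1)[OF f vector_space_axioms v' V] subspace_0[OF V] by simp
next
  case (insert E I)
  then have "g E \<in> V" "scale (a E) (g E) \<in> V" using subspace_scale[OF V] by auto
  then show ?case using insert f subspace_add[OF V] unfolding linear_on_subspace_def by simp
qed

text \<open>Subtracting \<nu> times the relation from its image under f removes the eigenvector of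
  \<nu> and multiplies the other coefficients by the nonzero numbers \<mu> - \<nu>.\<close>

lemma eigenvectors_independent:
  assumes V: "subspace V" and f: "linear_on_subspace scale scale V f"
    and M: "finite M" and v: "\<And>\<mu>. \<mu> \<in> M \<Longrightarrow> v \<mu> \<in> V \<and> v \<mu> \<noteq> 0 \<and> f (v \<mu>) = scale \<mu> (v \<mu>)"
    and zero: "(\<Sum>\<mu>\<in>M. scale (a \<mu>) (v \<mu>)) = 0"
  shows "\<forall>\<mu>\<in>M. a \<mu> = 0"
  using M v zero
proof (induction M arbitrary: a rule: finite_induct)
  case (insert \<nu> M)
  let ?s = "\<lambda>a. \<Sum>\<mu>\<in>M. scale (a \<mu>) (v \<mu>)"
  have vV: "v \<mu> \<in> V" if "\<mu> \<in> insert \<nu> M" for \<mu> using insert(4)[OF that] by simp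
  have 0: "scale (a \<nu>) (v \<nu>) + ?s a = 0" using insert by simp
  have "finite (insert \<nu> M)" using insert(1) by simp
  from linear_on_subspace_sum[where g = v and a = a, OF f V vector_space_axioms this vV]
  have "f (\<Sum>\<mu>\<in>insert \<nu> M. scale (a \<mu>) (v \<mu>)) = (\<Sum>\<mu>\<in>insert \<nu> M. scale (a \<mu>) (f (v \<mu>)))" by simp
  then have "(\<Sum>\<mu>\<in>insert \<nu> M. scale (a \<mu>) (f (v \<mu>))) = 0"
    using insert(5) linear_on_subspace_simps(1)[OF f vector_space_axioms vector_space_axioms V] by simp
  also have "(\<Sum>\<mu>\<in>insert \<nu> M. scale (a \<mu>) (f (v \<mu>))) = (\<Sum>\<mu>\<in>insert \<nu> M. scale (a \<mu> * \<mu>) (v \<mu>))"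
    using insert(4) by (intro sum.cong) auto
  finally have 1: "scale (a \<nu> * \<nu>) (v \<nu>) + ?s (\<lambda>\<mu>. a \<mu> * \<mu>) = 0" using insert(1,2) by simp
  have "scale \<nu> (scale (a \<nu>) (v \<nu>) + ?s a) = 0" using 0 by (simp only: scale_zero_right)
  then have 2: "scale (a \<nu> * \<nu>) (v \<nu>) + ?s (\<lambda>\<mu>. a \<mu> * \<nu>) = 0"
    by (simp add: scale_right_distrib scale_sum_right mult.commute)
  have "?s (\<lambda>\<mu>. a \<mu> * (\<mu> - \<nu>)) = ?s (\<lambda>\<mu>. a \<mu> * \<mu>) - ?s (\<lambda>\<mu>. a \<mu> * \<nu>)"
    by (simp add: right_diff_distrib scale_left_diff_distrib sum_subtractf)
  also have "\<dots> = 0" using 1 2 by (simp add: add_eq_0_iff)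
  finally have "\<forall>\<mu>\<in>M. a \<mu> * (\<mu> - \<nu>) = 0" using insert(3)[of "\<lambda>\<mu>. a \<mu> * (\<mu> - \<nu>)"] insert(4) by simp
  then have M: "\<forall>\<mu>\<in>M. a \<mu> = 0" using insert(2) by auto
  then have "?s a = 0" by (intro sum.neutral) auto
  then have "a \<nu> = 0" using 0 insert(4)[of \<nu>] by simp
  then show ?case using M by simp
qed simp

text \<open>The number of eigenvalues is bounded by the size of a spanning set, so the maximum in
  \<open>spectral_radius\<close> is taken over a finite set.\<close>

lemma finite_eigenvalues:
  assumes V: "subspace V" and f: "linear_on_subspace scale scale V f" and fd: "fin_dim scale V"
  shows "finite {\<mu>. \<exists>v\<in>V. v \<noteq> 0 \<and> f v = scale \<mu> v}"
proof -
  obtain B where B: "finite B" "V \<subseteq> span B" using fd unfolding fin_dim_def by auto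
  define E where "E = {\<mu>. \<exists>v\<in>V. v \<noteq> 0 \<and> f v = scale \<mu> v}"
  have "\<forall>\<mu>\<in>E. \<exists>v. v \<in> V \<and> v \<noteq> 0 \<and> f v = scale \<mu> v" unfolding E_def by blast
  from bchoice[OF this] obtain v where v: "\<forall>\<mu>\<in>E. v \<mu> \<in> V \<and> v \<mu> \<noteq> 0 \<and> f (v \<mu>) = scale \<mu> (v \<mu>)" by auto
  have inj: "inj_on v E"
  proof (rule inj_onI)
    fix \<mu> \<nu> assume *: "\<mu> \<in> E" "\<nu> \<in> E" "v \<mu> = v \<nu>"
    have "scale \<mu> (v \<mu>) = f (v \<mu>)" using bspec[OF v *(1)] by simp
    also have "\<dots> = scale \<nu> (v \<mu>)" using bspec[OF v *(2)] *(3) by simp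
    finally show "\<mu> = \<nu>" using bspec[OF v *(1)] scale_cancel_right by blast
  qed
  have "card M \<le> card B" if M: "M \<subseteq> E" "finite M" for M
  proof -
    have injM: "inj_on v M" using inj M(1) by (rule inj_on_subset)
    have "independent (v ` M)"
    proof (rule independent_if_scalars_zero)
      show "finite (v ` M)" using M by simp
      fix g x assume g: "(\<Sum>x\<in>v ` M. scale (g x) x) = 0" "x \<in> v ` M"
      have "(\<Sum>\<mu>\<in>M. scale (g (v \<mu>)) (v \<mu>)) = 0"
        using g(1) sum.reindex[OF injM, of "\<lambda>x. scale (g x) x"] by simp
      moreover have "v \<mu> \<in> V \<and> v \<mu> \<noteq> 0 \<and> f (v \<mu>) = scale \<mu> (v \<mu>)" if "\<mu> \<in> M" for \<mu> using v M(1) that by auto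
      ultimately have "\<forall>\<mu>\<in>M. g (v \<mu>) = 0" by (intro eigenvectors_independent[OF V f M(2)])
      then show "g x = 0" using g(2) by auto
    qed
    moreover have "v ` M \<subseteq> span B" using v M(1) B(2) by auto
    ultimately have "card (v ` M) \<le> card B" using independent_span_bound[OF B(1)] by simp
    then show ?thesis using card_image[OF injM] by simp
  qed
  then show ?thesis unfolding E_def[symmetric]
    using finite_if_finite_subsets_card_bdd[of E "card B"] by simp
qed

end

lemma vector_space_cscale: "vector_space (cscale :: complex \<Rightarrow> ('i \<Rightarrow> complex) \<Rightarrow> 'i \<Rightarrow> complex)"
  by unfold_locales (auto simp: pointwise_def fun_eq_iff algebra_simps)

interpretation cv: vector_space "cscale :: complex \<Rightarrow> ('i \<Rightarrow> complex) \<Rightarrow> 'i \<Rightarrow> complex"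
  by (rule vector_space_cscale)

lemma sum_apply: "(\<Sum>E\<in>I. g E) x = (\<Sum>E\<in>I. g E x)"
  for g :: "'a \<Rightarrow> 'i \<Rightarrow> complex"
  by (induction I rule: infinite_finite_induct) auto

lemma spectral_radius_eigen:
  assumes V: "cv.subspace V" and f: "linear_on_subspace cscale cscale V f" and fd: "fin_dim cscale V"
    and v: "v \<in> V" "v \<noteq> 0" "f v = cscale \<mu> v"
  shows "cmod \<mu> \<le> spectral_radius V f"
    and "\<exists>\<nu> w. w \<in> V \<and> w \<noteq> 0 \<and> f w = cscale \<nu> w \<and> cmod \<nu> = spectral_radius V f"
proof -
  let ?E = "{\<mu>. \<exists>v\<in>V. v \<noteq> 0 \<and> f v = cscale \<mu> v}"
  have eq: "{cmod \<mu> | \<mu>. \<exists>v\<in>V. v \<noteq> 0 \<and> f v = cscale \<mu> v} = cmod ` ?E" by auto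
  have fin: "finite (cmod ` ?E)" using cv.finite_eigenvalues[OF V f fd] by simp
  have mem: "cmod \<mu> \<in> cmod ` ?E" using v by blast
  show "cmod \<mu> \<le> spectral_radius V f" unfolding spectral_radius_def eq using Max_ge[OF fin mem] .
  have "Max (cmod ` ?E) \<in> cmod ` ?E" using Max_in[OF fin] mem by blast
  then show "\<exists>\<nu> w. w \<in> V \<and> w \<noteq> 0 \<and> f w = cscale \<nu> w \<and> cmod \<nu> = spectral_radius V f"
    unfolding spectral_radius_def eq by force
qed

subsection \<open>Linear independence over the rational numbers\<close>

text \<open>Flatness of \<open>\<complex>\<close> over \<open>\<int>\<close>, proved by expanding the coefficients in a basis of \<open>\<complex>\<close> over \<open>\<rat>\<close>.\<close>

lemma rational_relations:
  fixes a :: "'e \<Rightarrow> complex" and x :: "'f \<Rightarrow> 'e \<Rightarrow> int" and y :: "'e \<Rightarrow> complex"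
  assumes I: "finite I" and rel: "\<And>F. F \<in> S \<Longrightarrow> (\<Sum>E\<in>I. a E * of_int (x F E)) = 0"
    and y: "\<And>m :: 'e \<Rightarrow> int. (\<And>F. F \<in> S \<Longrightarrow> (\<Sum>E\<in>I. m E * x F E) = 0) \<Longrightarrow> (\<Sum>E\<in>I. of_int (m E) * y E) = 0"
  shows "(\<Sum>E\<in>I. a E * y E) = 0"
proof -
  interpret q: vector_space "\<lambda>(r::rat) (z::complex). of_rat r * z"
    by unfold_locales (auto simp: algebra_simps of_rat_add of_rat_mult)
  obtain B where "B \<subseteq> UNIV" and B: "q.independent B" "UNIV \<subseteq> q.span B"
    by (rule q.maximal_independent_subset)
  define r where "r E = q.representation B (a E)" for E
  define T where "T = (\<Union>E\<in>I. {b. r E b \<noteq> 0})"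
  have T: "finite T" unfolding T_def r_def by (rule finite_UN_I[OF I]) (rule q.finite_representation)
  have TB: "T \<subseteq> B" unfolding T_def r_def using q.representation_ne_zero[of B] by fast
  have a: "a E = (\<Sum>b\<in>T. of_rat (r E b) * b)" if "E \<in> I" for E
  proof -
    have "(\<Sum>b | r E b \<noteq> 0. of_rat (r E b) * b) = a E"
      unfolding r_def using q.sum_nonzero_representation_eq[OF B(1)] B(2) by blast
    moreover have "(\<Sum>b | r E b \<noteq> 0. of_rat (r E b) * b) = (\<Sum>b\<in>T. of_rat (r E b) * b)"
      using that unfolding T_def by (intro sum.mono_neutral_left) (use T[unfolded T_def] in auto)
    ultimately show ?thesis by simp
  qed
  \<comment> \<open>Every sum with coefficients a is regrouped by the rational basis vectors b that
    occur in the a E.\<close>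
  have comb: "(\<Sum>E\<in>I. a E * z E) = (\<Sum>b\<in>T. b * (\<Sum>E\<in>I. of_rat (r E b) * z E))" for z :: "'e \<Rightarrow> complex"
  proof -
    have "a E * z E = (\<Sum>b\<in>T. b * (of_rat (r E b) * z E))" if "E \<in> I" for E
      unfolding a[OF that] sum_distrib_right by (intro sum.cong) (simp_all add: mult_ac)
    then have "(\<Sum>E\<in>I. a E * z E) = (\<Sum>E\<in>I. \<Sum>b\<in>T. b * (of_rat (r E b) * z E))"
      by (intro sum.cong) simp_all
    also have "\<dots> = (\<Sum>b\<in>T. \<Sum>E\<in>I. b * (of_rat (r E b) * z E))" by (rule sum.swap)
    finally show ?thesis by (simp add: sum_distrib_left)
  qed
  have "(\<Sum>E\<in>I. of_rat (r E b) * y E) = 0" if b: "b \<in> T" for b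
  proof -
    \<comment> \<open>The rational independence of \<open>B\<close> splits a complex relation into
      one rational relation for each basis vector b.\<close>
    have rel': "(\<Sum>E\<in>I. r E b * of_int (x F E)) = 0" if F: "F \<in> S" for F
    proof -
      have "(\<Sum>b\<in>T. of_rat (\<Sum>E\<in>I. r E b * of_int (x F E)) * b) = 0"
        using rel[OF F] unfolding comb by (simp add: of_rat_sum of_rat_mult mult.commute)
      then show ?thesis
        using q.independentD[OF q.independent_mono[OF B(1) TB] T subset_refl _ b, of "\<lambda>b. \<Sum>E\<in>I. r E b * of_int (x F E)"] by simp
    qed
    \<comment> \<open>The product of the denominators makes the rational coefficients integral, so
      that the assumption on integral relations applies.\<close>
    define d where "d = (\<Prod>E\<in>I. snd (quotient_of (r E b)))"
    have d: "d > 0" unfolding d_def by (intro prod_pos) (simp add: quotient_of_denom_pos')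
    have "\<exists>m::int. of_int m = of_int d * r E b" if "E \<in> I" for E
    proof -
      obtain p q where pq: "quotient_of (r E b) = (p, q)" by force
      have "q dvd d" unfolding d_def using that I pq by (metis dvd_prodI snd_conv)
      then obtain k where k: "d = q * k" by auto
      have "q > 0" using quotient_of_denom_pos[OF pq] .
      then have "of_int d * r E b = of_int (k * p)" using quotient_of_div[OF pq] k by simp
      then show ?thesis by metis
    qed
    then obtain m :: "'e \<Rightarrow> int" where m: "\<And>E. E \<in> I \<Longrightarrow> of_int (m E) = of_int d * r E b" by metis
    have "(\<Sum>E\<in>I. m E * x F E) = 0" if F: "F \<in> S" for F
    proof -
      have "of_int (\<Sum>E\<in>I. m E * x F E) = (\<Sum>E\<in>I. of_int d * r E b * of_int (x F E))"
        using m by (simp add: of_int_sum)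
      also have "\<dots> = of_int d * (\<Sum>E\<in>I. r E b * of_int (x F E))" by (simp add: sum_distrib_left mult.assoc)
      also have "\<dots> = 0" using rel'[OF F] by simp
      finally show ?thesis by (simp only: of_int_eq_0_iff)
    qed
    then have "(\<Sum>E\<in>I. of_int (m E) * y E) = 0" using y by blast
    moreover have "(of_int (m E) :: complex) = of_int d * of_rat (r E b)" if "E \<in> I" for E
      using arg_cong[OF m[OF that], of "of_rat :: rat \<Rightarrow> complex"] by (simp add: of_rat_mult)
    ultimately have "of_int d * (\<Sum>E\<in>I. of_rat (r E b) * y E) = 0" by (simp add: sum_distrib_left mult.assoc)
    then show ?thesis using d by simp
  qed
  then show ?thesis unfolding comb by (simp add: sum.neutral)
qed

subsection \<open>Classes of objects\<close>

definition cls :: "('k::field, 'o, 'm::ab_group_add) tricat \<Rightarrow> 'o \<Rightarrow> 'o num_vec" where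
  "cls C E = tensor_one (N_group C) (N_class C E)"

text \<open>\<Phi> respects numerical equivalence, which is what makes the map on numerical classes
  well defined.\<close>

definition num_compat ::
  "('k::field, 'o1, 'm1::ab_group_add) tricat \<Rightarrow> ('k, 'o2, 'm2::ab_group_add) tricat \<Rightarrow>
   ('o1, 'm1, 'o2, 'm2) fnct \<Rightarrow> bool"
where
  "num_compat C D \<Phi> \<longleftrightarrow> (\<forall>E\<in>Ob C. \<forall>E'\<in>Ob C.
     (\<forall>F\<in>Ob C. euler_form C E F = euler_form C E' F) \<longrightarrow>
     (\<forall>F\<in>Ob D. euler_form D (fob \<Phi> E) F = euler_form D (fob \<Phi> E') F))"

context numerical
begin

lemma N_complex_span: "N_complex C = cv.span (cls C ` Ob C)"
  unfolding N_complex_def tensor_complex_def carrier_N cls_def by (rule arg_cong[of _ _ cv.span]) auto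

lemma N_complex_subspace: "cv.subspace (N_complex C)"
  unfolding N_complex_span by simp

lemma cls_in: "E \<in> Ob C \<Longrightarrow> cls C E \<in> N_complex C"
  unfolding N_complex_span by (rule cv.span_base) simp

lemma N_complex_sum:
  assumes "w \<in> N_complex C"
  obtains I a where "finite I" "I \<subseteq> Ob C" "w = (\<Sum>E\<in>I. cscale (a E) (cls C E))"
proof -
  obtain t r where t: "finite t" "t \<subseteq> cls C ` Ob C" "w = (\<Sum>a\<in>t. cscale (r a) a)"
    using assms unfolding N_complex_span cv.span_explicit by blast
  obtain I where I: "I \<subseteq> Ob C" "inj_on (cls C) I" "t = cls C ` I"
    using t(2) subset_image_inj[of t "cls C" "Ob C"] by blast
  then have "finite I" using t(1) finite_image_iff by blast
  moreover have "w = (\<Sum>E\<in>I. cscale (r (cls C E)) (cls C E))"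
    unfolding t(3) I(3) using sum.reindex[OF I(2)] by simp
  ultimately show ?thesis using that[of I "\<lambda>E. r (cls C E)"] I(1) by blast
qed

lemma cls_apply: "additive_on (N_group C) \<phi> \<Longrightarrow> cls C E \<phi> = \<phi> (N_class C E)"
  unfolding cls_def tensor_one_def by simp

lemma cls_extension:
  assumes "extension C X Y Z" shows "cls C Y = cls C X + cls C Z"
proof
  fix \<phi> show "cls C Y \<phi> = (cls C X + cls C Z) \<phi>"
    using additive_on_extension[OF _ assms, of \<phi>] unfolding cls_def tensor_one_def by simp
qed

text \<open>The form \<chi>(-, F) as a function of numerical classes, at which elements of
  \<open>N_complex C\<close> can be evaluated. \<open>N_class_eq_iff\<close> makes the choice of
  representative irrelevant.\<close>

definition chi_fun :: "'b \<Rightarrow> ('b \<Rightarrow>\<^sub>0 int) set set \<Rightarrow> complex" where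
  "chi_fun F x = of_int (euler_form C (SOME E. E \<in> Ob C \<and> N_class C E = x) F)"

lemma chi_fun_N_class:
  assumes "E \<in> Ob C" "F \<in> Ob C" shows "chi_fun F (N_class C E) = of_int (euler_form C E F)"
proof -
  let ?E = "SOME E'. E' \<in> Ob C \<and> N_class C E' = N_class C E"
  have "?E \<in> Ob C \<and> N_class C ?E = N_class C E"
    by (rule someI[of "\<lambda>E'. E' \<in> Ob C \<and> N_class C E' = N_class C E" E]) (use assms in simp)
  then show ?thesis unfolding chi_fun_def using N_class_eq_iff[of ?E E] assms by simp
qed

lemma chi_fun_additive: assumes "F \<in> Ob C" shows "additive_on (N_group C) (chi_fun F)"
  unfolding additive_on_def carrier_N
proof (intro ballI)
  fix x y assume "x \<in> {N_class C E |E. E \<in> Ob C}" "y \<in> {N_class C E |E. E \<in> Ob C}"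
  then obtain E E' where E: "E \<in> Ob C" "x = N_class C E" "E' \<in> Ob C" "y = N_class C E'" by blast
  obtain S where "direct_sum C E E' S" using ex_direct_sum[OF E(1,3)] by blast
  then have S: "extension C E S E'" using direct_sum_extension E by blast
  then have "S \<in> Ob C" using extension_ob by blast
  then show "chi_fun F (x \<otimes>\<^bsub>N_group C\<^esub> y) = chi_fun F x + chi_fun F y"
    using N_class_extension[OF S, symmetric] chi_fun_N_class assms E euler_additive[OF S assms] by simp
qed

lemma cls_chi_fun: "\<lbrakk>E \<in> Ob C; F \<in> Ob C\<rbrakk> \<Longrightarrow> cls C E (chi_fun F) = of_int (euler_form C E F)"
  using cls_apply[OF chi_fun_additive] chi_fun_N_class by simp

text \<open>By \<open>rational_relations\<close>, a complex relation between Euler forms reduces to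
  integral ones. These are realised by numerically trivial objects, on which every additive map
  vanishes.\<close>

lemma chi_fun_separates:
  assumes w: "w \<in> N_complex C" and 0: "\<And>F. F \<in> Ob C \<Longrightarrow> w (chi_fun F) = 0"
  shows "w = 0"
proof -
  obtain I a where I: "finite I" "I \<subseteq> Ob C" "w = (\<Sum>E\<in>I. cscale (a E) (cls C E))" using N_complex_sum[OF w] .
  have wa: "w \<phi> = (\<Sum>E\<in>I. a E * cls C E \<phi>)" for \<phi> unfolding I(3) sum_apply pointwise_def by simp
  have "w \<phi> = 0" for \<phi>
  proof (cases "additive_on (N_group C) \<phi>")
    case False
    then show ?thesis unfolding wa cls_def tensor_one_def by simp
  next
    case True
    have "(\<Sum>E\<in>I. a E * \<phi> (N_class C E)) = 0"
    proof (rule rational_relations[OF I(1), of "Ob C" a "\<lambda>F E. euler_form C E F"])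
      fix F assume F: "F \<in> Ob C"
      have "w (chi_fun F) = (\<Sum>E\<in>I. a E * of_int (euler_form C E F))"
        unfolding wa using cls_chi_fun[OF _ F] I(2) by (intro sum.cong) auto
      then show "(\<Sum>E\<in>I. a E * of_int (euler_form C E F)) = 0" using 0[OF F] by simp
    next
      fix m :: "'b \<Rightarrow> int" assume m: "\<And>F. F \<in> Ob C \<Longrightarrow> (\<Sum>E\<in>I. m E * euler_form C E F) = 0"
      obtain X where X: "X \<in> Ob C" "\<forall>F\<in>Ob C. euler_form C X F = (\<Sum>E\<in>I. m E * euler_form C E F)"
        "\<phi> (N_class C X) = (\<Sum>E\<in>I. of_int (m E) * \<phi> (N_class C E))"
        using int_combination[OF I(1,2), of m] True by blast
      then show "(\<Sum>E\<in>I. of_int (m E) * \<phi> (N_class C E)) = 0"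
        using additive_on_trivial[OF X(1) _ True] m by simp
    qed
    then show ?thesis unfolding wa using cls_apply[OF True] by simp
  qed
  then show ?thesis by (simp add: fun_eq_iff)
qed

text \<open>A positive multiple of every class lies in the subgroup generated by F, and over
  \<complex> one can divide by that multiple.\<close>

lemma N_complex_fin_dim:
  assumes "finite_rank (N_group C)" shows "fin_dim cscale (N_complex C)"
proof -
  obtain F where F: "finite F" "F \<subseteq> carrier (N_group C)"
    "\<forall>x\<in>carrier (N_group C). \<exists>m::nat. m > 0 \<and> x [^]\<^bsub>N_group C\<^esub> m \<in> generate (N_group C) F"
    using assms unfolding finite_rank_def by blast
  interpret N: comm_group "N_group C" by (rule comm_N)
  let ?t = "tensor_one (N_group C)"
  have mult: "?t (x \<otimes>\<^bsub>N_group C\<^esub> y) = ?t x + ?t y" if "x \<in> carrier (N_group C)" "y \<in> carrier (N_group C)" for x y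
    using that unfolding tensor_one_def additive_on_def by (auto simp: fun_eq_iff)
  have t_one: "?t \<one>\<^bsub>N_group C\<^esub> = 0" using mult[of "\<one>\<^bsub>N_group C\<^esub>" "\<one>\<^bsub>N_group C\<^esub>"] by simp
  have t_inv: "?t (inv\<^bsub>N_group C\<^esub> x) = - ?t x" if "x \<in> carrier (N_group C)" for x
    using mult[OF that N.inv_closed[OF that]] t_one that by (simp add: eq_neg_iff_add_eq_0 add.commute)
  have gen: "?t x \<in> cv.span (?t ` F)" if "x \<in> generate (N_group C) F" for x
    using that
  proof (induction rule: generate.induct)
    case (inv h)
    then have "?t (inv\<^bsub>N_group C\<^esub> h) = - ?t h" using t_inv F(2) by auto
    then show ?case using cv.span_neg[OF cv.span_base[OF imageI[OF inv]]] by metis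
  next
    case one
    show ?case unfolding t_one by (rule cv.span_zero)
  next
    case (incl h)
    then show ?case by (intro cv.span_base imageI)
  next
    case (eng h1 h2)
    then show ?case using mult N.generate_in_carrier[OF F(2)] cv.span_add by metis
  qed
  have pow: "?t (x [^]\<^bsub>N_group C\<^esub> m) = cscale (of_nat m) (?t x)" if "x \<in> carrier (N_group C)" for x and m :: nat
  proof (induction m)
    case 0
    then show ?case using t_one by simp
  next
    case (Suc m)
    have "x [^]\<^bsub>N_group C\<^esub> Suc m = x [^]\<^bsub>N_group C\<^esub> m \<otimes>\<^bsub>N_group C\<^esub> x" by simp
    then show ?case using mult[OF N.nat_pow_closed[OF that] that, of m] Suc
      by (simp add: cv.scale_left_distrib add.commute)
  qed
  have "?t x \<in> cv.span (?t ` F)" if x: "x \<in> carrier (N_group C)" for x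
  proof -
    obtain m :: nat where m: "m > 0" "x [^]\<^bsub>N_group C\<^esub> m \<in> generate (N_group C) F" using F(3) x by blast
    have "cscale (1 / of_nat m) (?t (x [^]\<^bsub>N_group C\<^esub> m)) \<in> cv.span (?t ` F)"
      using cv.span_scale[OF gen[OF m(2)]] .
    also have "cscale (1 / of_nat m) (?t (x [^]\<^bsub>N_group C\<^esub> m)) = ?t x" using pow[OF x] m(1) by simp
    finally show ?thesis .
  qed
  then have "N_complex C \<subseteq> cv.span (?t ` F)"
    unfolding N_complex_def tensor_complex_def by (intro cv.span_minimal) auto
  then show ?thesis unfolding fin_dim_def using F(1) by blast
qed

end

subsection \<open>Induced linear maps\<close>

locale numerical_functor = C: numerical C + D: numerical D
  for C :: "('k::field, 'o1, 'm1::ab_group_add) tricat" and D :: "('k, 'o2, 'm2::ab_group_add) tricat" +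
  fixes \<Phi> :: "('o1, 'm1, 'o2, 'm2) fnct"
  assumes exact: "exact_functor C D \<Phi>" and compat: "num_compat C D \<Phi>"
begin

lemma ob: "E \<in> Ob C \<Longrightarrow> fob \<Phi> E \<in> Ob D"
  using lin_functor_ob[OF exact_functor_lin[OF exact]] .

text \<open>\<psi> composed with the map that \<Phi> induces on classes; \<open>compat\<close> makes
  the choice of representative harmless.\<close>

definition pullback :: "(('o2 \<Rightarrow>\<^sub>0 int) set set \<Rightarrow> complex) \<Rightarrow> ('o1 \<Rightarrow>\<^sub>0 int) set set \<Rightarrow> complex" where
  "pullback \<psi> x = \<psi> (N_class D (fob \<Phi> (SOME E. E \<in> Ob C \<and> N_class C E = x)))"

lemma pullback_N_class:
  assumes "E \<in> Ob C" shows "pullback \<psi> (N_class C E) = \<psi> (N_class D (fob \<Phi> E))"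
proof -
  let ?E = "SOME E'. E' \<in> Ob C \<and> N_class C E' = N_class C E"
  have E: "?E \<in> Ob C \<and> N_class C ?E = N_class C E"
    by (rule someI[of "\<lambda>E'. E' \<in> Ob C \<and> N_class C E' = N_class C E" E]) (use assms in simp)
  then have "\<forall>F\<in>Ob C. euler_form C ?E F = euler_form C E F" using C.N_class_eq_iff[of ?E E] assms by blast
  then have "\<forall>F\<in>Ob D. euler_form D (fob \<Phi> ?E) F = euler_form D (fob \<Phi> E) F"
    using compat E assms unfolding num_compat_def by blast
  then have "N_class D (fob \<Phi> ?E) = N_class D (fob \<Phi> E)" using D.N_class_eq_iff[OF ob ob] E assms by blast
  then show ?thesis unfolding pullback_def by simp
qed

lemma pullback_additive:
  assumes "additive_on (N_group D) \<psi>" shows "additive_on (N_group C) (pullback \<psi>)"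
  unfolding additive_on_def C.carrier_N
proof (intro ballI)
  fix x y assume "x \<in> {N_class C E |E. E \<in> Ob C}" "y \<in> {N_class C E |E. E \<in> Ob C}"
  then obtain E E' where E: "E \<in> Ob C" "x = N_class C E" "E' \<in> Ob C" "y = N_class C E'" by blast
  obtain S where "direct_sum C E E' S" using C.ex_direct_sum[OF E(1,3)] by blast
  then have S: "extension C E S E'" using C.direct_sum_extension E by blast
  then have "S \<in> Ob C" using C.extension_ob by blast
  then show "pullback \<psi> (x \<otimes>\<^bsub>N_group C\<^esub> y) = pullback \<psi> x + pullback \<psi> y"
    using C.N_class_extension[OF S, symmetric] pullback_N_class E
      D.additive_on_extension[OF assms exact_functor_extension[OF exact S]] by simp
qed

text \<open>Vectors are functionals on additive maps, so \<Phi> acts by the transpose of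
  \<open>pullback\<close>. The default 0 matches \<open>tensor_one\<close>, and
  \<open>undefined\<close> matches the extensionality demanded in \<open>N_map\<close>.\<close>

definition push :: "'o1 num_vec \<Rightarrow> 'o2 num_vec" where
  "push w = (if w \<in> N_complex C then (\<lambda>\<psi>. if additive_on (N_group D) \<psi> then w (pullback \<psi>) else 0) else undefined)"

lemma push_cls: "E \<in> Ob C \<Longrightarrow> push (cls C E) = cls D (fob \<Phi> E)"
  unfolding push_def using C.cls_in C.cls_apply[OF pullback_additive] pullback_N_class
  by (auto simp: fun_eq_iff cls_def[of D] tensor_one_def)

lemma push_linear: "linear_on_subspace cscale cscale (N_complex C) push"
  unfolding linear_on_subspace_def push_def
  using cv.subspace_add[OF C.N_complex_subspace] cv.subspace_scale[OF C.N_complex_subspace]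
  by (auto simp: fun_eq_iff pointwise_def)

lemma linear_cls_sum:
  assumes "linear_on_subspace cscale cscale (N_complex C) f" "\<And>E. E \<in> Ob C \<Longrightarrow> f (cls C E) = cls D (fob \<Phi> E)"
    and I: "finite I" "I \<subseteq> Ob C"
  shows "f (\<Sum>E\<in>I. cscale (a E) (cls C E)) = (\<Sum>E\<in>I. cscale (a E) (cls D (fob \<Phi> E)))"
proof -
  have "f (\<Sum>E\<in>I. cscale (a E) (cls C E)) = (\<Sum>E\<in>I. cscale (a E) (f (cls C E)))"
    using cv.linear_on_subspace_sum[OF assms(1) C.N_complex_subspace vector_space_cscale I(1), of "cls C" a] C.cls_in I(2) by blast
  also have "\<dots> = (\<Sum>E\<in>I. cscale (a E) (cls D (fob \<Phi> E)))" using assms(2) I(2) by (intro sum.cong) auto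
  finally show ?thesis .
qed

lemma cls_sum_in: "\<lbrakk>finite I; I \<subseteq> Ob C\<rbrakk> \<Longrightarrow> (\<Sum>E\<in>I. cscale (a E) (cls D (fob \<Phi> E))) \<in> N_complex D"
  by (intro cv.subspace_sum[OF D.N_complex_subspace] cv.subspace_scale[OF D.N_complex_subspace] D.cls_in ob) auto

text \<open>Uniqueness holds because the classes span \<open>N_complex C\<close> and extensionality
  fixes the values outside it.\<close>

lemma N_map_eq_push: "N_map C D \<Phi> = push"
  unfolding N_map_def
proof (rule the_equality)
  have "push w \<in> N_complex D" if w: "w \<in> N_complex C" for w
  proof -
    obtain I a where I: "finite I" "I \<subseteq> Ob C" "w = (\<Sum>E\<in>I. cscale (a E) (cls C E))"
      using C.N_complex_sum[OF w] .
    show ?thesis using linear_cls_sum[OF push_linear push_cls I(1,2), of a] cls_sum_in[OF I(1,2), of a] I(3) by simp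
  qed
  then show "push \<in> extensional (N_complex C) \<and> push ` N_complex C \<subseteq> N_complex D \<and>
     linear_on_subspace cscale cscale (N_complex C) push \<and>
     (\<forall>E\<in>Ob C. push (tensor_one (N_group C) (N_class C E)) = tensor_one (N_group D) (N_class D (fob \<Phi> E)))"
    using push_linear push_cls unfolding cls_def by (auto simp: extensional_def push_def)
next
  fix f assume f: "f \<in> extensional (N_complex C) \<and> f ` N_complex C \<subseteq> N_complex D \<and>
     linear_on_subspace cscale cscale (N_complex C) f \<and>
     (\<forall>E\<in>Ob C. f (tensor_one (N_group C) (N_class C E)) = tensor_one (N_group D) (N_class D (fob \<Phi> E)))"
  show "f = push"
  proof
    fix w show "f w = push w"
    proof (cases "w \<in> N_complex C")
      case True
      obtain I a where I: "finite I" "I \<subseteq> Ob C" "w = (\<Sum>E\<in>I. cscale (a E) (cls C E))"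
        using C.N_complex_sum[OF True] .
      have "f (\<Sum>E\<in>I. cscale (a E) (cls C E)) = (\<Sum>E\<in>I. cscale (a E) (cls D (fob \<Phi> E)))"
        by (rule linear_cls_sum[OF _ _ I(1,2)]) (use f in \<open>simp_all add: cls_def\<close>)
      then show ?thesis using linear_cls_sum[OF push_linear push_cls I(1,2), of a] I(3) by simp
    next
      case False
      then show ?thesis using f unfolding extensional_def push_def by simp
    qed
  qed
qed

lemma N_map_linear: "linear_on_subspace cscale cscale (N_complex C) (N_map C D \<Phi>)"
  unfolding N_map_eq_push by (rule push_linear)

lemma N_map_sum: "\<lbrakk>finite I; I \<subseteq> Ob C\<rbrakk> \<Longrightarrow>
    N_map C D \<Phi> (\<Sum>E\<in>I. cscale (a E) (cls C E)) = (\<Sum>E\<in>I. cscale (a E) (cls D (fob \<Phi> E)))"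
  unfolding N_map_eq_push by (rule linear_cls_sum[OF push_linear push_cls])

lemma N_map_in: assumes "w \<in> N_complex C" shows "N_map C D \<Phi> w \<in> N_complex D"
proof -
  obtain I a where I: "finite I" "I \<subseteq> Ob C" "w = (\<Sum>E\<in>I. cscale (a E) (cls C E))"
    using C.N_complex_sum[OF assms] .
  show ?thesis using N_map_sum[OF I(1,2), of a] cls_sum_in[OF I(1,2), of a] I(3) by simp
qed

end

section \<open>Dg enhancements\<close>

context dg_category
begin

lemma module_smul: "module (smul A)"
  using vs by (simp add: module_iff_vector_space)

lemma dif_uminus: "\<lbrakk>X \<in> Ob A; Y \<in> Ob A; f \<in> dHom A X Y n\<rbrakk> \<Longrightarrow> dif A X Y (- f) = - dif A X Y f"
  using linear_on_subspace_simps(2)[OF dif_lin vs vs dhom_subspace] .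

lemma dhom_uminus: "\<lbrakk>X \<in> Ob A; Y \<in> Ob A; f \<in> dHom A X Y n\<rbrakk> \<Longrightarrow> - f \<in> dHom A X Y n"
  using module.subspace_neg[OF module_smul dhom_subspace] .

lemma cmp_diff_right: "\<lbrakk>X \<in> Ob A; Y \<in> Ob A; Z \<in> Ob A; f \<in> dHom A X Y m; f' \<in> dHom A X Y m; g \<in> dHom A Y Z n\<rbrakk>
    \<Longrightarrow> g \<odot> (f - f') = g \<odot> f - g \<odot> f'"
  using linear_on_subspace_simps(3)[OF cmp_lin_right vs vs dhom_subspace] .

lemma cmp_diff_left: "\<lbrakk>X \<in> Ob A; Y \<in> Ob A; Z \<in> Ob A; f \<in> dHom A X Y m; g \<in> dHom A Y Z n; g' \<in> dHom A Y Z n\<rbrakk>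
    \<Longrightarrow> (g - g') \<odot> f = g \<odot> f - g' \<odot> f"
  using linear_on_subspace_simps(3)[OF cmp_lin_left vs vs dhom_subspace] .

lemma cmp_zero_left: "\<lbrakk>X \<in> Ob A; Y \<in> Ob A; Z \<in> Ob A; f \<in> dHom A X Y m\<rbrakk> \<Longrightarrow> 0 \<odot> f = 0"
  using linear_on_subspace_simps(1)[OF cmp_lin_left vs vs dhom_subspace] .

lemma cmp_zero_right: "\<lbrakk>X \<in> Ob A; Y \<in> Ob A; Z \<in> Ob A; g \<in> dHom A Y Z m\<rbrakk> \<Longrightarrow> g \<odot> 0 = 0"
  using linear_on_subspace_simps(1)[OF cmp_lin_right vs vs dhom_subspace] .

lemma cocycles_subspace: assumes "X \<in> Ob A" "Y \<in> Ob A" shows "module.subspace (smul A) (cocycles A X Y n)"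
proof -
  interpret vector_space "smul A" by (rule vs)
  note lin = linear_on_subspace_simps[OF dif_lin[OF assms, of n] vs vs dhom_subspace[OF assms, of n]]
  note sub = dhom_subspace[OF assms, of n]
  show ?thesis unfolding cocycles_def
    by (rule subspaceI) (simp_all add: lin subspace_0[OF sub] subspace_add[OF sub] subspace_scale[OF sub])
qed

lemma coboundaries_subspace: assumes "X \<in> Ob A" "Y \<in> Ob A" shows "module.subspace (smul A) (coboundaries A X Y n)"
  unfolding coboundaries_def by (rule subspace_image_on[OF vs vs dhom_subspace[OF assms] dif_lin[OF assms]])

lemma coboundary_cocycle: "\<lbrakk>X \<in> Ob A; Y \<in> Ob A; f \<in> coboundaries A X Y n\<rbrakk> \<Longrightarrow> f \<in> cocycles A X Y n"
  unfolding coboundaries_def cocycles_def using dif_hom[of X Y _ "n - 1"] dif_dif by auto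

lemma cocycle_cmp:
  assumes "X \<in> Ob A" "Y \<in> Ob A" "Z \<in> Ob A" "f \<in> cocycles A X Y m" "g \<in> cocycles A Y Z n"
  shows "g \<odot> f \<in> cocycles A X Z (n + m)"
  using assms leibniz[OF assms(1-3), of f m g n] cmp_hom[OF assms(1-3), of f m g n]
    cmp_zero_left[OF assms(1-3), of f m] cmp_zero_right[OF assms(1-3), of g n]
  unfolding cocycles_def by simp

lemma coboundary_cmp_left:
  assumes "X \<in> Ob A" "Y \<in> Ob A" "Z \<in> Ob A" "f \<in> cocycles A X Y m" "g \<in> coboundaries A Y Z n"
  shows "g \<odot> f \<in> coboundaries A X Z (n + m)"
proof -
  obtain h where h: "h \<in> dHom A Y Z (n - 1)" "g = dif A Y Z h" using assms(5) unfolding coboundaries_def by auto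
  have f: "f \<in> dHom A X Y m" "dif A X Y f = 0" using assms(4) unfolding cocycles_def by auto
  have "dif A X Z (h \<odot> f) = g \<odot> f"
    using leibniz[OF assms(1-3) f(1) h(1)] f(2) h(2) cmp_zero_right[OF assms(1-3) h(1)] by simp
  moreover have "h \<odot> f \<in> dHom A X Z (n + m - 1)" using cmp_hom[OF assms(1-3) f(1) h(1)] by (simp add: algebra_simps)
  ultimately show ?thesis unfolding coboundaries_def by (metis imageI)
qed

lemma coboundary_cmp_right:
  assumes "X \<in> Ob A" "Y \<in> Ob A" "Z \<in> Ob A" "f \<in> coboundaries A X Y m" "g \<in> cocycles A Y Z n"
  shows "g \<odot> f \<in> coboundaries A X Z (n + m)"
proof -
  obtain h where h: "h \<in> dHom A X Y (m - 1)" "f = dif A X Y h" using assms(4) unfolding coboundaries_def by auto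
  have g: "g \<in> dHom A Y Z n" "dif A Y Z g = 0" using assms(5) unfolding cocycles_def by auto
  have gh: "g \<odot> h \<in> dHom A X Z (n + m - 1)" using cmp_hom[OF assms(1-3) h(1) g(1)] by (simp add: algebra_simps)
  have d: "dif A X Z (g \<odot> h) = ksign n (g \<odot> f)"
    using leibniz[OF assms(1-3) h(1) g(1)] g(2) h(2) cmp_zero_left[OF assms(1-3) h(1)] by simp
  have "g \<odot> f = dif A X Z (ksign n (g \<odot> h))"
    using d dif_uminus[OF assms(1,3) gh] unfolding ksign_def by auto
  moreover have "ksign n (g \<odot> h) \<in> dHom A X Z (n + m - 1)"
    using gh dhom_uminus[OF assms(1,3)] unfolding ksign_def by auto
  ultimately show ?thesis unfolding coboundaries_def by (metis imageI)
qed

lemma idn_cocycle: assumes "X \<in> Ob A" shows "idn A X \<in> cocycles A X X 0"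
proof -
  note i = idn_hom[OF assms]
  have di: "dif A X X (idn A X) \<in> dHom A X X 1" using dif_hom[OF assms assms i] by simp
  \<comment> \<open>The Leibniz rule for the identity composed with itself shows that its
    differential equals twice itself.\<close>
  have "dif A X X (idn A X \<odot> idn A X) = dif A X X (idn A X) \<odot> idn A X + ksign 0 (idn A X \<odot> dif A X X (idn A X))"
    using leibniz[OF assms assms assms i i] .
  then have "dif A X X (idn A X) = 0"
    using cmp_idn_left[OF assms assms i] cmp_idn_left[OF assms assms di] cmp_idn_right[OF assms assms di]
    unfolding ksign_def by simp
  then show ?thesis using i unfolding cocycles_def by simp
qed

lemma dg_shift_trans_aux:
  assumes X: "X \<in> Ob A" "Y \<in> Ob A" "Z \<in> Ob A" and u: "u \<in> cocycles A X Y (- m)" "v \<in> cocycles A Y X m"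
    and u': "u' \<in> cocycles A Y Z (- n)" "v' \<in> cocycles A Z Y n"
    and b: "v \<odot> u - idn A X \<in> coboundaries A X X 0" "v' \<odot> u' - idn A Y \<in> coboundaries A Y Y 0"
  shows "(v \<odot> v') \<odot> (u' \<odot> u) - idn A X \<in> coboundaries A X X 0"
proof -
  have uh: "u \<in> dHom A X Y (- m)" "v \<in> dHom A Y X m" and uh': "u' \<in> dHom A Y Z (- n)" "v' \<in> dHom A Z Y n"
    using u u' unfolding cocycles_def by auto
  note vu' = cmp_hom[OF X(2,3,2) uh'] note vuc = cocycle_cmp[OF X(2,3,2) u']
  have vu'0: "v' \<odot> u' \<in> dHom A Y Y 0" using vu' by simp
  have "v \<odot> ((v' \<odot> u' - idn A Y) \<odot> u) \<in> coboundaries A X X (m + (0 + - m))"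
    by (rule coboundary_cmp_right[OF X(1,2,1) coboundary_cmp_left[OF X(1,2,2) u(1) b(2)] u(2)])
  moreover have "(v' \<odot> u' - idn A Y) \<odot> u = (v' \<odot> u') \<odot> u - u"
    using cmp_diff_left[OF X(1,2,2) uh(1) vu'0 idn_hom[OF X(2)]] cmp_idn_left[OF X(1,2) uh(1)] by simp
  moreover have "v \<odot> ((v' \<odot> u') \<odot> u - u) = v \<odot> ((v' \<odot> u') \<odot> u) - v \<odot> u"
  proof -
    have "(v' \<odot> u') \<odot> u \<in> dHom A X Y (- m)" using cmp_hom[OF X(1,2,2) uh(1) vu'0] by simp
    from cmp_diff_right[OF X(1,2,1) this uh(1) uh(2)] show ?thesis .
  qed
  moreover have "v \<odot> ((v' \<odot> u') \<odot> u) = (v \<odot> v') \<odot> (u' \<odot> u)"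
    using cmp_assoc[OF X(1,2,3,2) uh(1) uh'] cmp_assoc[OF X(1,3,2,1) cmp_hom[OF X(1,2,3) uh(1) uh'(1)] uh'(2) uh(2)] by simp
  ultimately have "(v \<odot> v') \<odot> (u' \<odot> u) - v \<odot> u \<in> coboundaries A X X 0" by simp
  from module.subspace_add[OF module_smul coboundaries_subspace[OF X(1,1)] this b(1)] show ?thesis by simp
qed

lemma dg_shift_trans:
  assumes "dg_shift A m X Y u v" "dg_shift A n Y Z u' v'"
  shows "dg_shift A (m + n) X Z (u' \<odot> u) (v \<odot> v')"
proof -
  have X: "X \<in> Ob A" "Y \<in> Ob A" "Z \<in> Ob A" using assms unfolding dg_shift_def by auto
  have u: "u \<in> cocycles A X Y (- m)" "v \<in> cocycles A Y X m" and u': "u' \<in> cocycles A Y Z (- n)" "v' \<in> cocycles A Z Y n"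
    and b: "v \<odot> u - idn A X \<in> coboundaries A X X 0" "u \<odot> v - idn A Y \<in> coboundaries A Y Y 0"
      "v' \<odot> u' - idn A Y \<in> coboundaries A Y Y 0" "u' \<odot> v' - idn A Z \<in> coboundaries A Z Z 0"
    using assms unfolding dg_shift_def by auto
  have e: "- n + - m = - (m + n)" by simp
  have "u' \<odot> u \<in> cocycles A X Z (- (m + n))" "v \<odot> v' \<in> cocycles A Z X (m + n)"
    using cocycle_cmp[OF X u(1) u'(1), unfolded e] cocycle_cmp[OF X(3,2,1) u'(2) u(2)] by auto
  moreover have "(u' \<odot> u) \<odot> (v \<odot> v') - idn A Z \<in> coboundaries A Z Z 0"
    using dg_shift_trans_aux[OF X(3,2,1), of v' "- n" u' v "- m" u] u u' b by simp
  ultimately show ?thesis unfolding dg_shift_def using X dg_shift_trans_aux[OF X u u' b(1,3)] by simp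
qed

lemma dg_shift_sym: "dg_shift A n X Y u v \<Longrightarrow> dg_shift A (- n) Y X v u"
  unfolding dg_shift_def by simp

end

locale enhanced = D: triangulated_category D
  for A :: "('k::field, 'p, 'l::ab_group_add) dgcat" and E :: "('p, 'l, 'o, 'm::ab_group_add) fnct"
    and D :: "('k, 'o, 'm) tricat" +
  assumes enh: "dg_enhancement A E D"
begin

lemma pretri: "pretriangulated A" using enh unfolding dg_enhancement_def by blast

sublocale dg: dg_category A using pretri unfolding pretriangulated_def by blast

lemma E_ob: "X \<in> Ob A \<Longrightarrow> fob E X \<in> Ob D"
  using enh unfolding dg_enhancement_def by (simp add: image_subset_iff)

lemma E_full: "\<lbrakk>X \<in> Ob A; Y \<in> Ob A\<rbrakk> \<Longrightarrow> fmap E X Y ` cocycles A X Y 0 = Hom D (fob E X) (fob E Y)"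
  and E_lin: "\<lbrakk>X \<in> Ob A; Y \<in> Ob A\<rbrakk> \<Longrightarrow> linear_on_subspace (smul A) (smul D) (cocycles A X Y 0) (fmap E X Y)"
  and E_zero_iff: "\<lbrakk>X \<in> Ob A; Y \<in> Ob A; f \<in> cocycles A X Y 0\<rbrakk> \<Longrightarrow> fmap E X Y f = 0 \<longleftrightarrow> f \<in> coboundaries A X Y 0"
  and E_idn: "X \<in> Ob A \<Longrightarrow> fmap E X X (idn A X) = idn D (fob E X)"
  and E_cmp: "\<lbrakk>X \<in> Ob A; Y \<in> Ob A; Z \<in> Ob A; f \<in> cocycles A X Y 0; g \<in> cocycles A Y Z 0\<rbrakk> \<Longrightarrow>
      fmap E X Z (g \<odot>\<^bsub>A\<^esub> f) = fmap E Y Z g \<odot>\<^bsub>D\<^esub> fmap E X Y f"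
  and E_surj: "V \<in> Ob D \<Longrightarrow> \<exists>X\<in>Ob A. iso_ob D (fob E X) V"
  using enh unfolding dg_enhancement_def by simp_all

lemma E_arr: "\<lbrakk>X \<in> Ob A; Y \<in> Ob A; f \<in> cocycles A X Y 0\<rbrakk> \<Longrightarrow> arr D (fob E X) (fob E Y) (fmap E X Y f)"
  unfolding arr_def using E_ob E_full by blast

lemma E_homotopic:
  assumes "X \<in> Ob A" "Y \<in> Ob A" "f \<in> cocycles A X Y 0" "g \<in> cocycles A X Y 0" "f - g \<in> coboundaries A X Y 0"
  shows "fmap E X Y f = fmap E X Y g"
proof -
  have "fmap E X Y (f - g) = 0"
    using E_zero_iff[OF assms(1,2)] dg.coboundary_cocycle[OF assms(1,2,5)] assms(5) by simp
  then show ?thesis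
    using linear_on_subspace_simps(3)[OF E_lin[OF assms(1,2)] dg.vs D.vs dg.cocycles_subspace[OF assms(1,2)] assms(3,4)] by simp
qed

lemma E_retract:
  assumes "X \<in> Ob A" "Y \<in> Ob A" "i \<in> cocycles A Y X 0" "p \<in> cocycles A X Y 0" "p \<odot>\<^bsub>A\<^esub> i - idn A Y \<in> coboundaries A Y Y 0"
  shows "arr D (fob E Y) (fob E X) (fmap E Y X i)" "arr D (fob E X) (fob E Y) (fmap E X Y p)"
    "fmap E X Y p \<odot>\<^bsub>D\<^esub> fmap E Y X i = idn D (fob E Y)"
proof -
  have "p \<odot>\<^bsub>A\<^esub> i \<in> cocycles A Y Y 0" using dg.cocycle_cmp[OF assms(2,1,2,3,4)] by simp
  then show "fmap E X Y p \<odot>\<^bsub>D\<^esub> fmap E Y X i = idn D (fob E Y)"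
    using E_homotopic[OF assms(2,2) _ dg.idn_cocycle[OF assms(2)] assms(5)] E_cmp[OF assms(2,1,2,3,4)] E_idn[OF assms(2)] by simp
qed (use assms E_arr in auto)

lemma E_dg_shift_zero: assumes "dg_shift A 0 X X' u v" shows "isom D (fob E X) (fob E X')"
proof -
  have *: "X \<in> Ob A" "X' \<in> Ob A" "u \<in> cocycles A X X' 0" "v \<in> cocycles A X' X 0"
     "v \<odot>\<^bsub>A\<^esub> u - idn A X \<in> coboundaries A X X 0" "u \<odot>\<^bsub>A\<^esub> v - idn A X' \<in> coboundaries A X' X' 0"
    using assms unfolding dg_shift_def by auto
  show ?thesis unfolding isom_def using E_retract[OF *(2,1,3,4,5)] E_retract[OF *(1,2,4,3,6)] by metis
qed

lemma E_dg_shift_one: assumes "dg_shift A 1 X X' u v" shows "isom D (fob E X') (sh_ob D 1 (fob E X))"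
proof -
  have "X \<in> Ob A" "X' \<in> Ob A" using assms unfolding dg_shift_def by auto
  moreover have "iso_ob D (fob E X') (sh_ob D 1 (fob E X))"
    using enh assms unfolding dg_enhancement_def iso_ob_def by metis
  ultimately show ?thesis unfolding isom_iff using E_ob D.shift_ob by simp
qed

lemma ex_dg_shift: "X \<in> Ob A \<Longrightarrow> \<exists>X' u v. dg_shift A n X X' u v"
  using pretri unfolding pretriangulated_def by blast

text \<open>\<open>dg_enhancement\<close> compares only shifts by 1. In the induction step X' is
  shifted back inside the dg category to some Y, which is then an n-fold shift of X.\<close>

lemma E_dg_shift_nat: "dg_shift A (int n) X X' u v \<Longrightarrow> isom D (fob E X') (sh_ob D (int n) (fob E X))"
proof (induction n arbitrary: X' u v)
  case 0
  then have "X \<in> Ob A" unfolding dg_shift_def by simp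
  then show ?case using isom_sym[OF E_dg_shift_zero[of X X' u v]] 0 E_ob by (simp add: D.shift_zero)
next
  case (Suc n)
  then have X: "X \<in> Ob A" "X' \<in> Ob A" unfolding dg_shift_def by auto
  obtain Y u' v' where Y: "dg_shift A (- 1) X' Y u' v'" using ex_dg_shift[OF X(2)] by blast
  have "dg_shift A (int n) X Y (u' \<odot>\<^bsub>A\<^esub> u) (v \<odot>\<^bsub>A\<^esub> v')" using dg.dg_shift_trans[OF Suc(2) Y] by simp
  then have "isom D (fob E Y) (sh_ob D (int n) (fob E X))" by (rule Suc(1))
  then have "isom D (sh_ob D 1 (fob E Y)) (sh_ob D (int (Suc n)) (fob E X))"
    using D.shift_isom[of "fob E Y" "sh_ob D (int n) (fob E X)" 1] E_ob[OF X(1)] by (simp add: D.shift_shift)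
  moreover have "isom D (fob E X') (sh_ob D 1 (fob E Y))"
    using E_dg_shift_one[of Y X' v' u'] dg.dg_shift_sym[OF Y] by simp
  ultimately show ?case using D.isom_trans by blast
qed

lemma E_dg_shift: assumes "dg_shift A n X X' u v" shows "isom D (fob E X') (sh_ob D n (fob E X))"
proof (cases "n \<ge> 0")
  case True
  then show ?thesis using E_dg_shift_nat[of "nat n"] assms by simp
next
  case False
  have X: "X \<in> Ob A" "X' \<in> Ob A" using assms unfolding dg_shift_def by auto
  have "isom D (fob E X) (sh_ob D (- n) (fob E X'))"
    using E_dg_shift_nat[of "nat (- n)" X' X v u] dg.dg_shift_sym[OF assms] False by simp
  from isom_sym[OF D.shift_isom[OF this, of n]] show ?thesis
    using E_ob[OF X(2)] by (simp add: D.shift_shift D.shift_zero)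
qed

lemma E_dg_cone:
  assumes "dg_cone A X Y f Z i j" shows "extension D (fob E X) (fob E Y) (fob E Z)"
proof -
  have ob: "X \<in> Ob A" "Y \<in> Ob A" "Z \<in> Ob A" using assms unfolding dg_cone_def by auto
  have "\<forall>W\<in>Ob A. \<forall>n. \<forall>z\<in>cocycles A W Z n. \<exists>x\<in>cocycles A W X (n + 1). \<exists>y\<in>dHom A W Y n.
            dif A W Y y = - (f \<odot>\<^bsub>A\<^esub> x) \<and> j \<odot>\<^bsub>A\<^esub> x + i \<odot>\<^bsub>A\<^esub> y - z \<in> coboundaries A W Z n"
    using assms unfolding dg_cone_def by blast
  \<comment> \<open>The surjectivity clause of \<open>dg_cone\<close>, applied to the identity of Z,
    yields the projection that the enhancement requires.\<close>
  from this[rule_format, OF ob(3) dg.idn_cocycle[OF ob(3)]]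
  obtain p where "dg_cone_proj A X Y f Z i j p" unfolding dg_cone_proj_def by auto
  moreover obtain X' u v where "dg_shift A 1 X X' u v" using ex_dg_shift[OF ob(1)] by blast
  moreover obtain \<theta> where "\<forall>X Y f Z i j p X' u v.
           dg_cone A X Y f Z i j \<and> dg_cone_proj A X Y f Z i j p \<and> dg_shift A 1 X X' u v \<longrightarrow>
           tri D (fob E X) (fob E Y) (fob E Z) (fmap E X Y f) (fmap E Y Z i)
             (\<theta> X X' u \<odot>\<^bsub>D\<^esub> fmap E Z X' (u \<odot>\<^bsub>A\<^esub> p))"
    using enh unfolding dg_enhancement_def by auto
  ultimately show ?thesis using assms unfolding extension_def by blast
qed

lemma dg_lift_isom:
  assumes "dg_lift D A E D A E F P \<phi>" "lin_functor D D F" "X \<in> Ob A"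
  shows "isom D (fob E (fob P X)) (fob F (fob E X))"
proof -
  have "iso_ob D (fob F (fob E X)) (fob E (fob P X))" "fob P X \<in> Ob A"
    using assms unfolding dg_lift_def dg_functor_def iso_ob_def by auto
  then show ?thesis using isom_sym[of D "fob F (fob E X)"] lin_functor_ob[OF assms(2)] E_ob assms(3) unfolding isom_iff by simp
qed

text \<open>On an object in the image of E the triangle is that of a dg cone, transported along the
  lifts of F, G and T; every other object is isomorphic to one of these.\<close>

lemma functorial_cone_extension:
  assumes "functorial_cone D A E F G \<alpha> T" "lin_functor D D F" "lin_functor D D G" "X \<in> Ob D"
  shows "extension D (fob F X) (fob G X) (fob T X)"
proof -
  have T: "lin_functor D D T" using assms(1) unfolding functorial_cone_def by simp
  obtain P \<phi> Q \<psi> a K \<kappa> i j where lift: "dg_lift D A E D A E F P \<phi>" "dg_lift D A E D A E G Q \<psi>"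
    "dg_lift D A E D A E T K \<kappa>"
    and cone: "\<forall>X\<in>Ob A. dg_cone A (fob P X) (fob Q X) (a X) (fob K X) (i X) (j X)"
    using assms(1) unfolding functorial_cone_def by blast
  obtain X' where X': "X' \<in> Ob A" "iso_ob D (fob E X') X" using E_surj[OF assms(4)] by blast
  then have iso: "isom D (fob E X') X" using E_ob assms(4) unfolding isom_iff by simp
  have ext: "extension D (fob E (fob P X')) (fob E (fob Q X')) (fob E (fob K X'))" using E_dg_cone cone X'(1) by blast
  show ?thesis
    by (rule D.extension_isom[OF ext];
        rule D.isom_trans[OF dg_lift_isom[OF _ _ X'(1)] lin_functor_isom[OF _ iso]]) (fact lift assms T)+
qed

text \<open>\<open>W n\<close> is a finite-dimensional space mapping onto the degree n cohomology of
  the endomorphisms of G. Composition with \<open>u\<close> carries this cohomology onto the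
  morphisms from E G to E X, where X models the n-fold shift of G.\<close>

lemma hom_finite_endo:
  assumes G: "G \<in> Ob A" and s: "vector_space s"
    and W: "\<And>n. module.subspace s (W n)" "\<And>n. fin_dim s (W n)" "finite {n. W n \<noteq> {0}}"
    and L: "\<And>n. linear_on_subspace s (smul A) (W n) (L n)" "\<And>n. L n ` W n \<subseteq> cocycles A G G n"
    and surj: "\<And>n g. g \<in> cocycles A G G n \<Longrightarrow> \<exists>w\<in>W n. g - L n w \<in> coboundaries A G G n"
  shows "hom_finite D (fob E G) (fob E G)"
proof -
  have G': "fob E G \<in> Ob D" using E_ob[OF G] .
  have key: "fin_dim (smul D) (Hom D (fob E G) (sh_ob D n (fob E G))) \<and>
      (W n = {0} \<longrightarrow> hom_dim D (fob E G) (sh_ob D n (fob E G)) = 0)" for n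
  proof -
    obtain X u v where X: "dg_shift A n G X u v" using ex_dg_shift[OF G] by blast
    have uv: "X \<in> Ob A" "u \<in> cocycles A G X (- n)" "v \<in> cocycles A X G n"
      "u \<odot>\<^bsub>A\<^esub> v - idn A X \<in> coboundaries A X X 0" using X unfolding dg_shift_def by auto
    have uh: "u \<in> dHom A G X (- n)" "v \<in> dHom A X G n" using uv unfolding cocycles_def by auto
    define \<Theta> where "\<Theta> g = fmap E G X (u \<odot>\<^bsub>A\<^esub> g)" for g
    have ug: "u \<odot>\<^bsub>A\<^esub> g \<in> cocycles A G X 0" if "g \<in> cocycles A G G n" for g
      using dg.cocycle_cmp[OF G G uv(1) that uv(2)] by simp
    have \<Theta>_eq: "\<Theta> g = \<Theta> g'" if "g \<in> cocycles A G G n" "g' \<in> cocycles A G G n" "g - g' \<in> coboundaries A G G n" for g g'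
    proof -
      have "u \<odot>\<^bsub>A\<^esub> g - u \<odot>\<^bsub>A\<^esub> g' = u \<odot>\<^bsub>A\<^esub> (g - g')"
        using dg.cmp_diff_right[OF G G uv(1) _ _ uh(1), of g n g'] that unfolding cocycles_def by simp
      then have "u \<odot>\<^bsub>A\<^esub> g - u \<odot>\<^bsub>A\<^esub> g' \<in> coboundaries A G X 0"
        using dg.coboundary_cmp_right[OF G G uv(1) that(3) uv(2)] by simp
      then show ?thesis unfolding \<Theta>_def using E_homotopic[OF G uv(1) ug ug] that by blast
    qed
    have hom: "Hom D (fob E G) (fob E X) = (\<lambda>w. \<Theta> (L n w)) ` W n"
    proof (intro equalityI subsetI)
      fix a assume "a \<in> Hom D (fob E G) (fob E X)"
      then obtain f where f: "f \<in> cocycles A G X 0" "a = fmap E G X f" using E_full[OF G uv(1)] by blast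
      have fh: "f \<in> dHom A G X 0" using f(1) unfolding cocycles_def by simp
      have vf: "v \<odot>\<^bsub>A\<^esub> f \<in> cocycles A G G n" using dg.cocycle_cmp[OF G uv(1) G f(1) uv(3)] by simp
      have uvh: "u \<odot>\<^bsub>A\<^esub> v \<in> dHom A X X 0" using dg.cmp_hom[OF uv(1) G uv(1) uh(2,1)] by simp
      have "(u \<odot>\<^bsub>A\<^esub> v - idn A X) \<odot>\<^bsub>A\<^esub> f \<in> coboundaries A G X 0"
        using dg.coboundary_cmp_left[OF G uv(1,1) f(1) uv(4)] by simp
      also have "(u \<odot>\<^bsub>A\<^esub> v - idn A X) \<odot>\<^bsub>A\<^esub> f = u \<odot>\<^bsub>A\<^esub> (v \<odot>\<^bsub>A\<^esub> f) - f"
        using dg.cmp_diff_left[OF G uv(1,1) fh uvh dg.idn_hom[OF uv(1)]] dg.cmp_idn_left[OF G uv(1) fh]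
          dg.cmp_assoc[OF G uv(1) G uv(1) fh uh(2,1)] by simp
      finally have "\<Theta> (v \<odot>\<^bsub>A\<^esub> f) = a" unfolding \<Theta>_def f(2) by (rule E_homotopic[OF G uv(1) ug[OF vf] f(1)])
      moreover obtain w where "w \<in> W n" "v \<odot>\<^bsub>A\<^esub> f - L n w \<in> coboundaries A G G n" using surj[OF vf] by blast
      ultimately show "a \<in> (\<lambda>w. \<Theta> (L n w)) ` W n" using \<Theta>_eq[OF vf] L(2)[of n] by blast
    next
      fix a assume "a \<in> (\<lambda>w. \<Theta> (L n w)) ` W n"
      then obtain w where "w \<in> W n" "a = \<Theta> (L n w)" by blast
      then show "a \<in> Hom D (fob E G) (fob E X)"
        unfolding \<Theta>_def using E_arr[OF G uv(1) ug] L(2)[of n] unfolding arr_def by blast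
    qed
    have lin: "linear_on_subspace s (smul D) (W n) (\<lambda>w. \<Theta> (L n w))"
    proof -
      have Lh: "L n w \<in> dHom A G G n" "u \<odot>\<^bsub>A\<^esub> L n w \<in> cocycles A G X 0" if "w \<in> W n" for w
        using L(2)[of n] that ug unfolding cocycles_def by auto
      show ?thesis
        using L(1)[of n] dg.cmp_lin_right[OF G G uv(1) uh(1), of n] E_lin[OF G uv(1)] Lh
        unfolding linear_on_subspace_def \<Theta>_def by simp
    qed
    have fd: "fin_dim (smul D) (Hom D (fob E G) (fob E X))"
      unfolding hom by (rule fin_dim_image[OF s D.vs W(1) lin W(2)])
    have zero: "Hom D (fob E G) (fob E X) = {0}" if "W n = {0}"
      unfolding hom that using linear_on_subspace_simps(1)[OF lin s D.vs W(1)] by simp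
    have r: "retract D (sh_ob D n (fob E G)) (fob E X)" using isom_retract[OF isom_sym[OF E_dg_shift[OF X]]] .
    have "hom_dim D (fob E G) (fob E X) = 0" if "W n = {0}"
      using dim_zero_iff[OF D.vs D.hom_subspace[OF G' E_ob[OF uv(1)]] fd] zero[OF that] by simp
    note zero_dim = this
    note rh = D.retract_hom_right[OF r G' fd]
    have "hom_dim D (fob E G) (sh_ob D n (fob E G)) = 0" if "W n = {0}"
      using rh(2) zero_dim[OF that] by linarith
    then show ?thesis using rh(1) by simp
  qed
  have "{n. ext_dim D (fob E G) (fob E G) n \<noteq> 0} \<subseteq> {n. W n \<noteq> {0}}" using key by auto
  from finite_subset[OF this W(3)] show ?thesis using D.hom_finiteI[OF G' G'] key by simp
qed

end

text \<open>The operations generating \<open>dg_thick\<close> correspond under E to those generating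
  \<open>thick_closure\<close>, so the image of G generates; the work lies in moving between M and
  its restriction to fewer objects.\<close>

lemma dg_thick_enhanced:
  assumes tc: "triangulated_category D" and enh: "dg_enhancement (M\<lparr>Ob := dg_thick M G\<rparr>) E D"
  shows "G \<in> dg_thick M G" "split_generator D (fob E G)"
proof -
  let ?P = "M\<lparr>Ob := dg_thick M G\<rparr>"
  interpret D: triangulated_category D by fact
  interpret P: enhanced ?P E D by unfold_locales fact
  have obP: "Ob ?P = dg_thick M G" by simp
  \<comment> \<open>The zero object of D shows that the thick closure is inhabited, and this is
    possible only if G is an object of M.\<close>
  obtain Z where "zero_ob D Z" using D.ex_zero by blast
  then obtain X0 where "X0 \<in> dg_thick M G" using P.E_surj unfolding zero_ob_def by auto
  then have "G \<in> Ob M" by (induction rule: dg_thick.induct) auto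
  then show G: "G \<in> dg_thick M G" by (rule dg_thick.gen)
  have EG: "fob E G \<in> Ob D" using P.E_ob G by simp
  have cc: "cocycles ?P = cocycles M" "coboundaries ?P = coboundaries M"
    by (intro ext; simp add: cocycles_def coboundaries_def)+
  have thick: "fob E X \<in> thick_closure D (fob E G)" if "X \<in> dg_thick M G" for X
    using that
  proof (induction rule: dg_thick.induct)
    case gen
    show ?case by (rule thick_closure.gen[OF EG])
  next
    case (shift X n X' u v)
    have X': "X' \<in> dg_thick M G" using dg_thick.shift[OF shift(1,2)] .
    have "dg_shift ?P n X X' u v" using shift(1,2) X' unfolding dg_shift_def cc by simp
    from isom_sym[OF P.E_dg_shift[OF this]] show ?case
      using thick_closure.iso[OF thick_closure.shift[OF shift(3)]] unfolding isom_iff by blast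
  next
    case (cone X Y f Z i j)
    have Z: "Z \<in> dg_thick M G" using dg_thick.cone[OF cone(1-3)] .
    \<comment> \<open>The universal property in \<open>dg_cone\<close> quantifies over test objects
      W, so it survives the restriction to a subset of them.\<close>
    have sub: "dg_thick M G \<subseteq> Ob M"
    proof
      fix X assume "X \<in> dg_thick M G"
      then show "X \<in> Ob M" by (induction rule: dg_thick.induct) (auto simp: dg_shift_def dg_cone_def)
    qed
    have "dg_cone ?P X Y f Z i j"
      using cone(1-3) Z sub unfolding dg_cone_def cc by (simp add: subset_iff)
    from P.E_dg_cone[OF this] show ?case
      using thick_closure.cone[OF cone(4,5)] unfolding extension_def by blast
  next
    case (retract X Y i p)
    have Y: "Y \<in> dg_thick M G" using dg_thick.retract[OF retract(1-5)] .
    have "retract D (fob E Y) (fob E X)"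
      unfolding retract_def using P.E_retract[of X Y i p] retract(1,3,4,5) Y unfolding cc by auto
    then obtain W where "W \<in> Ob D" "direct_sum D (fob E Y) W (fob E X)" by (rule D.retract_direct_sum)
    then show ?case using thick_closure.summand[OF retract(6)] P.E_ob Y by simp
  qed
  have "Y \<in> thick_closure D (fob E G)" if Y: "Y \<in> Ob D" for Y
  proof -
    obtain X where "X \<in> dg_thick M G" "iso_ob D (fob E X) Y" using P.E_surj[OF Y] by auto
    then show ?thesis using thick_closure.iso[OF thick _ _] Y by blast
  qed
  then show "split_generator D (fob E G)"
    unfolding split_generator_def using EG D.thick_closure_ob by blast
qed

section \<open>Perfect derived categories of proper dg algebras\<close>

context dg_algebra
begin

lemma module_ascale: "module (ascale A)"
  using vs by (simp add: module_iff_vector_space)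

lemma adif_simps: "adif A 0 = 0" "adif A (x + y) = adif A x + adif A y" "adif A (x - y) = adif A x - adif A y"
  "adif A (ascale A c x) = ascale A c (adif A x)"
proof -
  interpret V: vector_space "ascale A" by (rule vs)
  note l = linear_on_subspace_simps[OF d_lin vs vs V.subspace_UNIV]
  show "adif A 0 = 0" "adif A (x + y) = adif A x + adif A y" "adif A (x - y) = adif A x - adif A y"
    "adif A (ascale A c x) = ascale A c (adif A x)" by (simp_all add: l)
qed

lemma agr_simps: "0 \<in> agr A n" "\<lbrakk>x \<in> agr A n; y \<in> agr A n\<rbrakk> \<Longrightarrow> x + y \<in> agr A n"
  "\<lbrakk>x \<in> agr A n; y \<in> agr A n\<rbrakk> \<Longrightarrow> x - y \<in> agr A n" "x \<in> agr A n \<Longrightarrow> ascale A c x \<in> agr A n"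
  using module.subspace_0[OF module_ascale gr_subspace] module.subspace_add[OF module_ascale gr_subspace]
    module.subspace_diff[OF module_ascale gr_subspace] module.subspace_scale[OF module_ascale gr_subspace] by auto

text \<open>The finite set F provided by properness may contain inhomogeneous elements, so its span
  is cut down to the cocycles of degree n.\<close>

definition cocycle_part :: "'a set \<Rightarrow> int \<Rightarrow> 'a set" where
  "cocycle_part F n = {w \<in> module.span (ascale A) F. w \<in> agr A n \<and> adif A w = 0}"

lemma cocycle_part_subspace: "module.subspace (ascale A) (cocycle_part F n)"
proof -
  interpret V: vector_space "ascale A" by (rule vs)
  show ?thesis unfolding cocycle_part_def
    by (rule V.subspaceI) (auto simp: agr_simps adif_simps V.span_zero V.span_add V.span_scale)
qed

lemma cocycle_part_fin_dim: "finite F \<Longrightarrow> fin_dim (ascale A) (cocycle_part F n)"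
  unfolding fin_dim_def cocycle_part_def by blast

text \<open>The finitely many elements of F have components in finitely many degrees S only, and
  their span has no homogeneous elements of other degrees except 0.\<close>

lemma cocycle_part_finite: assumes F: "finite F" shows "finite {n. cocycle_part F n \<noteq> {0}}"
proof -
  interpret V: vector_space "ascale A" by (rule vs)
  have "\<forall>x. \<exists>c. finite {n. c n \<noteq> 0} \<and> (\<forall>n. c n \<in> agr A n) \<and> x = (\<Sum>n | c n \<noteq> 0. c n)"
    using gr_decomp by blast
  then obtain d where d: "\<And>x. finite {n. d x n \<noteq> 0}" "\<And>x n. d x n \<in> agr A n" "\<And>x. x = (\<Sum>n | d x n \<noteq> 0. d x n)"
    by metis
  define S where "S = (\<Union>x\<in>F. {n. d x n \<noteq> 0})"
  have S: "finite S" unfolding S_def using F d(1) by simp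
  define U where "U = {\<Sum>n\<in>S. c n | c. \<forall>n. c n \<in> agr A n}"
  have "V.subspace U"
  proof (rule V.subspaceI)
    show "0 \<in> U" unfolding U_def using agr_simps(1) by (intro CollectI exI[of _ "\<lambda>_. 0"]) simp
    fix x y assume "x \<in> U" "y \<in> U"
    then obtain c c' where "\<forall>n. c n \<in> agr A n" "x = sum c S" "\<forall>n. c' n \<in> agr A n" "y = sum c' S" unfolding U_def by auto
    then show "x + y \<in> U" unfolding U_def using agr_simps(2)
      by (intro CollectI exI[of _ "\<lambda>n. c n + c' n"]) (simp add: sum.distrib)
  next
    fix k x assume "x \<in> U"
    then obtain c where "\<forall>n. c n \<in> agr A n" "x = sum c S" unfolding U_def by auto
    then show "ascale A k x \<in> U" unfolding U_def using agr_simps(4)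
      by (intro CollectI exI[of _ "\<lambda>n. ascale A k (c n)"]) (simp add: V.scale_sum_right)
  qed
  moreover have "F \<subseteq> U"
  proof
    fix x assume x: "x \<in> F"
    have "(\<Sum>n | d x n \<noteq> 0. d x n) = (\<Sum>n\<in>S. d x n)"
      by (rule sum.mono_neutral_left[OF S]) (use x in \<open>auto simp: S_def\<close>)
    then show "x \<in> U" unfolding U_def using d(2,3)[of x] by auto
  qed
  ultimately have span: "V.span F \<subseteq> U" by (rule V.span_minimal[rotated])
  have "cocycle_part F n = {0}" if n: "n \<notin> S" for n
  proof -
    have "w = 0" if w: "w \<in> cocycle_part F n" for w
    proof -
      obtain c where c: "\<forall>n. c n \<in> agr A n" "w = sum c S" using w span unfolding cocycle_part_def U_def by auto
      \<comment> \<open>Two homogeneous decompositions of w, one supported on S and one in degree n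
        alone; their uniqueness forces w = 0.\<close>
      define c1 where "c1 m = (if m \<in> S then c m else 0)" for m
      define c2 where "c2 m = (if m = n then w else 0)" for m
      have s1: "{m. c1 m \<noteq> 0} \<subseteq> S" unfolding c1_def by auto
      have "sum c1 S = w" unfolding c(2) c1_def by simp
      moreover have "(\<Sum>m | c1 m \<noteq> 0. c1 m) = sum c1 S" by (rule sum.mono_neutral_left[OF S s1]) simp
      moreover have "c1 m \<in> agr A m" for m unfolding c1_def using c(1) agr_simps(1) by simp
      ultimately have 1: "finite {m. c1 m \<noteq> 0} \<and> (\<forall>m. c1 m \<in> agr A m) \<and> w = (\<Sum>m | c1 m \<noteq> 0. c1 m)"
        using finite_subset[OF s1 S] by simp
      have s2: "{m. c2 m \<noteq> 0} \<subseteq> {n}" unfolding c2_def by auto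
      have "sum c2 {n} = w" unfolding c2_def by simp
      moreover have "(\<Sum>m | c2 m \<noteq> 0. c2 m) = sum c2 {n}" by (rule sum.mono_neutral_left[OF _ s2]) auto
      moreover have "c2 m \<in> agr A m" for m
        unfolding c2_def using w agr_simps(1) by (simp add: cocycle_part_def)
      ultimately have 2: "finite {m. c2 m \<noteq> 0} \<and> (\<forall>m. c2 m \<in> agr A m) \<and> w = (\<Sum>m | c2 m \<noteq> 0. c2 m)"
        using finite_subset[OF s2] by simp
      have "c1 = c2" using gr_decomp[of w] 1 2 by blast
      then have "c1 n = c2 n" by simp
      then show ?thesis using n unfolding c1_def c2_def by simp
    qed
    moreover have "0 \<in> cocycle_part F n" using V.subspace_0[OF cocycle_part_subspace] .
    ultimately show ?thesis by blast
  qed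
  then have "{n. cocycle_part F n \<noteq> {0}} \<subseteq> S" by blast
  then show ?thesis using S finite_subset by blast
qed

subsection \<open>Endomorphisms of the free module\<close>

abbreviation sA :: "'k \<Rightarrow> (nat \<Rightarrow> 'a) \<Rightarrow> nat \<Rightarrow> 'a" where
  "sA \<equiv> pointwise (ascale A)"

abbreviation free :: "('k, 'a, nat \<Rightarrow> 'a) bimod" where
  "free \<equiv> embed_bimod (regular_module A)"

definition emb :: "'a \<Rightarrow> nat \<Rightarrow> 'a" where
  "emb x = (\<lambda>i. if i = 0 then x else 0)"

lemma free_iff: "x \<in> bgr free n \<longleftrightarrow> (\<exists>a\<in>agr A n. x = emb a)"
  unfolding embed_bimod_def regular_module_def emb_def by (auto simp: fun_eq_iff)

lemma free_simps:
  "emb a \<in> bgr free n \<longleftrightarrow> a \<in> agr A n"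
  "lact free c (emb a) = emb (ascale A c a)" "ract free (emb a) b = emb (a * b)" "bdif free (emb a) = emb (adif A a)"
proof -
  interpret V: vector_space "ascale A" by (rule vs)
  show "emb a \<in> bgr free n \<longleftrightarrow> a \<in> agr A n"
    unfolding embed_bimod_def regular_module_def emb_def by auto
  show "lact free c (emb a) = emb (ascale A c a)" "ract free (emb a) b = emb (a * b)" "bdif free (emb a) = emb (adif A a)"
    unfolding embed_bimod_def regular_module_def emb_def by (auto simp: fun_eq_iff adif_simps)
qed

lemma emb_simps: "emb 0 = 0" "emb (a + b) = emb a + emb b" "emb (a - b) = emb a - emb b" "emb (- a) = - emb a"
  "emb (ascale A c a) = sA c (emb a)" "emb a = emb b \<longleftrightarrow> a = b" "emb (ksign n a) = ksign n (emb a)" "emb a 0 = a"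
proof -
  interpret V: vector_space "ascale A" by (rule vs)
  show "emb 0 = 0" "emb (a + b) = emb a + emb b" "emb (a - b) = emb a - emb b" "emb (- a) = - emb a"
    "emb (ascale A c a) = sA c (emb a)" "emb a = emb b \<longleftrightarrow> a = b" "emb (ksign n a) = ksign n (emb a)" "emb a 0 = a"
    unfolding emb_def pointwise_def ksign_def by (auto simp: fun_eq_iff)
qed

text \<open>The endomorphisms of the free right module are the left multiplications; components in
  wrong degrees and values off the module are 0, as \<open>bimod_hom\<close> demands.\<close>

definition mult_left :: "int \<Rightarrow> 'a \<Rightarrow> int \<Rightarrow> int \<Rightarrow> (nat \<Rightarrow> 'a) \<Rightarrow> (nat \<Rightarrow> 'a)" where
  "mult_left n w = (\<lambda>i j x. if j = i + n \<and> x \<in> bgr free i then emb (w * x 0) else 0)"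

lemma mult_left_emb: "a \<in> agr A i \<Longrightarrow> mult_left n w i j (emb a) = (if j = i + n then emb (w * a) else 0)"
  unfolding mult_left_def by (simp add: free_simps emb_simps)

lemma mult_left_hom:
  assumes w: "w \<in> agr A n" shows "mult_left n w \<in> bimod_hom sA sA ground_dga A free free n"
proof -
  interpret V: vector_space "ascale A" by (rule vs)
  have gr: "w * a \<in> agr A (i + n)" if "a \<in> agr A i" for a i
    using gr_mult[OF w that] by (simp add: add.commute)
  show ?thesis
    unfolding bimod_hom_def
  proof (intro CollectI conjI allI ballI impI)
    fix i j x assume "j \<noteq> i + n \<or> x \<notin> bgr free i"
    then show "mult_left n w i j x = 0" unfolding mult_left_def by auto
  next
    fix i show "mult_left n w i (i + n) ` bgr free i \<subseteq> bgr free (i + n)"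
      by (auto simp: free_iff[of _ i] free_simps mult_left_emb gr)
    show "linear_on_subspace sA sA (bgr free i) (mult_left n w i (i + n))"
      unfolding linear_on_subspace_def
    proof (intro conjI ballI allI)
      fix x y assume "x \<in> bgr free i" "y \<in> bgr free i"
      then obtain a b where ab: "a \<in> agr A i" "x = emb a" "b \<in> agr A i" "y = emb b" by (auto simp: free_iff)
      show "mult_left n w i (i + n) (x + y) = mult_left n w i (i + n) x + mult_left n w i (i + n) y"
        using ab mult_left_emb[OF agr_simps(2)[OF ab(1,3)]] by (simp add: mult_left_emb emb_simps distrib_left)
    next
      fix c x assume "x \<in> bgr free i"
      then obtain a where a: "a \<in> agr A i" "x = emb a" by (auto simp: free_iff)
      show "mult_left n w i (i + n) (sA c x) = sA c (mult_left n w i (i + n) x)"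
        using a mult_left_emb[OF agr_simps(4)[OF a(1)], of n w] scale_mult(2)[of c w a, symmetric]
        by (simp add: mult_left_emb emb_simps)
    qed
  next
    fix i m and c :: 'k and x assume c: "c \<in> agr ground_dga m" and "x \<in> bgr free i"
    then obtain a where a: "a \<in> agr A i" "x = emb a" by (auto simp: free_iff)
    show "mult_left n w (m + i) (m + i + n) (lact free c x) = ksign (n * m) (lact free c (mult_left n w i (i + n) x))"
    proof (cases "m = 0")
      case True
      then show ?thesis
        using a mult_left_emb[OF agr_simps(4)[OF a(1)], of n w] scale_mult(2)[of c w a, symmetric]
        by (simp add: free_simps mult_left_emb emb_simps ksign_def)
    next
      case False
      \<comment> \<open>The ground algebra is concentrated in degree 0.\<close>
      then have "c = 0" using c unfolding ground_dga_def by simp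
      then show ?thesis using a mult_left_emb[OF agr_simps(1), of n w]
        by (simp add: free_simps mult_left_emb emb_simps)
    qed
  next
    fix i m b x assume b: "b \<in> agr A m" and "x \<in> bgr free i"
    then obtain a where a: "a \<in> agr A i" "x = emb a" by (auto simp: free_iff)
    show "mult_left n w (i + m) (i + m + n) (ract free x b) = ract free (mult_left n w i (i + n) x) b"
      using a mult_left_emb[OF gr_mult[OF a(1) b], of n w] by (simp add: free_simps mult_left_emb mult.assoc)
  qed
qed

abbreviation modcat :: "('k, ('k, 'a, nat \<Rightarrow> 'a) bimod, int \<Rightarrow> int \<Rightarrow> (nat \<Rightarrow> 'a) \<Rightarrow> (nat \<Rightarrow> 'a)) dgcat" where
  "modcat \<equiv> bimod_dgcat sA ground_dga A"

lemma modcat_simps: "dHom modcat M N n = bimod_hom sA sA ground_dga A M N n"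
  "dif modcat M N f i k x = (if x \<in> bgr M i
     then bdif N (f i (k - 1) x) - ksign (k - 1 - i) (f (i + 1) k (bdif M x)) else 0)"
  "smul modcat c f i j x = sA c (f i j x)"
  unfolding bimod_dgcat_def by simp_all

text \<open>The Leibniz rule of A, solved for d(w) a. Together with
  \<open>bimod_hom_eq_mult_left\<close> it identifies the endomorphism complex of the free module
  with A.\<close>

lemma dif_mult_left:
  assumes w: "w \<in> agr A n" shows "dif modcat free free (mult_left n w) = mult_left (n + 1) (adif A w)"
proof (rule ext, rule ext, rule ext)
  fix i k x
  show "dif modcat free free (mult_left n w) i k x = mult_left (n + 1) (adif A w) i k x"
  proof (cases "x \<in> bgr free i")
    case False
    then show ?thesis unfolding modcat_simps mult_left_def by auto
  next
    case True
    then obtain a where a: "a \<in> agr A i" "x = emb a" by (auto simp: free_iff)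
    note da = d_gr[OF a(1)]
    show ?thesis
    proof (cases "k = i + (n + 1)")
      case True
      have "adif A (w * a) - ksign n (w * adif A a) = adif A w * a" using d_mult[OF w, of a] by simp
      then have "emb (adif A (w * a)) - ksign n (emb (w * adif A a)) = emb (adif A w * a)"
        by (metis emb_simps(3,7))
      then show ?thesis using True a da unfolding modcat_simps
        by (simp add: free_simps mult_left_emb algebra_simps)
    next
      case False
      have "bdif free (0 :: nat \<Rightarrow> 'a) = 0" using free_simps(4)[of 0] by (simp add: emb_simps adif_simps)
      then show ?thesis using False a da unfolding modcat_simps
        by (simp add: free_simps mult_left_emb algebra_simps)
    qed
  qed
qed

text \<open>A right module map is determined by the image of 1.\<close>

lemma bimod_hom_eq_mult_left:
  assumes f: "f \<in> bimod_hom sA sA ground_dga A free free n"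
  obtains z where "z \<in> agr A n" "f = mult_left n z"
proof -
  have f0: "\<And>i j x. j \<noteq> i + n \<or> x \<notin> bgr free i \<Longrightarrow> f i j x = 0"
    and fim: "\<And>i. f i (i + n) ` bgr free i \<subseteq> bgr free (i + n)"
    and fr: "\<And>i m b x. b \<in> agr A m \<Longrightarrow> x \<in> bgr free i \<Longrightarrow> f (i + m) (i + m + n) (ract free x b) = ract free (f i (i + n) x) b"
    using f unfolding bimod_hom_def by blast+
  have one: "emb 1 \<in> bgr free 0" using gr_one by (simp add: free_simps)
  then have "f 0 (0 + n) (emb 1) \<in> bgr free (0 + n)" using fim[of 0] by blast
  then obtain z where z: "z \<in> agr A n" "f 0 n (emb 1) = emb z" by (auto simp: free_iff)
  have "f i j x = mult_left n z i j x" for i j x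
  proof (cases "j = i + n \<and> x \<in> bgr free i")
    case False
    then show ?thesis using f0[of j i x] unfolding mult_left_def by auto
  next
    case True
    then obtain a where a: "a \<in> agr A i" "x = emb a" by (auto simp: free_iff)
    have "f (0 + i) (0 + i + n) (ract free (emb 1) a) = ract free (f 0 (0 + n) (emb 1)) a" by (rule fr[OF a(1) one])
    then show ?thesis using z True a by (simp add: free_simps mult_left_emb)
  qed
  then have "f = mult_left n z" by (intro ext) simp
  then show ?thesis using that[OF z(1)] by simp
qed

lemma mult_left_linear: "linear_on_subspace (ascale A) (smul modcat) V (mult_left n)"
proof -
  interpret V: vector_space "ascale A" by (rule vs)
  show ?thesis
    unfolding linear_on_subspace_def
  proof (intro conjI ballI allI)
    show "mult_left n (x + y) = mult_left n x + mult_left n y" for x y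
      by (rule ext, rule ext, rule ext) (simp add: mult_left_def distrib_right emb_simps)
    show "mult_left n (ascale A c x) = smul modcat c (mult_left n x)" for c x
    proof (rule ext, rule ext, rule ext)
      fix i j y
      have "sA c 0 = 0" unfolding pointwise_def by (simp add: fun_eq_iff)
      then show "mult_left n (ascale A c x) i j y = smul modcat c (mult_left n x) i j y"
        unfolding modcat_simps mult_left_def by (simp add: scale_mult(1)[symmetric] emb_simps)
    qed
  qed
qed

lemma mult_left_eq_zero_iff: "w \<in> agr A n \<Longrightarrow> mult_left n w = 0 \<longleftrightarrow> w = 0"
proof
  assume "mult_left n w = 0"
  then have "mult_left n w 0 n (emb 1) = 0" by simp
  then show "w = 0" using mult_left_emb[OF gr_one, of n w n] emb_simps(6)[of w 0] by (simp add: emb_simps(1))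
next
  assume "w = 0"
  then show "mult_left n w = 0" by (intro ext) (simp add: mult_left_def emb_simps(1))
qed

lemma mult_left_diff: "mult_left n (z - w) = mult_left n z - mult_left n w"
  by (intro ext) (simp add: mult_left_def left_diff_distrib emb_simps)

lemma perf_dgcat_eq: "perf_dgcat A = modcat\<lparr>Ob := dg_thick modcat free\<rparr>"
  unfolding perf_dgcat_def Let_def by simp

lemma perf_finite_type:
  fixes D :: "('k, 'o, 'm::ab_group_add) tricat"
  assumes tc: "triangulated_category D" and proper: "proper_dga A" and perf: "is_perfect_derived_category A D"
  shows "finite_type D \<and> (\<exists>G. split_generator D G)"
proof -
  obtain E where E: "dg_enhancement (modcat\<lparr>Ob := dg_thick modcat free\<rparr>) E D"
    using perf unfolding is_perfect_derived_category_def perf_dgcat_eq by blast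
  let ?P = "modcat\<lparr>Ob := dg_thick modcat free\<rparr>"
  interpret D: triangulated_category D by fact
  interpret P: enhanced ?P E D by unfold_locales fact
  have G: "free \<in> Ob ?P" using dg_thick_enhanced(1)[OF tc E] by simp
  have gen: "split_generator D (fob E free)" using dg_thick_enhanced(2)[OF tc E] .
  obtain F where F: "finite F" "\<And>n z. \<lbrakk>z \<in> agr A n; adif A z = 0\<rbrakk> \<Longrightarrow>
      \<exists>w\<in>module.span (ascale A) F. z - w \<in> adif A ` agr A (n - 1)"
    using proper unfolding proper_dga_def by blast
  have cc: "cocycles ?P free free n = {f \<in> bimod_hom sA sA ground_dga A free free n. dif modcat free free f = 0}"
    "coboundaries ?P free free n = dif modcat free free ` bimod_hom sA sA ground_dga A free free (n - 1)" for n
    unfolding cocycles_def coboundaries_def by (simp_all add: modcat_simps)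
  have "hom_finite D (fob E free) (fob E free)"
  proof (rule P.hom_finite_endo[OF G vs cocycle_part_subspace cocycle_part_fin_dim[OF F(1)] cocycle_part_finite[OF F(1)]])
    show "linear_on_subspace (ascale A) (smul ?P) (cocycle_part F n) (mult_left n)" for n
      using mult_left_linear by simp
    show "mult_left n ` cocycle_part F n \<subseteq> cocycles ?P free free n" for n
      unfolding cc using mult_left_hom dif_mult_left mult_left_eq_zero_iff[OF agr_simps(1)]
      by (auto simp: cocycle_part_def)
    fix n g assume g: "g \<in> cocycles ?P free free n"
    then obtain z where z: "z \<in> agr A n" "g = mult_left n z" unfolding cc using bimod_hom_eq_mult_left by blast
    have "adif A z = 0" using g z dif_mult_left[OF z(1)] mult_left_eq_zero_iff[OF d_gr[OF z(1)]] unfolding cc by simp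
    then obtain w y where w: "w \<in> module.span (ascale A) F" "y \<in> agr A (n - 1)" "z - w = adif A y"
      using F(2)[OF z(1)] by blast
    have dy: "adif A y \<in> agr A n" using d_gr[OF w(2)] by simp
    \<comment> \<open>Hence w, a priori just an element of the span of F, is a cocycle of degree
      n.\<close>
    have wz: "w = z - adif A y" using w(3) by (simp add: algebra_simps)
    have "w \<in> cocycle_part F n"
      unfolding cocycle_part_def using w(1) agr_simps(3)[OF z(1) dy] \<open>adif A z = 0\<close> wz d_d adif_simps(3)[of z "adif A y"] by simp
    moreover have "g - mult_left n w = dif modcat free free (mult_left (n - 1) y)"
      unfolding z(2) mult_left_diff[symmetric] w(3) using dif_mult_left[OF w(2)] by simp
    then have "g - mult_left n w \<in> coboundaries ?P free free n" unfolding cc using mult_left_hom[OF w(2)] by blast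
    ultimately show "\<exists>w\<in>cocycle_part F n. g - mult_left n w \<in> coboundaries ?P free free n" by blast
  qed
  then show ?thesis using D.finite_type_of_generator[OF gen] gen by blast
qed

end

section \<open>Entropy of spherical twists\<close>

text \<open>Every F is isomorphic to some T F', and \<chi>(T E, T F') = \<chi>(E, F').\<close>

lemma (in triangulated_category) num_compat_autoequivalence:
  assumes "finite_type C" "exact_autoequivalence C T" shows "num_compat C C T"
  unfolding num_compat_def
proof (intro ballI impI)
  fix E E' F assume E: "E \<in> Ob C" "E' \<in> Ob C" "\<forall>F\<in>Ob C. euler_form C E F = euler_form C E' F" and F: "F \<in> Ob C"
  have lin: "lin_functor C C T" and eq: "equivalence C C T"
    using assms(2) exact_functor_lin unfolding exact_autoequivalence_def by auto
  obtain F' where F': "F' \<in> Ob C" "iso_ob C (fob T F') F" using eq F unfolding equivalence_def by blast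
  then have iso: "isom C (fob T F') F" using lin_functor_ob[OF lin] F unfolding isom_iff by simp
  have "euler_form C (fob T X) F = euler_form C X F'" if "X \<in> Ob C" for X
    using euler_form_isom(2)[OF assms(1) lin_functor_ob[OF lin that] iso]
      euler_form_autoequivalence[OF assms that F'(1)] by simp
  then show "euler_form C (fob T E) F = euler_form C (fob T E') F" using E F'(1) by simp
qed

lemma num_compat_adjoint:
  assumes "triangulated_category C" "triangulated_category D" "finite_type C" "finite_type D"
    and "exact_functor C D S" "exact_functor D C R" "adjunction C D S R \<eta> \<epsilon>"
  shows "num_compat C D S"
  unfolding num_compat_def
  using euler_form_adjunction[OF assms] lin_functor_ob[OF exact_functor_lin[OF assms(6)]] by simp

text \<open>Evaluating \<open>[T]\<^sup>n w = \<mu>\<^sup>n w\<close> at a form \<open>\<chi>(-, F)\<close> that does not vanish on \<open>w\<close> bounds \<open>|\<mu>|\<^sup>n\<close> by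
  total dimensions of morphism spaces, hence by the complexity.\<close>

lemma (in numerical) eigenvalue_growth:
  assumes T: "exact_autoequivalence C T" and G: "split_generator C G"
    and w: "w \<in> N_complex C" "w \<noteq> 0" "N_map C C T w = cscale \<mu> w"
  shows "\<exists>K>0. \<forall>n. cmod \<mu> ^ n \<le> K * real (cone_length C G ((fob T ^^ n) G))"
proof -
  have ex: "exact_functor C C T" using T unfolding exact_autoequivalence_def by simp
  interpret N: numerical_functor C C T
    by unfold_locales (use ex num_compat_autoequivalence[OF ft T] in auto)
  have it: "(fob T ^^ n) X \<in> Ob C" if "X \<in> Ob C" for X n using iterate_ob[OF exact_functor_lin[OF ex] that] .
  have GO: "G \<in> Ob C" using G unfolding split_generator_def by simp
  obtain I a where I: "finite I" "I \<subseteq> Ob C" "w = (\<Sum>E\<in>I. cscale (a E) (cls C E))" using N_complex_sum[OF w(1)] .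
  obtain F where F: "F \<in> Ob C" "w (chi_fun F) \<noteq> 0" using chi_fun_separates[OF w(1)] w(2) by blast
  have pow: "(\<Sum>E\<in>I. cscale (a E) (cls C ((fob T ^^ n) E))) = cscale (\<mu> ^ n) w" for n
  proof (induction n)
    case 0
    then show ?case using I(3) by simp
  next
    case (Suc n)
    have in_N: "cls C ((fob T ^^ n) E) \<in> N_complex C" if "E \<in> I" for E using cls_in it I(2) that by blast
    have "(\<Sum>E\<in>I. cscale (a E) (cls C ((fob T ^^ Suc n) E))) = (\<Sum>E\<in>I. cscale (a E) (N_map C C T (cls C ((fob T ^^ n) E))))"
    proof (rule sum.cong)
      fix E assume "E \<in> I"
      then have "(fob T ^^ n) E \<in> Ob C" using it I(2) by blast
      from N.push_cls[OF this] show "cscale (a E) (cls C ((fob T ^^ Suc n) E)) = cscale (a E) (N_map C C T (cls C ((fob T ^^ n) E)))"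
        unfolding N.N_map_eq_push by simp
    qed simp
    also have "\<dots> = N_map C C T (\<Sum>E\<in>I. cscale (a E) (cls C ((fob T ^^ n) E)))"
      using cv.linear_on_subspace_sum[OF N.N_map_linear N_complex_subspace vector_space_cscale I(1) in_N] by simp
    also have "\<dots> = N_map C C T (cscale (\<mu> ^ n) w)" using Suc by simp
    also have "\<dots> = cscale (\<mu> ^ n) (cscale \<mu> w)"
      using N.N_map_linear w(1,3) unfolding linear_on_subspace_def by simp
    finally show ?case by (simp add: mult.commute)
  qed
  define d where "d n = cone_length C G ((fob T ^^ n) G)" for n
  define l where "l E = cone_length C G E" for E
  define b where "b E = cmod (a E) * (real (l E) * real (total_dim C G F))" for E
  have fin: "hom_finite C X F" if "X \<in> Ob C" for X using ft that F(1) unfolding finite_type_iff by blast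
  have bound: "cmod \<mu> ^ n * cmod (w (chi_fun F)) \<le> real (d n) * sum b I" for n
  proof -
    have "cls C ((fob T ^^ n) E) (chi_fun F) = of_int (euler_form C ((fob T ^^ n) E) F)" if "E \<in> I" for E
      using cls_chi_fun[OF it F(1)] I(2) that by blast
    then have "(\<Sum>E\<in>I. a E * of_int (euler_form C ((fob T ^^ n) E) F))
        = (\<Sum>E\<in>I. cscale (a E) (cls C ((fob T ^^ n) E))) (chi_fun F)"
      unfolding sum_apply pointwise_def by (intro sum.cong) simp_all
    also have "\<dots> = \<mu> ^ n * w (chi_fun F)" using pow[of n] by (simp add: pointwise_def)
    finally have "\<mu> ^ n * w (chi_fun F) = (\<Sum>E\<in>I. a E * of_int (euler_form C ((fob T ^^ n) E) F))" by simp
    then have "cmod \<mu> ^ n * cmod (w (chi_fun F)) = cmod (\<Sum>E\<in>I. a E * of_int (euler_form C ((fob T ^^ n) E) F))"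
      by (metis norm_mult norm_power)
    also have "\<dots> \<le> (\<Sum>E\<in>I. real (d n) * b E)"
    proof (rule sum_norm_le)
      fix E assume "E \<in> I"
      then have E: "E \<in> Ob C" using I(2) by blast
      \<comment> \<open>E needs \<open>l E\<close> cones on shifts of G, so T^n E needs as many on
        shifts of T^n G, each of which costs \<open>d n\<close> cones on shifts of G.\<close>
      have lev: "level C G (d n * l E) ((fob T ^^ n) E)"
        unfolding d_def l_def
        using level_trans[OF split_generator_level[OF G it[OF GO]] iterate_level[OF ex GO split_generator_level[OF G E]] GO] .
      have "\<bar>euler_form C ((fob T ^^ n) E) F\<bar> \<le> int (total_dim C ((fob T ^^ n) E) F)"
        using abs_euler_form_le[OF it[OF E] F(1) fin[OF it[OF E]]] .
      also have "\<dots> \<le> int (d n * l E * total_dim C G F)"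
        using level_hom_finite_left(2)[OF lev GO F(1) fin[OF GO]] by (simp only: of_nat_le_iff)
      finally have "real_of_int \<bar>euler_form C ((fob T ^^ n) E) F\<bar> \<le> real (d n * l E * total_dim C G F)"
        by (metis of_int_le_iff of_int_of_nat_eq)
      then have le: "cmod (of_int (euler_form C ((fob T ^^ n) E) F)) \<le> real (d n) * (real (l E) * real (total_dim C G F))"
        by (simp add: mult.assoc)
      show "cmod (a E * of_int (euler_form C ((fob T ^^ n) E) F)) \<le> real (d n) * b E"
        unfolding norm_mult b_def using mult_left_mono[OF le norm_ge_zero[of "a E"]] by (simp add: mult_ac)
    qed
    finally show ?thesis by (simp add: sum_distrib_left)
  qed
  have b0: "0 \<le> sum b I" unfolding b_def by (intro sum_nonneg) simp
  have pos: "cmod (w (chi_fun F)) > 0" using F(2) by simp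
  show ?thesis
  proof (intro exI conjI allI)
    \<comment> \<open>The added 1 keeps the constant positive even if \<open>sum b I\<close> is
      0.\<close>
    show "0 < (sum b I + 1) / cmod (w (chi_fun F))" using b0 pos by simp
    fix n
    have "cmod \<mu> ^ n * cmod (w (chi_fun F)) \<le> (sum b I + 1) * real (d n)"
      using bound[of n] by (simp add: algebra_simps)
    then show "cmod \<mu> ^ n \<le> (sum b I + 1) / cmod (w (chi_fun F)) * real (cone_length C G ((fob T ^^ n) G))"
      unfolding d_def using pos by (simp add: field_simps)
  qed
qed

text \<open>Evaluating w at \<chi>(-, F) equals evaluating [T]w at \<chi>(-, T F). If [T]w = 0, all
  these values vanish and \<open>chi_fun_separates\<close> gives w = 0.\<close>

lemma (in numerical) eigenvalue_nonzero:
  assumes T: "exact_autoequivalence C T" and w: "w \<in> N_complex C" "w \<noteq> 0" "N_map C C T w = cscale \<mu> w"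
  shows "\<mu> \<noteq> 0"
proof
  assume \<mu>: "\<mu> = 0"
  have ex: "exact_functor C C T" using T unfolding exact_autoequivalence_def by simp
  interpret N: numerical_functor C C T
    by unfold_locales (use ex num_compat_autoequivalence[OF ft T] in auto)
  obtain I a where I: "finite I" "I \<subseteq> Ob C" "w = (\<Sum>E\<in>I. cscale (a E) (cls C E))" using N_complex_sum[OF w(1)] .
  have "w (chi_fun F) = 0" if F: "F \<in> Ob C" for F
  proof -
    have "w (chi_fun F) = (\<Sum>E\<in>I. a E * of_int (euler_form C E F))"
      unfolding I(3) sum_apply pointwise_def using cls_chi_fun[OF _ F] I(2) by (intro sum.cong) auto
    also have "\<dots> = (\<Sum>E\<in>I. a E * cls C (fob T E) (chi_fun (fob T F)))"
      using cls_chi_fun[OF N.ob N.ob[OF F]] euler_form_autoequivalence[OF ft T _ F] I(2) by (intro sum.cong) auto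
    also have "\<dots> = (N_map C C T w) (chi_fun (fob T F))"
      using N.N_map_sum[OF I(1,2), of a] I(3) by (simp add: sum_apply pointwise_def)
    also have "\<dots> = 0" unfolding w(3) \<mu> pointwise_def by simp
    finally show ?thesis .
  qed
  then show False using chi_fun_separates[OF w(1)] w(2) by blast
qed

subsection \<open>Spherical functors\<close>

context spherical_functor
begin

lemma S_exact: "exact_functor C D S" and R_exact: "exact_functor D C R" and L_exact: "exact_functor D C L"
  using exact unfolding dg_exact_functor_def by auto

lemma T_exact: "exact_functor D D T" and Q_exact: "exact_functor C C Q"
  using twist_equiv cotwist_equiv unfolding exact_autoequivalence_def by auto

lemmas S_lin = exact_functor_lin[OF S_exact] and R_lin = exact_functor_lin[OF R_exact]
  and L_lin = exact_functor_lin[OF L_exact] and T_lin = exact_functor_lin[OF T_exact]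
  and Q_lin = exact_functor_lin[OF Q_exact]

sublocale C: triangulated_category C by (rule triangulated)
sublocale D: triangulated_category D by (rule triangulated)
sublocale CE: enhanced CC EC C by unfold_locales (rule enhanced)
sublocale DE: enhanced DD ED D by unfold_locales (rule enhanced)

lemma twist_extension: "X \<in> Ob D \<Longrightarrow> extension D (fob S (fob R X)) X (fob T X)"
  using DE.functorial_cone_extension[OF twist lin_functor_comp[OF R_lin S_lin] lin_functor_id] by simp

lemma cotwist_extension:
  assumes "X \<in> Ob C"
  obtains Y where "extension C X (fob R (fob S X)) Y" "isom C (fob Q X) (sh_ob C (- 1) Y)"
proof -
  obtain K where K: "functorial_cone C CC EC id_fnct (R \<circ>\<^sub>F S) \<eta> K" "isomorphic_functors C C Q (shift C (- 1) \<circ>\<^sub>F K)"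
    using cotwist(2) by blast
  have Klin: "lin_functor C C K" using K(1) unfolding functorial_cone_def by simp
  have "extension C X (fob R (fob S X)) (fob K X)"
    using CE.functorial_cone_extension[OF K(1) lin_functor_id lin_functor_comp[OF S_lin R_lin] assms] by simp
  moreover have "isom C (fob Q X) (sh_ob C (- 1) (fob K X))"
    using isomorphic_functors_isom[OF Q_lin lin_functor_comp[OF Klin C.shift_functor] K(2) assms] by simp
  ultimately show ?thesis using that by blast
qed

text \<open>The first formula for R at X[1] gives R X[1] \<cong> L T X, and the second at T X gives
  R T X \<cong> Q L (T X [1]). Shifts do not affect levels, so this carries the level over from R
  X.\<close>

lemma cotwist_level:
  assumes X: "X \<in> Ob D" and E: "E \<in> Ob C" and l: "level C E k (fob R X)"
  shows "level C (fob Q E) k (fob R (fob T X))"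
proof -
  let ?TX = "fob T X"
  have TX: "?TX \<in> Ob D" using lin_functor_ob[OF T_lin X] .
  have 1: "level C E k (fob R (sh_ob D 1 X))"
    using C.level_isom[OF C.level_shift[OF l E] isom_sym[OF exact_functor_shift[OF triangulated(2,1) R_exact X]]] .
  have "isom C (fob R (sh_ob D 1 X)) (fob L (fob T (sh_ob D (- 1) (sh_ob D 1 X))))"
    using isomorphic_functors_isom[OF R_lin lin_functor_comp[OF D.shift_functor lin_functor_comp[OF T_lin L_lin], of "- 1"] _ D.shift_ob[OF X]]
      right_via_twist unfolding fcomp_def by (simp add: comp_assoc)
  then have "isom C (fob R (sh_ob D 1 X)) (fob L ?TX)" using X by (simp add: D.shift_shift D.shift_zero)
  then have 2: "level C E k (fob L ?TX)" using C.level_isom 1 by blast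
  have "level C E k (fob L (sh_ob D 1 ?TX))"
    using C.level_isom[OF C.level_shift[OF 2 E] isom_sym[OF exact_functor_shift[OF triangulated(2,1) L_exact TX]]] .
  then have 3: "level C (fob Q E) k (fob Q (fob L (sh_ob D 1 ?TX)))"
    using exact_functor_level[OF triangulated(1,1) Q_exact _ E] by blast
  have "isom C (fob R ?TX) (fob Q (fob L (sh_ob D 1 ?TX)))"
    using isomorphic_functors_isom[OF R_lin lin_functor_comp[OF D.shift_functor lin_functor_comp[OF L_lin Q_lin], of 1] _ TX]
      right_via_cotwist unfolding fcomp_def by (simp add: comp_assoc)
  then show ?thesis using C.level_isom[OF 3 isom_sym] by blast
qed

text \<open>\<open>r\<close> counts the cones from H to R G and \<open>s\<close> those from G to S
  H. Hence S R T^n G has level s r \<delta>(H, Q^n H) over G, and the constant M is s r. The leading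
  1 is the length of G over itself.\<close>

lemma twist_iterate_level:
  assumes G: "split_generator D G" and H: "split_generator C H"
  shows "\<exists>M. \<forall>n. cone_length D G ((fob T ^^ n) G) \<le> 1 + (\<Sum>k<n. M * cone_length C H ((fob Q ^^ k) H))"
proof -
  have GO: "G \<in> Ob D" and HO: "H \<in> Ob C" using G H unfolding split_generator_def by auto
  have TG: "(fob T ^^ n) G \<in> Ob D" for n using D.iterate_ob[OF T_lin GO] .
  have QH: "(fob Q ^^ n) H \<in> Ob C" for n using C.iterate_ob[OF Q_lin HO] .
  let ?d = "\<lambda>n. cone_length C H ((fob Q ^^ n) H)"
  define r where "r = cone_length C H (fob R G)"
  define s where "s = cone_length D G (fob S H)"
  have 1: "level C ((fob Q ^^ n) H) r (fob R ((fob T ^^ n) G))" for n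
  proof (induction n)
    case 0
    then show ?case using C.split_generator_level[OF H lin_functor_ob[OF R_lin GO]] unfolding r_def by simp
  next
    case (Suc n)
    then show ?case using cotwist_level[OF TG QH Suc] by simp
  qed
  have SR: "level D G (s * (?d n * r)) (fob S (fob R ((fob T ^^ n) G)))" for n
  proof -
    have "level C H (?d n * r) (fob R ((fob T ^^ n) G))"
      using C.level_trans[OF C.split_generator_level[OF H QH] 1 HO] .
    then have "level D (fob S H) (?d n * r) (fob S (fob R ((fob T ^^ n) G)))"
      using exact_functor_level[OF triangulated S_exact _ HO] by blast
    then show ?thesis
      using D.level_trans[OF D.split_generator_level[OF G lin_functor_ob[OF S_lin HO]] _ GO] unfolding s_def by blast
  qed
  have "cone_length D G ((fob T ^^ n) G) \<le> 1 + (\<Sum>k<n. s * r * ?d k)" for n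
  proof (induction n)
    case 0
    then show ?case using cone_length_le[OF D.level_self[OF GO]] by simp
  next
    case (Suc n)
    let ?X = "(fob T ^^ n) G"
    have "extension D ?X (fob T ?X) (sh_ob D 1 (fob S (fob R ?X)))"
      using D.extension_rotate[OF twist_extension[OF TG]] .
    from D.level_extension[OF D.split_generator_level[OF G TG] D.level_shift[OF SR GO] this]
    have "cone_length D G ((fob T ^^ Suc n) G) \<le> cone_length D G ?X + s * (?d n * r)"
      using cone_length_le by simp
    then show ?case using Suc by (simp add: algebra_simps)
  qed
  then show ?thesis by blast
qed

end

text \<open>Half of e pays for replacing \<open>d k\<close> by an exponential of rate h + e/2, the
  other half for the factor linear in n that comes from adding n terms. The sign of h makes these
  exponentials increasing.\<close>

lemma exp_growth_bound:
  fixes d :: "nat \<Rightarrow> nat"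
  assumes d: "\<And>n. d n > 0" and lim: "(\<lambda>n. ln (real (d n)) / real n) \<longlonglongrightarrow> h" and h: "0 \<le> h" and e: "e > 0"
    and b: "\<And>n. b n \<le> 1 + (\<Sum>k<n. M * d k)" and b0: "\<And>n. b n > (0::nat)"
  shows "eventually (\<lambda>n. ln (real (b n)) / real n < h + e) sequentially"
proof -
  have "eventually (\<lambda>n. ln (real (d n)) / real n < h + e / 2) sequentially"
    using order_tendstoD(2)[OF lim] e by simp
  then obtain N where N: "\<And>n. n \<ge> N \<Longrightarrow> ln (real (d n)) / real n < h + e / 2"
    unfolding eventually_sequentially by blast
  \<comment> \<open>A absorbs the values for k \<le> N, to which the asymptotic estimate need not
    apply; the summand 1 gives A \<ge> 1 for the remaining k.\<close>
  define A where "A = 1 + (\<Sum>k\<le>N. real (d k))"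
  have A: "A \<ge> 1" unfolding A_def by (simp add: sum_nonneg)
  let ?g = "h + e / 2"
  have g0: "?g \<ge> 0" using h e by simp
  have dk: "real (d k) \<le> A * exp (?g * real k)" for k
  proof (cases "k \<le> N")
    case True
    have "real (d k) \<le> (\<Sum>k\<le>N. real (d k))" using True by (intro member_le_sum) auto
    then have "real (d k) \<le> A" unfolding A_def by simp
    also have "\<dots> \<le> A * exp (?g * real k)" using A g0 by (simp add: mult_le_cancel_left1)
    finally show ?thesis .
  next
    case False
    then have "ln (real (d k)) < ?g * real k" using N[of k] by (simp add: field_simps)
    then have "real (d k) \<le> exp (?g * real k)" using d[of k] by (metis exp_le_cancel_iff exp_ln less_imp_le of_nat_0_less_iff)
    also have "\<dots> \<le> A * exp (?g * real k)" using A by simp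
    finally show ?thesis .
  qed
  define B where "B = 1 + real M * A"
  have B: "B \<ge> 1" unfolding B_def using A by simp
  have bn: "real (b n) \<le> B * (1 + real n) * exp (?g * real n)" for n
  proof -
    have "real (b n) \<le> real (1 + (\<Sum>k<n. M * d k))" using b[of n] by (simp only: of_nat_le_iff)
    also have "\<dots> = 1 + (\<Sum>k<n. real M * real (d k))" by simp
    also have "\<dots> \<le> 1 + (\<Sum>k<n. real M * (A * exp (?g * real n)))"
    proof (intro add_left_mono sum_mono mult_left_mono)
      fix k assume "k \<in> {..<n}"
      then have "exp (?g * real k) \<le> exp (?g * real n)" using g0 by (simp add: mult_left_mono)
      then show "real (d k) \<le> A * exp (?g * real n)" using dk[of k] A by (smt (verit) mult_left_mono)
    qed simp
    also have "\<dots> = 1 + real n * (real M * A) * exp (?g * real n)" by simp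
    \<comment> \<open>The factor 1 + n is at least 1 also for n = 0, and so is the exponential, so
      their product absorbs the leading 1.\<close>
    also have "\<dots> \<le> (1 + real n) * exp (?g * real n) + (1 + real n) * (real M * A) * exp (?g * real n)"
    proof (rule add_mono)
      have "1 * 1 \<le> (1 + real n) * exp (?g * real n)" using g0 by (intro mult_mono) auto
      then show "1 \<le> (1 + real n) * exp (?g * real n)" by simp
      show "real n * (real M * A) * exp (?g * real n) \<le> (1 + real n) * (real M * A) * exp (?g * real n)"
        using A by (intro mult_right_mono) auto
    qed
    finally show ?thesis unfolding B_def by (simp add: algebra_simps)
  qed
  have lim0: "(\<lambda>n. (ln B + ln (1 + real n)) / real n) \<longlonglongrightarrow> 0" by real_asymp
  have "eventually (\<lambda>n. (ln B + ln (1 + real n)) / real n < e / 2) sequentially"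
    by (rule order_tendstoD(2)[OF lim0]) (use e in simp)
  then show ?thesis
  proof (rule eventually_elim2[OF _ eventually_gt_at_top[of 0]])
    fix n :: nat assume n: "(ln B + ln (1 + real n)) / real n < e / 2" "0 < n"
    have "ln (real (b n)) \<le> ln (B * (1 + real n) * exp (?g * real n))"
      using bn[of n] b0[of n] by (intro ln_mono) auto
    also have "\<dots> = (ln B + ln (1 + real n)) + ?g * real n" using B by (simp add: ln_mult)
    finally have "ln (real (b n)) / real n \<le> (ln B + ln (1 + real n)) / real n + ?g"
      using n(2) by (simp add: field_simps)
    then show "ln (real (b n)) / real n < h + e" using n(1) by linarith
  qed
qed

theorem corollary1p10:
  fixes C :: "('k::field, 'oc, 'mc::ab_group_add) tricat"
    and CC :: "('k, 'pc, 'lc::ab_group_add) dgcat" and EC :: "('pc, 'lc, 'oc, 'mc) fnct"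
    and D :: "('k, 'od, 'md::ab_group_add) tricat"
    and DD :: "('k, 'pd, 'ld::ab_group_add) dgcat" and ED :: "('pd, 'ld, 'od, 'md) fnct"
    and A :: "('k, 'a::{ring, monoid_mult}) dga"
    and S :: "('oc, 'mc, 'od, 'md) fnct"
    and R L :: "('od, 'md, 'oc, 'mc) fnct"
    and \<eta> :: "'oc \<Rightarrow> 'mc" and \<epsilon> :: "'od \<Rightarrow> 'md"
    and T\<^sub>S :: "('od, 'md, 'od, 'md) fnct" and C\<^sub>S :: "('oc, 'mc, 'oc, 'mc) fnct"
    and v :: "'oc num_vec" and c :: complex
  assumes "finite_type C"
    and "finite_rank (N_group C)"
    and "dg_algebra A" "smooth_dga A" "proper_dga A"
    and "is_perfect_derived_category A D"
    and "finite_rank (N_group D)"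
    and "spherical_functor C CC EC D DD ED S R L \<eta> \<epsilon> T\<^sub>S C\<^sub>S"
    and "\<exists>Y\<in>Ob D. \<exists>G. iso_ob C (fob R Y) G \<and> split_generator C G"
    and "entropy C 0 C\<^sub>S \<le> ereal (ln (num_spectral_radius C C\<^sub>S))"
    and "v \<in> N_complex C" "N_map C D S v \<noteq> 0"
    and "N_map C C C\<^sub>S v = cscale c v" "cmod c = num_spectral_radius C C\<^sub>S"
  shows "entropy D 0 T\<^sub>S = ereal (ln (num_spectral_radius D T\<^sub>S))"
proof -
  interpret sph: spherical_functor C CC EC D DD ED S R L \<eta> \<epsilon> T\<^sub>S C\<^sub>S by fact
  have D: "finite_type D" "\<exists>G. split_generator D G"
    using dg_algebra.perf_finite_type[OF assms(3) sph.triangulated(2) assms(5,6)] by auto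
  interpret C: numerical C by unfold_locales fact
  interpret D: numerical D by unfold_locales fact
  interpret S: numerical_functor C D S
    by unfold_locales (use sph.S_exact num_compat_adjoint[OF sph.triangulated assms(1) D(1) sph.S_exact sph.R_exact sph.right_adjoint] in auto)
  interpret T: numerical_functor D D T\<^sub>S
    by unfold_locales (use sph.T_exact sph.D.num_compat_autoequivalence[OF D(1) sph.twist_equiv] in auto)
  interpret Q: numerical_functor C C C\<^sub>S
    by unfold_locales (use sph.Q_exact sph.C.num_compat_autoequivalence[OF assms(1) sph.cotwist_equiv] in auto)
  obtain H where H: "split_generator C H" using assms(9) by blast

  \<comment> \<open>v is nonzero because its image under [S] is; only then is it an
    eigenvector.\<close>
  have "linear_on_subspace cscale cscale (N_complex C) (N_map C D S)" by (rule S.N_map_linear)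
  then have "N_map C D S 0 = 0"
    using linear_on_subspace_simps(1)[OF _ vector_space_cscale vector_space_cscale C.N_complex_subspace] by blast
  then have v0: "v \<noteq> 0" using assms(12) by auto
  have c0: "c \<noteq> 0" using C.eigenvalue_nonzero[OF sph.cotwist_equiv assms(11) v0 assms(13)] .

  \<comment> \<open>Powers of |c| > 0 bound the cone lengths from below up to a constant, so none of
    them is 0.\<close>
  have Qpos: "0 < cone_length C G ((fob C\<^sub>S ^^ n) G)" if G: "split_generator C G" for G n
  proof -
    obtain K where "K > 0" "\<And>n. cmod c ^ n \<le> K * real (cone_length C G ((fob C\<^sub>S ^^ n) G))"
      using C.eigenvalue_growth[OF sph.cotwist_equiv G assms(11) v0 assms(13)] by blast
    then have "0 < K * real (cone_length C G ((fob C\<^sub>S ^^ n) G))" using c0 by (meson less_le_trans zero_less_norm_iff zero_less_power)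
    then show ?thesis by (intro Nat.gr0I) simp
  qed
  obtain h where h: "0 \<le> h" "entropy C 0 C\<^sub>S = ereal h"
    "(\<lambda>n. ln (real (cone_length C H ((fob C\<^sub>S ^^ n) H))) / real n) \<longlonglongrightarrow> h"
    using sph.C.entropy_limit[OF sph.Q_exact H Qpos] by blast
  \<comment> \<open>This is where the assumed bound on the entropy of the cotwist and the choice of
    c as an eigenvalue of maximal modulus meet.\<close>
  have hc: "h \<le> ln (cmod c)" using assms(10,14) h(2) by simp

  \<comment> \<open>The class of S R S X is the difference of S X and S Q X by the cotwist triangle,
    and of S X and T S X by the twist triangle. Arguing on objects avoids forming a map [R].\<close>
  have TS: "cls D (fob T\<^sub>S (fob S X)) = cls D (fob S (fob C\<^sub>S X))" if X: "X \<in> Ob C" for X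
  proof -
    obtain Y where Y: "extension C X (fob R (fob S X)) Y" "isom C (fob C\<^sub>S X) (sh_ob C (- 1) Y)"
      using sph.cotwist_extension[OF X] .
    have ob: "Y \<in> Ob C" "fob S X \<in> Ob D" "fob C\<^sub>S X \<in> Ob C"
      using sph.C.extension_ob[OF Y(1)] S.ob[OF X] Q.ob[OF X] by auto
    have "extension C (fob C\<^sub>S X) X (fob R (fob S X))"
      using sph.C.extension_isom[OF sph.C.extension_rotate_back[OF Y(1)] isom_sym[OF Y(2)] sph.C.isom_refl sph.C.isom_refl]
        sph.C.extension_ob[OF Y(1)] by blast
    then have "extension D (fob S (fob C\<^sub>S X)) (fob S X) (fob S (fob R (fob S X)))"
      using exact_functor_extension[OF sph.S_exact] by blast
    from D.cls_extension[OF this] D.cls_extension[OF sph.twist_extension[OF ob(2)]]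
    show ?thesis by (simp add: add.commute)
  qed
  obtain I a where I: "finite I" "I \<subseteq> Ob C" "v = (\<Sum>E\<in>I. cscale (a E) (cls C E))" using C.N_complex_sum[OF assms(11)] .
  let ?w = "N_map C D S v"
  have w: "?w \<in> N_complex D" using S.N_map_in[OF assms(11)] .
  have "N_map D D T\<^sub>S ?w = N_map C D S (N_map C C C\<^sub>S v)"
  proof -
    have "N_map D D T\<^sub>S ?w = N_map D D T\<^sub>S (\<Sum>E\<in>I. cscale (a E) (cls D (fob S E)))"
      unfolding I(3) S.N_map_sum[OF I(1,2)] ..
    also have "\<dots> = (\<Sum>E\<in>I. cscale (a E) (N_map D D T\<^sub>S (cls D (fob S E))))"
      using cv.linear_on_subspace_sum[OF T.N_map_linear D.N_complex_subspace vector_space_cscale I(1), of "\<lambda>E. cls D (fob S E)" a]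
        D.cls_in S.ob I(2) by blast
    also have "\<dots> = (\<Sum>E\<in>I. cscale (a E) (N_map C D S (cls C (fob C\<^sub>S E))))"
    proof (rule sum.cong)
      fix E assume "E \<in> I"
      then have "E \<in> Ob C" using I(2) by blast
      then show "cscale (a E) (N_map D D T\<^sub>S (cls D (fob S E))) = cscale (a E) (N_map C D S (cls C (fob C\<^sub>S E)))"
        unfolding T.N_map_eq_push S.N_map_eq_push using T.push_cls[OF S.ob] S.push_cls[OF Q.ob] TS by simp
    qed simp
    also have "\<dots> = N_map C D S (\<Sum>E\<in>I. cscale (a E) (cls C (fob C\<^sub>S E)))"
      using cv.linear_on_subspace_sum[OF S.N_map_linear C.N_complex_subspace vector_space_cscale I(1), of "\<lambda>E. cls C (fob C\<^sub>S E)" a]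
        C.cls_in Q.ob I(2) by (metis (no_types, lifting) subsetD)
    also have "\<dots> = N_map C D S (N_map C C C\<^sub>S v)" unfolding I(3) Q.N_map_sum[OF I(1,2)] ..
    finally show ?thesis .
  qed
  also have "\<dots> = cscale c ?w" unfolding assms(13) using S.N_map_linear assms(11) unfolding linear_on_subspace_def by blast
  finally have eig: "N_map D D T\<^sub>S ?w = cscale c ?w" .

  note sr = spectral_radius_eigen[OF D.N_complex_subspace T.N_map_linear D.N_complex_fin_dim[OF assms(7)] w assms(12) eig]
  define \<rho> where "\<rho> = num_spectral_radius D T\<^sub>S"
  have c\<rho>: "cmod c \<le> \<rho>" using sr(1) unfolding \<rho>_def num_spectral_radius_def .
  \<comment> \<open>The image of v only yields |c| \<le> \<rho>; the lower bound for the entropy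
    needs an eigenvector whose eigenvalue has maximal modulus \<rho>.\<close>
  obtain \<nu> u where u: "u \<in> N_complex D" "u \<noteq> 0" "N_map D D T\<^sub>S u = cscale \<nu> u" "cmod \<nu> = \<rho>"
    using sr(2) unfolding \<rho>_def num_spectral_radius_def by blast
  have \<rho>0: "\<rho> > 0" using c\<rho> c0 by (meson less_le_trans zero_less_norm_iff)
  have h\<rho>: "h \<le> ln \<rho>" using hc c\<rho> c0 by (meson ln_mono order_trans zero_less_norm_iff)

  have growth: "\<exists>K>0. \<forall>n. \<rho> ^ n \<le> K * real (cone_length D G ((fob T\<^sub>S ^^ n) G))" if G: "split_generator D G" for G
    using D.eigenvalue_growth[OF sph.twist_equiv G u(1-3)] u(4) by simp
  have pos: "0 < cone_length D G ((fob T\<^sub>S ^^ n) G)" if G: "split_generator D G" for G n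
  proof -
    obtain K where "K > 0" "\<rho> ^ n \<le> K * real (cone_length D G ((fob T\<^sub>S ^^ n) G))" using growth[OF G] by blast
    then have "0 < K * real (cone_length D G ((fob T\<^sub>S ^^ n) G))" using \<rho>0 by (meson less_le_trans zero_less_power)
    then show ?thesis by (intro Nat.gr0I) simp
  qed
  \<comment> \<open>The two growth bounds enclose the limit, so its existence and its independence
    of G are obtained together with its value.\<close>
  have lim: "(\<lambda>n. ln (real (cone_length D G ((fob T\<^sub>S ^^ n) G))) / real n) \<longlonglongrightarrow> ln \<rho>" if G: "split_generator D G" for G
  proof (rule order_tendstoI)
    let ?d = "\<lambda>n. cone_length D G ((fob T\<^sub>S ^^ n) G)"
    fix x assume x: "ln \<rho> < x"
    obtain M where M: "\<And>n. ?d n \<le> 1 + (\<Sum>k<n. M * cone_length C H ((fob C\<^sub>S ^^ k) H))"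
      using sph.twist_iterate_level[OF G H] by blast
    \<comment> \<open>The margin x - h is positive because h \<le> ln \<rho> < x.\<close>
    have "eventually (\<lambda>n. ln (real (?d n)) / real n < h + (x - h)) sequentially"
      by (rule exp_growth_bound[OF Qpos[OF H] h(3,1) _ M pos[OF G]]) (use h\<rho> x in simp)
    then show "eventually (\<lambda>n. ln (real (?d n)) / real n < x) sequentially" by simp
  next
    let ?d = "\<lambda>n. cone_length D G ((fob T\<^sub>S ^^ n) G)"
    fix x assume x: "x < ln \<rho>"
    obtain K where K: "K > 0" "\<And>n. \<rho> ^ n \<le> K * real (?d n)" using growth[OF G] by blast
    have "(\<lambda>n. ln \<rho> - ln K / real n) \<longlonglongrightarrow> ln \<rho> - 0" by (intro tendsto_diff tendsto_const lim_const_over_n)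
    then have "eventually (\<lambda>n. x < ln \<rho> - ln K / real n) sequentially" using order_tendstoD(1) x by fastforce
    then show "eventually (\<lambda>n. x < ln (real (?d n)) / real n) sequentially"
    proof (rule eventually_elim2[OF _ eventually_gt_at_top[of 0]])
      fix n :: nat assume n: "x < ln \<rho> - ln K / real n" "0 < n"
      have "real n * ln \<rho> = ln (\<rho> ^ n)" using \<rho>0 by (simp add: ln_realpow)
      also have "\<dots> \<le> ln (K * real (?d n))" using K(2)[of n] \<rho>0 by (intro ln_mono) auto
      also have "\<dots> = ln K + ln (real (?d n))" using K(1) pos[OF G, of n] by (simp add: ln_mult)
      finally have "ln \<rho> \<le> (ln K + ln (real (?d n))) / real n"
        using n(2) by (simp add: pos_le_divide_eq mult.commute)
      then have "ln \<rho> - ln K / real n \<le> ln (real (?d n)) / real n" by (simp add: add_divide_distrib)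
      then show "x < ln (real (?d n)) / real n" using n(1) by linarith
    qed
  qed
  obtain G where "split_generator D G" using D(2) by blast
  then show ?thesis using sph.D.entropy_eqI[OF _ lin_functor_ob[OF sph.T_lin] pos lim] unfolding \<rho>_def by blast
qed

end
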